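(* (Chordal part.) For every $s\in\mathfrak{P}_b({\bf M}^0(\mathbb R))$, let $\mu_t=s(t)$, let $f_t:\mathbb C^+\to\mathbb C^+\setminus\mathcal K_t$ be the inverse of the solution $g_t$ of the chordal Löwner equation driven by $(\mu_t)$, and let $\nu_t$ be the unique probability measure on $\mathbb R$ with $\frac{1}{f_t(z)}=\int_{\mathbb R}\frac{\nu_t(dx)}{z-x}$ for all $z\in\mathbb C^+$. Then $t\mapsto \nu_t$ belongs to $\mathfrak{P}({\bf M}_1^0(\mathbb R))$, so that $(\mathfrak{CL}(s))(t)=\nu_t$ defines a map $$\mathfrak{CL}:\mathfrak{P}_b({\bf M}^0(\mathbb R))\to\mathfrak{P}({\bf M}_1^0(\mathbb R)),$$ and $(\mathfrak{CL}(s))(0)=\delta_0$ for each $s\in\mathfrak{P}_b({\bf M}^0(\mathbb R))$. The unique fixed point $s$ of this map is the free convolution semigroup of the semicircle law; that is, $\mathfrak{CL}(s)=s$ if and only if $\mu_t=s(t)$ has $R$-transform $R(z)=tz$ for each $t\in[0,\infty)$. (Radial part.) For every $s\in\mathfrak{P}_b({\bf M}(\mathbb T))$, let $\mu_t=s(t)$, let $f_t:\mathbb D\to\mathbb D\setminus\mathcal K_t$ be the inverse of the solution $g_t$ of the radial Löwner equation driven by $(\mu_t)$, and let $\nu_t$ be the unique probability measure on $\mathbb T$ with $\frac{f_t(z)}{1-f_t(z)}=\int_0^{2\pi}\frac{ze^{-i\theta}}{1-ze^{-i\theta}}\,\nu_t(d\theta)$ for all $z\in\mathbb D$. Then $t\mapsto\nu_t$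 belongs to $\mathfrak{P}({\bf M}_1(\mathbb T))$, so that $(\mathfrak{RL}(s))(t)=\nu_t$ defines a map $$\mathfrak{RL}:\mathfrak{P}_b({\bf M}(\mathbb T))\to\mathfrak{P}({\bf M}_1(\mathbb T)),$$ and $(\mathfrak{RL}(s))(0)=\delta_1$ for each $s\in\mathfrak{P}_b({\bf M}(\mathbb T))$. Furthermore, for $s\in\mathfrak{P}_b({\bf M}(\mathbb T))$, $\mathfrak{RL}(s)=s$ if and only if $\mu_t=s(t)$ has $S$-transform $\exp\left(2t\left(z+\tfrac12\right)\right)$ for each $t\in[0,\infty)$.
   Context: Notation: $\mathbb C^\pm=\{z\in\mathbb C:\pm\mathrm{Im}(z)>0\}$, $\mathbb D$ is the open unit disk, $\mathbb T=\{z\in\mathbb C:|z|=1\}$. Measure spaces. ${\bf M}^0(\mathbb R)$ is the set of nonzero Borel measures $\mu$ on $\mathbb R$ with finite total mass and bounded support; ${\bf M}_1^0(\mathbb R)$ is the subset of probability measures. ${\bf M}(\mathbb T)$ is the set of finite positive Borel measures on $\mathbb T$ and ${\bf M}_1(\mathbb T)$ the subset of probability measures. All carry the topology of weak convergence (tested against bounded continuous functions). For $X$ one of these spaces, $\mathfrak P(X)=C([0,\infty);X)$ is the set of continuous paths, and $\mathfrak P_b(X)$ is the set of paths $s\in\mathfrak P(X)$, $s(t)=\mu_t$, whose total masses are uniformly bounded: $\sup_{t\ge0}\mu_t(\mathbb R)<\infty$ (resp. $\sup_{t\ge 0}\mu_t(\mathbb T)<\infty$). Measures on $\mathbb T$ are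 identified with measures on $[0,2\pi)$. Chordal Löwner equation. For $s\in\mathfrak P_b({\bf M}^0(\mathbb R))$, $\mu_t=s(t)$, and $z\in\mathbb C^+$, let $g_t(z)$ solve $$\partial_t g_t(z)=\int_{\mathbb R}\frac{\mu_t(dx)}{g_t(z)-x},\qquad g_0(z)=z,$$ up to its maximal existence time $T_z\in(0,\infty]$, and let $\mathcal K_t$ be the closure of $\{z\in\mathbb C^+:T_z\le t\}$. Then $g_t$ is a conformal map of $\mathbb C^+\setminus\mathcal K_t$ onto $\mathbb C^+$; $f_t=g_t^{-1}$. Radial Löwner equation. For $s\in\mathfrak P_b({\bf M}(\mathbb T))$, $\mu_t=s(t)$, and $z\in\mathbb D$, let $g_t(z)$ solve $$\partial_t g_t(z)=g_t(z)\int_0^{2\pi}\frac{e^{i\theta}+g_t(z)}{e^{i\theta}-g_t(z)}\,\mu_t(d\theta),\qquad g_0(z)=z,$$ up to its maximal existence time $T_z\in(0,\infty]$, and let $\mathcal K_t$ be the closure of $\{z\in\mathbb D:T_z\le t\}$. Then $g_t$ is a conformal map of $\mathbb D\setminus\mathcal K_t$ onto $\mathbb D$ with $g_t(0)=0$, $g_t'(0)>0$; $f_t=g_t^{-1}$. $R$-transform. For a probability measure $\mu$ on $\mathbb R$, $G_\mu(z)=\int_{\mathbb R}\frac{\mu(dx)}{z-x}$ is its Cauchy transform on $\mathbb C^+$. For every $\alpha>0$ there is $\beta>0$ such that $G_\mu$ has a right inverse $K_\mu$ on $\Theta_{\alpha,\beta}=\{z\in\mathbb C^-:\alpha\,\mathrm{Im}(z)<\mathrm{Re}(z)<-\alpha\,\mathrm{Im}(z),\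 |z|<\beta\}$, taking values in some domain $\{z\in\mathbb C^+:-\gamma\,\mathrm{Im}(z)<\mathrm{Re}(z)<\gamma\,\mathrm{Im}(z),\ |z|>\delta\}$ with $\gamma,\delta>0$. The $R$-transform is $R_\mu(z)=K_\mu(z)-\frac1z$. The centered semicircle law with variance $t>0$ has density $\frac{1}{2\pi t}\sqrt{4t-x^2}$ on $(-2\sqrt t,2\sqrt t)$ and $R$-transform $tz$; $\delta_0$ has $R$-transform $0$. The free convolution semigroup of the semicircle law is the family with $R$-transforms $tz$, $t\ge0$. $S$-transform. For a probability measure $\mu$ on $\mathbb T$ with nonzero mean, let $\psi_\mu(z)=\int_0^{2\pi}\frac{ze^{-i\theta}}{1-ze^{-i\theta}}\,\mu(d\theta)$, let $\chi_\mu$ be its (formal) inverse at $0$, $\psi_\mu(\chi_\mu(z))=z$, and $S_\mu(z)=\frac{1+z}{z}\chi_\mu(z)$.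
   Formalization: That ν_t has bounded support (the chordal map lands in P(M_1^0(R))) is asserted only when the supports of μ_t are bounded on compact time intervals; it fails for δ_0+(1−t)δ_{1/(1−t)}. For other paths ν_t is shown to be a continuous path of probability measures. *)

theory Defs
  imports "HOL-Probability.Probability" "HOL-Complex_Analysis.Complex_Analysis"
begin

section \<open>Spaces of measures and paths of measures\<close>

definition finite_measures_on :: "'a::topological_space set \<Rightarrow> 'a measure set" where
  "finite_measures_on X = {\<mu>. finite_measure \<mu> \<and> sets \<mu> = sets (restrict_space borel X)}"

definition prob_measures_on :: "'a::topological_space set \<Rightarrow> 'a measure set" where
  "prob_measures_on X = {\<mu> \<in> finite_measures_on X. prob_space \<mu>}"

definition msupport :: "real measure \<Rightarrow> real set" where
  "msupport \<mu> = {x. \<forall>U. open U \<and> x \<in> U \<longrightarrow> emeasure \<mu> U \<noteq> 0}"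

definition M0_real :: "real measure set" where
  "M0_real = {\<mu> \<in> finite_measures_on UNIV. emeasure \<mu> UNIV \<noteq> 0 \<and> bounded (msupport \<mu>)}"

definition M01_real :: "real measure set" where
  "M01_real = {\<mu> \<in> M0_real. prob_space \<mu>}"

text \<open>The circle measures are measures on \<^term>\<open>sphere (0::complex) 1\<close>, with the integration
  variable \<open>\<zeta> = exp (\<i> \<theta>)\<close> in place of \<open>\<theta> \<in> [0, 2\<pi>)\<close>; test functions for weak
  convergence are thus continuous on the circle, not merely on the interval.\<close>

abbreviation M_circle :: "complex measure set" where
  "M_circle \<equiv> finite_measures_on (sphere 0 1)"

abbreviation M1_circle :: "complex measure set" where
  "M1_circle \<equiv> prob_measures_on (sphere 0 1)"

text \<open>The initial topology on \<open>A\<close> (a set of measures on \<open>X\<close>) for integration against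
  bounded continuous functions on \<open>X\<close>.\<close>

definition weak_topology ::
    "'a::topological_space set \<Rightarrow> 'a measure set \<Rightarrow> 'a measure topology" where
  "weak_topology X A = topology_generated_by
     {{\<mu> \<in> A. (LINT x|\<mu>. \<phi> x) \<in> U} | (\<phi> :: 'a \<Rightarrow> real) U.
        continuous_on X \<phi> \<and> bounded (\<phi> ` X) \<and> open U}"

text \<open>Paths are indexed by \<^typ>\<open>real\<close>; only their values on \<open>[0, \<infinity>)\<close> matter.\<close>

definition paths ::
    "'a::topological_space set \<Rightarrow> 'a measure set \<Rightarrow> (real \<Rightarrow> 'a measure) set" where
  "paths X A = {s. continuous_map (top_of_set {0..}) (weak_topology X A) s}"

definition bounded_paths ::
    "'a::topological_space set \<Rightarrow> 'a measure set \<Rightarrow> (real \<Rightarrow> 'a measure) set" where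
  "bounded_paths X A = {s \<in> paths X A. bdd_above ((\<lambda>t. measure (s t) X) ` {0..})}"

lemma topspace_weak_topology [simp]: "topspace (weak_topology X A) = A"
proof -
  have "A \<in> {{\<mu> \<in> A. (LINT x|\<mu>. \<phi> x) \<in> U} | (\<phi> :: 'a \<Rightarrow> real) U.
        continuous_on X \<phi> \<and> bounded (\<phi> ` X) \<and> open U}"
    by (rule CollectI, rule exI[of _ "\<lambda>_. 0"], rule exI[of _ UNIV]) (auto simp: image_constant_conv)
  then show ?thesis
    unfolding weak_topology_def topology_generated_by_topspace by blast
qed

lemma paths_iff:
  "s \<in> paths X A \<longleftrightarrow> (\<forall>t\<ge>0. s t \<in> A) \<and>
     (\<forall>\<phi> :: 'a::topological_space \<Rightarrow> real. continuous_on X \<phi> \<and> bounded (\<phi> ` X) \<longrightarrow>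
        continuous_on {0..} (\<lambda>t. LINT x|s t. \<phi> x))"
proof (intro iffI conjI allI impI)
  assume s: "s \<in> paths X A"
  then have A: "s t \<in> A" if "t \<ge> 0" for t
    using that unfolding paths_def continuous_map_def by auto
  then show "s t \<in> A" if "t \<ge> 0" for t using that .
  fix \<phi> :: "'a \<Rightarrow> real"
  assume \<phi>: "continuous_on X \<phi> \<and> bounded (\<phi> ` X)"
  show "continuous_on {0..} (\<lambda>t. LINT x|s t. \<phi> x)"
    unfolding continuous_on_open_gen[of _ _ UNIV, simplified]
  proof (intro allI impI)
    fix U :: "real set"
    assume "open U"
    then have "openin (weak_topology X A) {\<mu> \<in> A. (LINT x|\<mu>. \<phi> x) \<in> U}"
      unfolding weak_topology_def using \<phi> by (intro topology_generated_by_Basis) auto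
    with s have "openin (top_of_set {0..}) {t \<in> {0..}. s t \<in> {\<mu> \<in> A. (LINT x|\<mu>. \<phi> x) \<in> U}}"
      unfolding paths_def continuous_map_def by auto
    moreover have "{t \<in> {0..}. s t \<in> {\<mu> \<in> A. (LINT x|\<mu>. \<phi> x) \<in> U}}
        = {0..} \<inter> (\<lambda>t. LINT x|s t. \<phi> x) -` U"
      using A by auto
    ultimately show "openin (top_of_set {0..}) ({0..} \<inter> (\<lambda>t. LINT x|s t. \<phi> x) -` U)"
      by simp
  qed
next
  assume s: "(\<forall>t\<ge>0. s t \<in> A) \<and>
     (\<forall>\<phi> :: 'a \<Rightarrow> real. continuous_on X \<phi> \<and> bounded (\<phi> ` X) \<longrightarrow>
        continuous_on {0..} (\<lambda>t. LINT x|s t. \<phi> x))"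
  show "s \<in> paths X A"
    unfolding paths_def mem_Collect_eq weak_topology_def
  proof (rule continuous_on_generated_topo)
    fix V
    assume "V \<in> {{\<mu> \<in> A. (LINT x|\<mu>. \<phi> x) \<in> U} | (\<phi> :: 'a \<Rightarrow> real) U.
        continuous_on X \<phi> \<and> bounded (\<phi> ` X) \<and> open U}"
    then obtain \<phi> :: "'a \<Rightarrow> real" and U where
      V: "V = {\<mu> \<in> A. (LINT x|\<mu>. \<phi> x) \<in> U}" and "continuous_on X \<phi>" "bounded (\<phi> ` X)" "open U"
      by auto
    then have "openin (top_of_set {0..}) ({0..} \<inter> (\<lambda>t. LINT x|s t. \<phi> x) -` U)"
      using s continuous_openin_preimage_gen by blast
    moreover have "s -` V \<inter> topspace (top_of_set {0..}) = {0..} \<inter> (\<lambda>t. LINT x|s t. \<phi> x) -` U"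
      using s V by auto
    ultimately show "openin (top_of_set {0..}) (s -` V \<inter> topspace (top_of_set {0..}))"
      by simp
  next
    show "s ` topspace (top_of_set {0..}) \<subseteq> \<Union> {{\<mu> \<in> A. (LINT x|\<mu>. \<phi> x) \<in> U} |
        (\<phi> :: 'a \<Rightarrow> real) U. continuous_on X \<phi> \<and> bounded (\<phi> ` X) \<and> open U}"
      using s topspace_weak_topology[of X A]
      unfolding weak_topology_def topology_generated_by_topspace by auto
  qed
qed

text \<open>A weakly continuous path in \<^const>\<open>M0_real\<close> may carry a vanishing amount of mass that
  escapes to infinity in finite time, e.g.\ \<open>\<mu>\<^sub>t = \<delta>\<^sub>0 + (1 - t) \<delta>\<^bsub>1/(1-t)\<^esub>\<close> for \<open>t < 1\<close> and
  \<open>\<mu>\<^sub>t = \<delta>\<^sub>0\<close> for \<open>t \<ge> 1\<close>. For this path the hull at time 1 is unbounded and so is the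
  support of the associated probability measure. Boundedness of the supports is therefore
  only inherited from paths satisfying the following condition.\<close>

definition locally_bounded_support :: "(real \<Rightarrow> real measure) \<Rightarrow> bool" where
  "locally_bounded_support s \<longleftrightarrow> (\<forall>T. bounded (\<Union>t\<in>{0..T}. msupport (s t)))"

section \<open>Loewner flows\<close>

text \<open>Flow of the time-dependent vector field \<open>V\<close> on the phase space \<open>D\<close>. Solutions are
  required to stay in \<open>D\<close>, and the lifetime is the maximal existence time in \<open>D\<close>.\<close>

definition flow_solution ::
    "complex set \<Rightarrow> (real \<Rightarrow> complex \<Rightarrow> complex) \<Rightarrow> complex \<Rightarrow> real \<Rightarrow> (real \<Rightarrow> complex) \<Rightarrow> bool" where
  "flow_solution D V z T h \<longleftrightarrow> 0 < T \<and> h 0 = z \<and>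
     (\<forall>t\<in>{0..<T}. h t \<in> D \<and> (h has_vector_derivative V t (h t)) (at t within {0..<T}))"

definition lifetime ::
    "complex set \<Rightarrow> (real \<Rightarrow> complex \<Rightarrow> complex) \<Rightarrow> complex \<Rightarrow> ereal" where
  "lifetime D V z = Sup {ereal T | T. \<exists>h. flow_solution D V z T h}"

definition loewner_hull ::
    "complex set \<Rightarrow> (real \<Rightarrow> complex \<Rightarrow> complex) \<Rightarrow> real \<Rightarrow> complex set" where
  "loewner_hull D V t = closure {z \<in> D. lifetime D V z \<le> ereal t}"

definition flow ::
    "complex set \<Rightarrow> (real \<Rightarrow> complex \<Rightarrow> complex) \<Rightarrow> real \<Rightarrow> complex \<Rightarrow> complex" where
  "flow D V t z = (THE w. \<exists>T h. flow_solution D V z T h \<and> t < T \<and> h t = w)"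

definition inverse_flow ::
    "complex set \<Rightarrow> (real \<Rightarrow> complex \<Rightarrow> complex) \<Rightarrow> real \<Rightarrow> complex \<Rightarrow> complex" where
  "inverse_flow D V t = inv_into (D - loewner_hull D V t) (flow D V t)"

section \<open>The chordal case\<close>

abbreviation upper_half :: "complex set" where
  "upper_half \<equiv> {z. Im z > 0}"

definition cauchy_transform :: "real measure \<Rightarrow> complex \<Rightarrow> complex" where
  "cauchy_transform \<mu> z = (LINT x|\<mu>. 1 / (z - complex_of_real x))"

definition chordal_f :: "(real \<Rightarrow> real measure) \<Rightarrow> real \<Rightarrow> complex \<Rightarrow> complex" where
  "chordal_f s = inverse_flow upper_half (\<lambda>t. cauchy_transform (s t))"

definition chordal_measure :: "(real \<Rightarrow> real measure) \<Rightarrow> real \<Rightarrow> real measure \<Rightarrow> bool" where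
  "chordal_measure s t \<nu> \<longleftrightarrow> \<nu> \<in> prob_measures_on UNIV \<and>
     (\<forall>z\<in>upper_half. 1 / chordal_f s t z = cauchy_transform \<nu> z)"

definition CL :: "(real \<Rightarrow> real measure) \<Rightarrow> real \<Rightarrow> real measure" where
  "CL s t = (THE \<nu>. chordal_measure s t \<nu>)"

definition lower_cone :: "real \<Rightarrow> real \<Rightarrow> complex set" where
  "lower_cone \<alpha> \<beta> = {z. Im z < 0 \<and> \<alpha> * Im z < Re z \<and> Re z < - \<alpha> * Im z \<and> cmod z < \<beta>}"

definition upper_cone :: "real \<Rightarrow> real \<Rightarrow> complex set" where
  "upper_cone \<gamma> \<delta> = {z. Im z > 0 \<and> - \<gamma> * Im z < Re z \<and> Re z < \<gamma> * Im z \<and> cmod z > \<delta>}"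

definition cauchy_right_inverse ::
    "real measure \<Rightarrow> real \<Rightarrow> real \<Rightarrow> (complex \<Rightarrow> complex) \<Rightarrow> bool" where
  "cauchy_right_inverse \<mu> \<alpha> \<beta> K \<longleftrightarrow>
     (\<exists>\<gamma>>0. \<exists>\<delta>>0. \<forall>z\<in>lower_cone \<alpha> \<beta>. K z \<in> upper_cone \<gamma> \<delta> \<and> cauchy_transform \<mu> (K z) = z)"

text \<open>The right inverse is unique near 0 in each cone, so this determines the germ of \<open>R\<close> at 0
  in each cone \<open>{z. Im z < 0 \<and> \<bar>Re z\<bar> < \<alpha> \<bar>Im z\<bar>}\<close>.\<close>

definition has_R_transform :: "real measure \<Rightarrow> (complex \<Rightarrow> complex) \<Rightarrow> bool" where
  "has_R_transform \<mu> R \<longleftrightarrow> \<mu> \<in> prob_measures_on UNIV \<and>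
     (\<forall>\<alpha>>0. \<exists>\<beta>>0. \<exists>K. cauchy_right_inverse \<mu> \<alpha> \<beta> K \<and>
        (\<forall>z\<in>lower_cone \<alpha> \<beta>. R z = K z - 1 / z))"

definition semicircle_law :: "real \<Rightarrow> real measure" where
  "semicircle_law t =
     (if t \<le> 0 then return borel 0
      else density lborel (\<lambda>x. ennreal (indicator {- 2 * sqrt t <..< 2 * sqrt t} x *
             (sqrt (4 * t - x\<^sup>2) / (2 * pi * t)))))"

section \<open>The radial case\<close>

abbreviation unit_disc :: "complex set" where
  "unit_disc \<equiv> ball 0 1"

definition radial_field :: "complex measure \<Rightarrow> complex \<Rightarrow> complex" where
  "radial_field \<mu> w = w * (LINT \<zeta>|\<mu>. (\<zeta> + w) / (\<zeta> - w))"

definition radial_f :: "(real \<Rightarrow> complex measure) \<Rightarrow> real \<Rightarrow> complex \<Rightarrow> complex" where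
  "radial_f s = inverse_flow unit_disc (\<lambda>t. radial_field (s t))"

definition psi :: "complex measure \<Rightarrow> complex \<Rightarrow> complex" where
  "psi \<mu> z = (LINT \<zeta>|\<mu>. z * cnj \<zeta> / (1 - z * cnj \<zeta>))"

definition radial_measure :: "(real \<Rightarrow> complex measure) \<Rightarrow> real \<Rightarrow> complex measure \<Rightarrow> bool" where
  "radial_measure s t \<nu> \<longleftrightarrow> \<nu> \<in> M1_circle \<and>
     (\<forall>z\<in>unit_disc. radial_f s t z / (1 - radial_f s t z) = psi \<nu> z)"

definition RL :: "(real \<Rightarrow> complex measure) \<Rightarrow> real \<Rightarrow> complex measure" where
  "RL s t = (THE \<nu>. radial_measure s t \<nu>)"

text \<open>The formal power series \<open>((1 + z) / z) \<chi>(z)\<close>. The product below has vanishing constant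
  term, so the division by \<^term>\<open>fps_X\<close> is exact. It is meaningful when the mean is nonzero,
  as the linear coefficient of \<^const>\<open>psi\<close> is the conjugate of the mean.\<close>

definition S_transform :: "complex measure \<Rightarrow> complex fps" where
  "S_transform \<mu> = ((1 + fps_X) * fps_inv (fps_expansion (psi \<mu>) 0)) / fps_X"

definition has_S_transform :: "complex measure \<Rightarrow> (complex \<Rightarrow> complex) \<Rightarrow> bool" where
  "has_S_transform \<mu> S \<longleftrightarrow> \<mu> \<in> M1_circle \<and> (LINT \<zeta>|\<mu>. \<zeta>) \<noteq> 0 \<and>
     S_transform \<mu> = fps_expansion S 0"

end

theory Submission
  imports Defs
begin

text \<open>
  The maps \<open>CL\<close> and \<open>RL\<close> are well defined because the Loewner equations, read backwards in time,
  never reach the boundary. The chordal velocity \<open>G\<close> has negative imaginary part, so the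
  imaginary part of a solution can only grow when time runs backwards; in the disc the modulus can
  only shrink. Hence the solution that ends at a given point \<open>z\<close> at time \<open>t\<close> exists on the whole of
  \<open>[0, t]\<close>, and its initial value is \<open>f\<^sub>t z\<close>. The locale \<open>loewner_field\<close> carries out this argument
  for both equations at once. The regularity of \<open>f\<^sub>t\<close> in \<open>z\<close> comes from one formula: if the velocity has
  the divided difference \<open>W\<close>, two solutions satisfy
  \<open>h - k = (h 0 - k 0) exp (\<integral> W(h, k))\<close>. This gives injectivity, Lipschitz bounds and the complex
  derivative of \<open>f\<^sub>t\<close>, and it identifies \<open>D - K\<^sub>t\<close> with the range of \<open>f\<^sub>t\<close>.

  Existence of \<open>\<nu>\<^sub>t\<close> is a representation theorem. In the disc, \<open>(1 + f\<^sub>t) / (1 - f\<^sub>t)\<close> has nonnegative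
  real part and value 1 at 0, so the Herglotz theorem applies. In the half-plane, \<open>1 / f\<^sub>t\<close> maps
  into the lower half-plane and is asymptotic to \<open>1 / z\<close>, which characterises Cauchy transforms of
  probability measures (\<open>cauchy_representation\<close>, deduced from the Herglotz theorem by a Cayley
  transform). Uniqueness, and continuity of \<open>t \<mapsto> \<nu>\<^sub>t\<close>, both follow from one principle: among
  probability measures, pointwise convergence of \<open>psi\<close> or of Cauchy transforms implies weak
  convergence (\<open>circle_weak_convergence\<close>, \<open>line_weak_convergence\<close>); the Taylor coefficients of
  \<open>psi\<close> at 0 are the moments, and trigonometric polynomials are dense. If the
  driving measures up to time \<open>t\<close> have supports in a common bounded set, then far from it a trajectory
  changes its imaginary part by a bounded factor only. So \<open>Im (1 / f\<^sub>t)\<close> vanishes to first order on the real line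
  there, and \<open>\<nu>\<^sub>t\<close> has no mass there (\<open>CL_support_bounded\<close>).

  The fixed points are found by looking at a single trajectory. If \<open>CL s = s\<close>, the velocity at time
  \<open>\<tau>\<close> along the trajectory \<open>h\<close> starting at \<open>\<zeta>\<close> is \<open>G(h \<tau>) = 1 / f\<^sub>\<tau> (h \<tau>) = 1 / \<zeta>\<close>, which does not
  depend on \<open>\<tau>\<close>. So \<open>h \<tau> = \<zeta> + \<tau> / \<zeta>\<close>, and the Cauchy transform of \<open>s t\<close> inverts
  \<open>\<xi> \<mapsto> t \<xi> + 1 / \<xi>\<close>: this is the semicircle law, with R-transform \<open>t z\<close>. In the disc the
  logarithmic velocity along a trajectory of a fixed point is the constant \<open>(1 + \<zeta>) / (1 - \<zeta>)\<close>, so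
  \<open>h \<tau> = \<zeta> exp (\<tau> (1 + \<zeta>) / (1 - \<zeta>))\<close>. In the coordinate \<open>u = \<zeta> / (1 - \<zeta>)\<close> this says that
  \<open>\<chi>\<^sub>t u = u / (1 + u) exp (t (1 + 2 u))\<close>, that is, \<open>S\<^sub>t u = exp (2 t (u + 1 / 2))\<close>. Both
  computations can be reversed.
\<close>

section \<open>Global existence for Lipschitz equations\<close>

text \<open>Banach's fixed point theorem, applied once on the whole interval: with the weight
  \<open>exp (2 M \<bar>s - t0\<bar>)\<close> the integral operator contracts by a factor \<open>1/2\<close> on any compact interval,
  so that no local solutions have to be glued. The interval may extend to both sides of the
  initial time; the Loewner equation is solved mainly backwards.\<close>

lemma picard_lindeloef_global:
  fixes v :: "real \<Rightarrow> 'a::banach \<Rightarrow> 'a" and z :: 'a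
  assumes t0: "t0 \<in> {a..b}"
    and cont: "continuous_on ({a..b} \<times> UNIV) (\<lambda>(t, x). v t x)"
    and lip: "\<And>t x y. t \<in> {a..b} \<Longrightarrow> norm (v t x - v t y) \<le> L * norm (x - y)"
  obtains h where "h t0 = z"
    "\<And>t. t \<in> {a..b} \<Longrightarrow> (h has_vector_derivative v t (h t)) (at t within {a..b})"
proof -
  define M where "M = max L 1"
  have M: "M > 0" unfolding M_def by simp
  have lipM: "norm (v t x - v t y) \<le> M * norm (x - y)" if "t \<in> {a..b}" for t x y
    using lip[OF that, of x y] unfolding M_def
    by (smt (verit) mult_right_mono norm_ge_zero)
  have v_cont: "continuous_on {a..b} (\<lambda>s. v s (u s))" if "continuous_on {a..b} u" for u
  proof -
    have "continuous_on {a..b} (\<lambda>s. (s, u s))" using that by (intro continuous_intros)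
    from continuous_on_compose2[OF cont this] show ?thesis by auto
  qed
  define e where "e s = exp (2 * M * \<bar>s - t0\<bar>)" for s
  have e_cont: "continuous_on S e" for S unfolding e_def by (intro continuous_intros)
  define u where "u \<phi> s = e s *\<^sub>R apply_bcontfun \<phi> s" for \<phi> :: "real \<Rightarrow>\<^sub>C 'a" and s
  have u_cont: "continuous_on S (u \<phi>)" for \<phi> S
    unfolding u_def by (intro continuous_intros e_cont)
      (metis continuous_on_subset continuous_on_apply_bcontfun subset_UNIV)
  define J where "J \<phi> t = integral {a..t} (\<lambda>s. v s (u \<phi> s))" for \<phi> t
  have J_deriv: "(J \<phi> has_vector_derivative v t (u \<phi> t)) (at t within {a..b})"
    if "t \<in> {a..b}" for \<phi> t
    unfolding J_def using integral_has_vector_derivative[OF v_cont[OF u_cont]] that by blast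
  have J_cont: "continuous_on {a..b} (J \<phi>)" for \<phi>
    using J_deriv by (meson continuous_on_eq_continuous_within has_vector_derivative_continuous)
  \<comment> \<open>Bounded continuous functions live on the whole line, so the time is clamped to the interval.\<close>
  define c where "c t = max a (min b t)" for t
  have c_in: "c t \<in> {a..b}" for t using t0 unfolding c_def by auto
  have c_id: "c t = t" if "t \<in> {a..b}" for t using that unfolding c_def by auto
  define T where "T \<phi> t = (1 / e (c t)) *\<^sub>R (z + (J \<phi> (c t) - J \<phi> t0))" for \<phi> t
  have e_pos: "e s > 0" for s unfolding e_def by simp
  have T_bc: "T \<phi> \<in> bcontfun" for \<phi>
  proof -
    have c_cont: "continuous_on UNIV c" unfolding c_def by (intro continuous_intros)
    define G where "G t = (1 / e t) *\<^sub>R (z + (J \<phi> t - J \<phi> t0))" for t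
    have G: "continuous_on {a..b} G" unfolding G_def using e_pos
      by (intro continuous_intros e_cont J_cont) (simp add: less_imp_neq[symmetric])
    have TG: "T \<phi> = (\<lambda>t. G (c t))" unfolding T_def G_def by simp
    have T_cont: "continuous_on UNIV (T \<phi>)" unfolding TG
      by (rule continuous_on_compose2[OF G c_cont]) (use c_in in auto)
    have "compact (G ` {a..b})" using G by (intro compact_continuous_image) auto
    then have "bounded (G ` {a..b})" by (rule compact_imp_bounded)
    then obtain K where "\<forall>x\<in>G ` {a..b}. norm x \<le> K" using bounded_iff by blast
    then have "norm (T \<phi> t) \<le> K" for t unfolding TG using c_in by blast
    then show ?thesis using T_cont by (rule bcontfun_normI[rotated])
  qed
  have contr: "dist (Bcontfun (T \<phi>)) (Bcontfun (T \<psi>)) \<le> (1/2) * dist \<phi> \<psi>" for \<phi> \<psi>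
  proof (rule dist_bound)
    fix t
    define D where "D = dist \<phi> \<psi>"
    define \<delta> where "\<delta> s = J \<phi> s - J \<psi> s" for s
    have \<delta>_deriv: "(\<delta> has_vector_derivative (v s (u \<phi> s) - v s (u \<psi> s))) (at s within {a..b})"
      if "s \<in> {a..b}" for s
      unfolding \<delta>_def by (intro has_vector_derivative_diff J_deriv that)
    have \<delta>_cont: "continuous_on {a..b} \<delta>"
      unfolding \<delta>_def by (intro continuous_intros J_cont)
    have bound: "norm (v s (u \<phi> s) - v s (u \<psi> s)) \<le> M * e s * D" if "s \<in> {a..b}" for s
    proof -
      have "norm (u \<phi> s - u \<psi> s) = e s * dist (\<phi> s) (\<psi> s)"
        unfolding u_def using e_pos[of s]
        by (simp add: dist_norm flip: scaleR_diff_right)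
      also have "\<dots> \<le> e s * D" unfolding D_def using e_pos[of s] dist_bounded[of \<phi> s \<psi>] by simp
      finally show ?thesis using lipM[OF that, of "u \<phi> s" "u \<psi> s"] M
        by (smt (verit, best) mult.assoc mult_left_mono)
    qed
    have key: "norm (\<delta> r - \<delta> t0) \<le> e r * D / 2" if r: "r \<in> {a..b}" for r
    proof (cases r t0 rule: linorder_cases)
      case greater
      have "norm (\<delta> r - \<delta> t0) \<le> exp (2 * M * (r - t0)) * D / 2 - exp (2 * M * (t0 - t0)) * D / 2"
      proof (rule differentiable_bound_general[OF greater])
        show "continuous_on {t0..r} \<delta>"
          by (rule continuous_on_subset[OF \<delta>_cont]) (use r t0 in auto)
        show "continuous_on {t0..r} (\<lambda>s. exp (2 * M * (s - t0)) * D / 2)"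
          by (intro continuous_intros) auto
        fix s assume s: "t0 < s" "s < r"
        then have "s \<in> interior {a..b}" using r t0 by simp
        then have "at s within {a..b} = at s" by (rule at_within_interior)
        moreover have "s \<in> {a..b}" using s r t0 by simp
        ultimately show "(\<delta> has_vector_derivative (v s (u \<phi> s) - v s (u \<psi> s))) (at s)"
          using \<delta>_deriv[of s] by (simp only:)
        have lin: "((\<lambda>s. 2 * M * (s - t0)) has_real_derivative 2 * M) (at s)"
          by (auto intro!: derivative_eq_intros)
        have "((\<lambda>s. exp (2 * M * (s - t0)) * D / 2) has_real_derivative M * e s * D) (at s)"
          using DERIV_cdivide[OF DERIV_cmult_right[OF DERIV_fun_exp[OF lin]], of D 2] s
          unfolding e_def by (simp add: mult.commute mult.left_commute)
        then show "((\<lambda>s. exp (2 * M * (s - t0)) * D / 2) has_vector_derivative M * e s * D) (at s)"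
          by (simp add: has_real_derivative_iff_has_vector_derivative)
        show "norm (v s (u \<phi> s) - v s (u \<psi> s)) \<le> M * e s * D" using bound s r t0 by auto
      qed
      also have "\<dots> \<le> e r * D / 2" unfolding e_def D_def using greater by simp
      finally show ?thesis .
    next
      case less
      have "norm (\<delta> t0 - \<delta> r) \<le> (- exp (2 * M * (t0 - t0)) * D / 2) - (- exp (2 * M * (t0 - r)) * D / 2)"
      proof (rule differentiable_bound_general[OF less])
        show "continuous_on {r..t0} \<delta>"
          by (rule continuous_on_subset[OF \<delta>_cont]) (use r t0 in auto)
        show "continuous_on {r..t0} (\<lambda>s. - exp (2 * M * (t0 - s)) * D / 2)"
          by (intro continuous_intros) auto
        fix s assume s: "r < s" "s < t0"
        then have "s \<in> interior {a..b}" using r t0 by simp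
        then have "at s within {a..b} = at s" by (rule at_within_interior)
        moreover have "s \<in> {a..b}" using s r t0 by simp
        ultimately show "(\<delta> has_vector_derivative (v s (u \<phi> s) - v s (u \<psi> s))) (at s)"
          using \<delta>_deriv[of s] by (simp only:)
        have lin: "((\<lambda>s. 2 * M * (t0 - s)) has_real_derivative - 2 * M) (at s)"
          by (auto intro!: derivative_eq_intros)
        have "((\<lambda>s. - exp (2 * M * (t0 - s)) * D / 2) has_real_derivative M * e s * D) (at s)"
          using DERIV_cdivide[OF DERIV_cmult_right[OF DERIV_minus[OF DERIV_fun_exp[OF lin]]], of D 2] s
          unfolding e_def by (simp add: mult.commute mult.left_commute)
        then show "((\<lambda>s. - exp (2 * M * (t0 - s)) * D / 2) has_vector_derivative M * e s * D) (at s)"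
          by (simp add: has_real_derivative_iff_has_vector_derivative)
        show "norm (v s (u \<phi> s) - v s (u \<psi> s)) \<le> M * e s * D" using bound s r t0 by auto
      qed
      also have "\<dots> \<le> e r * D / 2" unfolding e_def D_def using less by simp
      finally show ?thesis by (simp add: norm_minus_commute)
    qed (use e_pos[of r] in \<open>simp add: D_def\<close>)
    have "T \<phi> t - T \<psi> t = (1 / e (c t)) *\<^sub>R (\<delta> (c t) - \<delta> t0)"
      unfolding T_def \<delta>_def by (simp add: algebra_simps)
    then have "dist (T \<phi> t) (T \<psi> t) = (1 / e (c t)) * norm (\<delta> (c t) - \<delta> t0)"
      using e_pos[of "c t"] by (simp add: dist_norm)
    also have "\<dots> \<le> (1 / e (c t)) * (e (c t) * D / 2)"
      using e_pos[of "c t"] key[OF c_in] by (intro mult_left_mono) auto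
    also have "\<dots> = 1/2 * D" using e_pos[of "c t"] by simp
    finally show "dist (Bcontfun (T \<phi>) t) (Bcontfun (T \<psi>) t) \<le> (1/2) * dist \<phi> \<psi>"
      unfolding D_def by (simp add: Bcontfun_inverse T_bc)
  qed
  have "\<exists>!\<phi>. Bcontfun (T \<phi>) = \<phi>"
    by (rule banach_fix_type[of "1/2"]) (use contr in auto)
  then obtain \<phi> where \<phi>: "Bcontfun (T \<phi>) = \<phi>" by blast
  have fix_eq: "\<phi> t = T \<phi> t" for t
    using fun_cong[OF Bcontfun_inverse[OF T_bc[of \<phi>]], of t] unfolding \<phi> .
  have u_eq: "u \<phi> t = z + (J \<phi> t - J \<phi> t0)" if "t \<in> {a..b}" for t
  proof -
    have "u \<phi> t = e t *\<^sub>R T \<phi> t" unfolding u_def using fix_eq by simp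
    then show ?thesis unfolding T_def c_id[OF that] using e_pos[of t] by simp
  qed
  show ?thesis
  proof (rule that[of "\<lambda>t. z + (J \<phi> t - J \<phi> t0)"])
    fix t assume t: "t \<in> {a..b}"
    show "((\<lambda>t. z + (J \<phi> t - J \<phi> t0)) has_vector_derivative v t (z + (J \<phi> t - J \<phi> t0))) (at t within {a..b})"
      using has_vector_derivative_add[OF has_vector_derivative_const
        has_vector_derivative_diff[OF J_deriv[OF t, of \<phi>] has_vector_derivative_const]]
      unfolding u_eq[OF t] by simp
  qed simp
qed

section \<open>Loewner fields\<close>

lemma norm_exp_integral_le:
  fixes w :: "real \<Rightarrow> complex"
  assumes "0 \<le> t" "continuous_on {0..t} w" "\<And>s. s \<in> {0..t} \<Longrightarrow> norm (w s) \<le> C"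
  shows "norm (exp (integral {0..t} w)) \<le> exp (C * t)" "norm (exp (- integral {0..t} w)) \<le> exp (C * t)"
proof -
  have *: "norm (integral {0..t} w) \<le> C * t" using integral_bound[of 0 t w C] assms by simp
  have "Re (integral {0..t} w) \<le> norm (integral {0..t} w)" by (rule complex_Re_le_cmod)
  with * show "norm (exp (integral {0..t} w)) \<le> exp (C * t)" by simp
  have "- Re (integral {0..t} w) \<le> norm (integral {0..t} w)"
    using abs_Re_le_cmod[of "integral {0..t} w"] by linarith
  with * show "norm (exp (- integral {0..t} w)) \<le> exp (C * t)" by simp
qed

text \<open>The common structure of the two Loewner equations. The function \<open>\<rho>\<close> measures the distance to the
  boundary of the phase space \<open>{w. 0 < \<rho> w}\<close>: it is \<open>Im\<close> in the half-plane and \<open>1 - norm w\<close> in the disc.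
  The velocity \<open>V\<close> has a divided difference \<open>W\<close>; both are bounded, by \<open>B c\<close> and \<open>L c\<close>, on the
  level set \<open>{w. c \<le> \<rho> w}\<close>. Convexity of the level sets makes the nearest-point projection onto
  them available, and with it a globally Lipschitz modification of \<open>V\<close>. The assumption
  \<open>decreasing\<close> is stated for this modification, since its solutions are not yet known to stay in
  the level set; monotonicity of \<open>\<rho>\<close> along them is what proves that they do.\<close>

locale loewner_field =
  fixes \<rho> :: "complex \<Rightarrow> real"
    and V :: "real \<Rightarrow> complex \<Rightarrow> complex"
    and W :: "real \<Rightarrow> complex \<Rightarrow> complex \<Rightarrow> complex"
    and B L :: "real \<Rightarrow> real"
  assumes cont_rho: "continuous_on UNIV \<rho>"
    and convex_rho: "convex {w. c \<le> \<rho> w}"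
    and V_cont: "continuous_on ({0..} \<times> {w. 0 < \<rho> w}) (\<lambda>(t, w). V t w)"
    and W_cont: "continuous_on ({0..} \<times> {w. 0 < \<rho> w} \<times> {w. 0 < \<rho> w}) (\<lambda>(t, a, b). W t a b)"
    and divided_difference: "\<lbrakk>0 \<le> t; 0 < \<rho> a; 0 < \<rho> b\<rbrakk> \<Longrightarrow> V t a - V t b = W t a b * (a - b)"
    and V_bound: "\<lbrakk>0 \<le> t; 0 < c; c \<le> \<rho> a\<rbrakk> \<Longrightarrow> norm (V t a) \<le> B c"
    and W_bound: "\<lbrakk>0 \<le> t; 0 < c; c \<le> \<rho> a; c \<le> \<rho> b\<rbrakk> \<Longrightarrow> norm (W t a b) \<le> L c"
    and decreasing: "\<lbrakk>0 < c; \<exists>w. c \<le> \<rho> w; 0 \<le> t\<^sub>1; t\<^sub>1 \<le> t\<^sub>2;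
        \<And>t. t \<in> {t\<^sub>1..t\<^sub>2} \<Longrightarrow>
          (h has_vector_derivative V t (closest_point {w. c \<le> \<rho> w} (h t))) (at t within {t\<^sub>1..t\<^sub>2})\<rbrakk>
      \<Longrightarrow> \<rho> (h t\<^sub>2) \<le> \<rho> (h t\<^sub>1)"
begin

abbreviation D :: "complex set" where "D \<equiv> {w. 0 < \<rho> w}"

lemma open_D: "open D"
  using open_Collect_less[of "\<lambda>_. 0" \<rho>, OF continuous_on_const cont_rho] .

lemma closed_level: "closed {w. c \<le> \<rho> w}"
  using closed_Collect_le[of "\<lambda>_. c" \<rho>, OF continuous_on_const cont_rho] .

lemma V_continuous:
  assumes "continuous_on S h" "\<And>t. t \<in> S \<Longrightarrow> 0 \<le> t \<and> h t \<in> D"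
  shows "continuous_on S (\<lambda>t. V t (h t))"
proof -
  have "continuous_on S (\<lambda>t. (t, h t))" using assms by (intro continuous_intros)
  moreover have "(\<lambda>t. (t, h t)) ` S \<subseteq> {0..} \<times> D" using assms(2) by auto
  ultimately have "continuous_on S (\<lambda>t. case (t, h t) of (t, w) \<Rightarrow> V t w)"
    by (rule continuous_on_compose2[OF V_cont])
  then show ?thesis by simp
qed

lemma W_continuous:
  assumes "continuous_on S h" "continuous_on S k"
    "\<And>t. t \<in> S \<Longrightarrow> 0 \<le> t \<and> h t \<in> D \<and> k t \<in> D"
  shows "continuous_on S (\<lambda>t. W t (h t) (k t))"
proof -
  have "continuous_on S (\<lambda>t. (t, h t, k t))" using assms by (intro continuous_intros)
  moreover have "(\<lambda>t. (t, h t, k t)) ` S \<subseteq> {0..} \<times> D \<times> D" using assms(3) by auto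
  ultimately have "continuous_on S (\<lambda>t. case (t, h t, k t) of (t, a, b) \<Rightarrow> W t a b)"
    by (rule continuous_on_compose2[OF W_cont])
  then show ?thesis by simp
qed

text \<open>Backwards in time \<open>\<rho>\<close> increases, so the solution of the modified equation with value \<open>z\<close> at time
  \<open>t\<close> stays in the level set, where both equations agree. For a short time after \<open>t\<close> it remains
  there by continuity, because the level \<open>c\<close> is chosen as half of \<open>\<rho> z\<close>.\<close>

lemma solution_through:
  assumes t: "0 \<le> t" and z: "z \<in> D"
  obtains h T where "t < T" "flow_solution D V (h 0) T h" "h t = z"
    "\<And>\<tau>. \<tau> \<in> {0..t} \<Longrightarrow> \<rho> z \<le> \<rho> (h \<tau>)"
proof -
  define c where "c = \<rho> z / 2"
  define K where "K = {w. c \<le> \<rho> w}"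
  have c: "0 < c" "c < \<rho> z" using z unfolding c_def by auto
  have "z \<in> K" using c unfolding K_def by simp
  then have K: "K \<noteq> {}" "closed K" "convex K" "K \<subseteq> D"
    using c(1) closed_level[of c] convex_rho[of c] unfolding K_def by auto
  define v where "v s w = V s (closest_point K w)" for s w
  have cp: "closest_point K w \<in> K" for w using K by (intro closest_point_in_set) auto
  obtain h :: "real \<Rightarrow> complex" where h: "h t = z"
    "\<And>s. s \<in> {0..t+1} \<Longrightarrow> (h has_vector_derivative v s (h s)) (at s within {0..t+1})"
  proof (rule picard_lindeloef_global[of t 0 "t+1" v "L c" z])
    show "t \<in> {0..t+1}" using t by simp
    have "continuous_on ({0..t+1} \<times> UNIV) (\<lambda>p. (fst p, closest_point K (snd p)))"
      by (intro continuous_on_Pair continuous_on_fst continuous_on_snd continuous_on_id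
          continuous_on_compose2[OF continuous_on_closest_point[OF K(3,2,1), of UNIV]]) simp
    moreover have "(\<lambda>p. (fst p, closest_point K (snd p))) ` ({0..t+1} \<times> UNIV) \<subseteq> {0..} \<times> D"
      using cp K by auto
    ultimately have "continuous_on ({0..t+1} \<times> UNIV)
        (\<lambda>p. case (fst p, closest_point K (snd p)) of (t, w) \<Rightarrow> V t w)"
      by (rule continuous_on_compose2[OF V_cont])
    then show "continuous_on ({0..t+1} \<times> UNIV) (\<lambda>(s, w). v s w)"
      unfolding v_def by (simp add: case_prod_beta')
    fix s :: real and x y :: complex assume s: "s \<in> {0..t+1}"
    have in_level: "c \<le> \<rho> (closest_point K w)" for w using cp[of w] unfolding K_def by simp
    then have in_D: "0 < \<rho> (closest_point K w)" for w using c(1) by (meson less_le_trans)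
    have "norm (v s x - v s y) = norm (W s (closest_point K x) (closest_point K y)) * norm (closest_point K x - closest_point K y)"
      unfolding v_def using divided_difference[where t=s and a="closest_point K x" and b="closest_point K y"] s in_D
      by (simp add: norm_mult)
    also have "\<dots> \<le> L c * norm (x - y)"
    proof (rule mult_mono)
      show W: "norm (W s (closest_point K x) (closest_point K y)) \<le> L c"
        using W_bound s c in_level by simp
      show "norm (closest_point K x - closest_point K y) \<le> norm (x - y)"
        using closest_point_lipschitz[of K x y] K by (simp add: dist_norm)
      show "0 \<le> L c" using W norm_ge_zero by (rule order_trans[rotated])
    qed simp
    finally show "norm (v s x - v s y) \<le> L c * norm (x - y)" .
  next
    fix h assume "h t = z" "\<And>s. s \<in> {0..t+1} \<Longrightarrow> (h has_vector_derivative v s (h s)) (at s within {0..t+1})"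
    then show thesis by (rule that)
  qed
  have h_cont: "continuous_on {0..t+1} h"
    unfolding continuous_on_eq_continuous_within using has_vector_derivative_continuous[OF h(2)] by blast
  have h_back: "\<rho> z \<le> \<rho> (h \<tau>)" if "\<tau> \<in> {0..t}" for \<tau>
  proof -
    have "\<rho> (h t) \<le> \<rho> (h \<tau>)"
    proof (rule decreasing[OF c(1)])
      show "\<exists>w. c \<le> \<rho> w" using c(2) less_imp_le by blast
      fix s assume "s \<in> {\<tau>..t}"
      then show "(h has_vector_derivative V s (closest_point {w. c \<le> \<rho> w} (h s))) (at s within {\<tau>..t})"
        using has_vector_derivative_within_subset[OF h(2)[of s], of "{\<tau>..t}"] that
        unfolding v_def K_def by auto
    qed (use that in auto)
    then show ?thesis using h(1) by simp
  qed
  have cont: "continuous_on {0..t+1} (\<lambda>s. \<rho> (h s))"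
    by (rule continuous_on_compose2[OF cont_rho h_cont]) simp
  have "t \<in> {0..t+1}" "0 < \<rho> (h t) - c" using t h(1) c by auto
  from cont[unfolded continuous_on_iff, rule_format, OF this] obtain \<delta> where \<delta>: "0 < \<delta>"
    "\<And>s. s \<in> {0..t+1} \<Longrightarrow> dist s t < \<delta> \<Longrightarrow> dist (\<rho> (h s)) (\<rho> (h t)) < \<rho> (h t) - c"
    by blast
  define T where "T = t + min \<delta> 1"
  have inK: "h s \<in> K" if "s \<in> {0..<T}" for s
  proof (cases "s \<le> t")
    case True
    then show ?thesis using h_back[of s] that c unfolding K_def by auto
  next
    case False
    then have "dist (\<rho> (h s)) (\<rho> (h t)) < \<rho> (h t) - c"
      using that unfolding T_def by (intro \<delta>(2)) (auto simp: dist_real_def)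
    then show ?thesis unfolding K_def by (auto simp: dist_real_def)
  qed
  have "flow_solution D V (h 0) T h"
    unfolding flow_solution_def
  proof (intro conjI ballI)
    show "0 < T" using t \<delta>(1) unfolding T_def by simp
    fix s assume s: "s \<in> {0..<T}"
    show "h s \<in> D" using inK[OF s] K by auto
    have "v s (h s) = V s (h s)" unfolding v_def using inK[OF s] by (simp add: closest_point_self)
    moreover have "s \<in> {0..t+1}" "{0..<T} \<subseteq> {0..t+1}" using s unfolding T_def by auto
    ultimately show "(h has_vector_derivative V s (h s)) (at s within {0..<T})"
      using has_vector_derivative_within_subset[OF h(2)[of s], of "{0..<T}"] by simp
  qed simp
  moreover have "t < T" using \<delta>(1) unfolding T_def by simp
  ultimately show ?thesis using h(1) h_back by (intro that[of T h]) auto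
qed

lemma flow_solution_continuous:
  assumes "flow_solution D V z T h"
  shows "continuous_on {0..<T} h"
  using assms has_vector_derivative_continuous
  unfolding flow_solution_def continuous_on_eq_continuous_within by blast

lemma flow_solution_deriv:
  assumes "flow_solution D V z T h" "S \<subseteq> {0..<T}" "s \<in> S"
  shows "(h has_vector_derivative V s (h s)) (at s within S)"
proof -
  have "(h has_vector_derivative V s (h s)) (at s within {0..<T})"
    using assms unfolding flow_solution_def by blast
  then show ?thesis using assms(2) by (rule has_vector_derivative_within_subset)
qed

text \<open>The difference of two solutions solves the linear equation \<open>d' = W(h, k) d\<close>.\<close>

lemma solution_difference:
  assumes h: "flow_solution D V z T h" and k: "flow_solution D V z' T' k"
    and t: "0 \<le> t" "t < T" "t < T'"
  shows "h t - k t = (z - z') * exp (integral {0..t} (\<lambda>s. W s (h s) (k s)))"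
proof -
  define w where "w s = W s (h s) (k s)" for s
  have sub: "{0..t} \<subseteq> {0..<T}" "{0..t} \<subseteq> {0..<T'}" using t by auto
  have "continuous_on {0..t} h" "continuous_on {0..t} k"
    using flow_solution_continuous[OF h] flow_solution_continuous[OF k] sub
    by (auto intro: continuous_on_subset)
  then have w_cont: "continuous_on {0..t} w" unfolding w_def
    using h k t unfolding flow_solution_def by (intro W_continuous) auto
  define I where "I s = integral {0..s} w" for s
  have I: "(I has_vector_derivative w s) (at s within {0..t})" if "s \<in> {0..t}" for s
    unfolding I_def using integral_has_vector_derivative[OF w_cont that] .
  define \<phi> where "\<phi> s = (h s - k s) * exp (- I s)" for s
  have "(\<phi> has_vector_derivative 0) (at s within {0..t})" if s: "s \<in> {0..t}" for s
  proof -
    have hs: "(h has_vector_derivative V s (h s)) (at s within {0..t})"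
      by (rule flow_solution_deriv[OF h sub(1) s])
    have ks: "(k has_vector_derivative V s (k s)) (at s within {0..t})"
      by (rule flow_solution_deriv[OF k sub(2) s])
    have E: "((\<lambda>s. exp (- I s)) has_vector_derivative (- w s * exp (- I s))) (at s within {0..t})"
      using field_vector_diff_chain_within[OF has_vector_derivative_minus[OF I[OF s]]
          has_field_derivative_at_within[OF DERIV_exp]]
      unfolding o_def .
    have "V s (h s) - V s (k s) = w s * (h s - k s)" unfolding w_def
      using h k s t unfolding flow_solution_def by (intro divided_difference) auto
    then have "(h s - k s) * (- w s * exp (- I s)) + (V s (h s) - V s (k s)) * exp (- I s) = 0"
      by simp
    then show ?thesis unfolding \<phi>_def
      using has_vector_derivative_mult[OF has_vector_derivative_diff[OF hs ks] E] by simp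
  qed
  then obtain C where "\<And>s. s \<in> {0..t} \<Longrightarrow> \<phi> s = C"
    using has_vector_derivative_zero_constant[of "{0..t}" \<phi>] by blast
  then have "\<phi> t = \<phi> 0" using t(1) by simp
  moreover have "\<phi> 0 = z - z'" using h k unfolding \<phi>_def I_def flow_solution_def by simp
  ultimately have "(h t - k t) * exp (- I t) * exp (I t) = (z - z') * exp (I t)" unfolding \<phi>_def by simp
  then show ?thesis unfolding mult.assoc exp_add[symmetric] by (simp add: I_def w_def[abs_def])
qed

lemma solution_increment:
  assumes h: "flow_solution D V z T h" and t: "0 \<le> t\<^sub>1" "t\<^sub>1 \<le> t\<^sub>2" "t\<^sub>2 < T" and "0 < c"
    and level: "\<And>t. t \<in> {t\<^sub>1..t\<^sub>2} \<Longrightarrow> c \<le> \<rho> (h t)"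
  shows "norm (h t\<^sub>2 - h t\<^sub>1) \<le> B c * (t\<^sub>2 - t\<^sub>1)"
proof -
  have sub: "{t\<^sub>1..t\<^sub>2} \<subseteq> {0..<T}" using t by auto
  have "((\<lambda>s. V s (h s)) has_integral (h t\<^sub>2 - h t\<^sub>1)) {t\<^sub>1..t\<^sub>2}"
  proof (rule fundamental_theorem_of_calculus[OF t(2)])
    fix s assume "s \<in> {t\<^sub>1..t\<^sub>2}"
    then show "(h has_vector_derivative V s (h s)) (at s within {t\<^sub>1..t\<^sub>2})"
      by (rule flow_solution_deriv[OF h sub])
  qed
  moreover have "continuous_on {t\<^sub>1..t\<^sub>2} (\<lambda>s. V s (h s))"
  proof (rule V_continuous)
    show "continuous_on {t\<^sub>1..t\<^sub>2} h" using flow_solution_continuous[OF h] sub by (rule continuous_on_subset)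
    show "0 \<le> s \<and> h s \<in> D" if "s \<in> {t\<^sub>1..t\<^sub>2}" for s
      using that h sub t unfolding flow_solution_def by auto
  qed
  ultimately show ?thesis
    using integral_bound[of t\<^sub>1 t\<^sub>2 "\<lambda>s. V s (h s)" "B c"] V_bound[OF _ \<open>0 < c\<close> level] t
    by (simp add: integral_unique)
qed

lemma solution_eq:
  assumes "flow_solution D V z T h" "flow_solution D V z T' k" "0 \<le> t" "t < T" "t < T'"
  shows "h t = k t"
  using solution_difference[OF assms] by simp

lemma initial_value_eq:
  assumes "flow_solution D V z T h" "flow_solution D V z' T' k" "0 \<le> t" "t < T" "t < T'" "h t = k t"
  shows "z = z'"
  using solution_difference[OF assms(1-5)] assms(6) by simp

text \<open>The starting point of the trajectory that is at \<open>z\<close> at time \<open>t\<close>; it turns out to be \<^const>\<open>inverse_flow\<close>.\<close>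

definition pullback :: "real \<Rightarrow> complex \<Rightarrow> complex" where
  "pullback t z = (SOME \<zeta>. \<exists>h T. t < T \<and> flow_solution D V \<zeta> T h \<and> h t = z)"

lemma pullback_eq:
  assumes "0 \<le> t" "t < T" "flow_solution D V \<zeta> T h"
  shows "pullback t (h t) = \<zeta>"
  unfolding pullback_def
proof (rule some_equality)
  show "\<exists>k T. t < T \<and> flow_solution D V \<zeta> T k \<and> k t = h t" using assms by blast
  show "\<zeta>' = \<zeta>" if "\<exists>k T. t < T \<and> flow_solution D V \<zeta>' T k \<and> k t = h t" for \<zeta>'
    using that initial_value_eq[OF _ assms(3)] assms(1,2) by blast
qed

lemma pullback_solution:
  assumes "0 \<le> t" "z \<in> D"
  obtains h T where "t < T" "flow_solution D V (pullback t z) T h" "h t = z"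
    "\<And>\<tau>. \<tau> \<in> {0..t} \<Longrightarrow> \<rho> z \<le> \<rho> (h \<tau>)"
proof -
  obtain h T where *: "t < T" "flow_solution D V (h 0) T h" "h t = z"
    "\<And>\<tau>. \<tau> \<in> {0..t} \<Longrightarrow> \<rho> z \<le> \<rho> (h \<tau>)"
    using solution_through[OF assms] by metis
  have "pullback t z = h 0" using pullback_eq[OF assms(1) *(1,2)] *(3) by simp
  with * show ?thesis using that by metis
qed

lemma pullback_level:
  assumes "0 \<le> t" "z \<in> D"
  shows "\<rho> z \<le> \<rho> (pullback t z)"
proof -
  obtain h T where *: "t < T" "flow_solution D V (pullback t z) T h" "h t = z"
    "\<And>\<tau>. \<tau> \<in> {0..t} \<Longrightarrow> \<rho> z \<le> \<rho> (h \<tau>)"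
    using pullback_solution[OF assms] by metis
  from *(2) have "h 0 = pullback t z" unfolding flow_solution_def by blast
  with *(4)[of 0] assms(1) show ?thesis by simp
qed

lemma pullback_in_D: "\<lbrakk>0 \<le> t; z \<in> D\<rbrakk> \<Longrightarrow> pullback t z \<in> D"
  using pullback_level[of t z] by simp

text \<open>The solution difference formula along two backward trajectories. These stay above the level \<open>c\<close> of
  their endpoints, so the exponent is bounded by \<open>L c * t\<close>.\<close>

lemma pullback_difference:
  assumes t: "0 \<le> t" and z: "z \<in> D" "z' \<in> D" and c: "0 < c" "c \<le> \<rho> z" "c \<le> \<rho> z'"
    and h: "t < T" "flow_solution D V (pullback t z) T h" "h t = z" "\<And>\<tau>. \<tau> \<in> {0..t} \<Longrightarrow> \<rho> z \<le> \<rho> (h \<tau>)"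
    and k: "t < T'" "flow_solution D V (pullback t z') T' k" "k t = z'" "\<And>\<tau>. \<tau> \<in> {0..t} \<Longrightarrow> \<rho> z' \<le> \<rho> (k \<tau>)"
  shows "continuous_on {0..t} (\<lambda>s. W s (h s) (k s))"
    and "\<And>s. s \<in> {0..t} \<Longrightarrow> norm (W s (h s) (k s)) \<le> L c"
    and "pullback t z - pullback t z' = (z - z') * exp (- integral {0..t} (\<lambda>s. W s (h s) (k s)))"
    and "norm (pullback t z - pullback t z') \<le> exp (L c * t) * norm (z - z')"
    and "\<And>s. s \<in> {0..t} \<Longrightarrow> norm (h s - k s) \<le> exp (L c * t) * exp (L c * t) * norm (z - z')"
proof -
  have sub: "{0..t} \<subseteq> {0..<T}" "{0..t} \<subseteq> {0..<T'}" using h(1) k(1) by auto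
  show w_cont: "continuous_on {0..t} (\<lambda>s. W s (h s) (k s))"
  proof (rule W_continuous)
    show "continuous_on {0..t} h" "continuous_on {0..t} k"
      using flow_solution_continuous[OF h(2)] flow_solution_continuous[OF k(2)] sub
      by (auto intro: continuous_on_subset)
    show "0 \<le> s \<and> h s \<in> D \<and> k s \<in> D" if "s \<in> {0..t}" for s
      using that h(1,2) k(1,2) unfolding flow_solution_def by auto
  qed
  show w_le: "norm (W s (h s) (k s)) \<le> L c" if s: "s \<in> {0..t}" for s
  proof (rule W_bound)
    show "c \<le> \<rho> (h s)" using h(4)[OF s] c by simp
    show "c \<le> \<rho> (k s)" using k(4)[OF s] c by simp
  qed (use s c in auto)
  have L0: "0 \<le> L c" using w_le[of 0] t norm_ge_zero by (meson atLeastAtMost_iff order_refl order_trans)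
  define I where "I s = integral {0..s} (\<lambda>s. W s (h s) (k s))" for s
  have diff: "h s - k s = (pullback t z - pullback t z') * exp (I s)" if "s \<in> {0..t}" for s
    unfolding I_def using solution_difference[OF h(2) k(2)] that h(1) k(1) by auto
  have "(pullback t z - pullback t z') * exp (I t) * exp (- I t) = (z - z') * exp (- I t)"
    using diff[of t] t h(3) k(3) by simp
  then show eq: "pullback t z - pullback t z' = (z - z') * exp (- integral {0..t} (\<lambda>s. W s (h s) (k s)))"
    unfolding I_def mult.assoc exp_add[symmetric] by simp
  show le: "norm (pullback t z - pullback t z') \<le> exp (L c * t) * norm (z - z')"
    unfolding eq norm_mult
    using mult_left_mono[OF norm_exp_integral_le(2)[OF t w_cont w_le] norm_ge_zero[of "z - z'"]]
    by (simp add: mult.commute)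
  show "norm (h s - k s) \<le> exp (L c * t) * exp (L c * t) * norm (z - z')" if s: "s \<in> {0..t}" for s
  proof -
    have "norm (exp (I s)) \<le> exp (L c * s)" unfolding I_def
      using s by (intro norm_exp_integral_le(1) continuous_on_subset[OF w_cont] w_le) auto
    also have "\<dots> \<le> exp (L c * t)" using L0 s by (simp add: mult_left_mono)
    finally have "norm (h s - k s) \<le> (exp (L c * t) * norm (z - z')) * exp (L c * t)"
      unfolding diff[OF s] norm_mult using le by (intro mult_mono) auto
    then show ?thesis by (simp add: mult.commute mult.left_commute)
  qed
qed

lemma pullback_lipschitz:
  assumes "0 \<le> t" "0 < c" "c \<le> \<rho> z" "c \<le> \<rho> z'"
  shows "norm (pullback t z - pullback t z') \<le> exp (L c * t) * norm (z - z')"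
proof -
  have D: "z \<in> D" "z' \<in> D" using assms by auto
  obtain h T where h: "t < T" "flow_solution D V (pullback t z) T h" "h t = z" "\<And>\<tau>. \<tau> \<in> {0..t} \<Longrightarrow> \<rho> z \<le> \<rho> (h \<tau>)"
    using pullback_solution[OF assms(1) D(1)] by metis
  obtain k T' where k: "t < T'" "flow_solution D V (pullback t z') T' k" "k t = z'" "\<And>\<tau>. \<tau> \<in> {0..t} \<Longrightarrow> \<rho> z' \<le> \<rho> (k \<tau>)"
    using pullback_solution[OF assms(1) D(2)] by metis
  show ?thesis by (rule pullback_difference(4)[OF assms(1) D assms(2-4) h k])
qed

lemma pullback_inj:
  assumes t: "0 \<le> t" and z: "z \<in> D" "z' \<in> D" and eq: "pullback t z = pullback t z'"
  shows "z = z'"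
proof -
  obtain h T where h: "t < T" "flow_solution D V (pullback t z) T h" "h t = z"
    using pullback_solution[OF t z(1)] by metis
  obtain k T' where k: "t < T'" "flow_solution D V (pullback t z') T' k" "k t = z'"
    using pullback_solution[OF t z(2)] by metis
  show ?thesis using solution_eq[OF h(2) k(2)[folded eq] t h(1) k(1)] h(3) k(3) by simp
qed

text \<open>The difference quotient of \<open>pullback t\<close> at \<open>z0\<close> is \<open>exp (- \<integral> W(k, h))\<close> by the difference formula, and
  when the endpoint of \<open>k\<close> tends to \<open>z0\<close> the integrals converge by domination.\<close>

lemma pullback_holomorphic:
  assumes t: "0 \<le> t"
  shows "pullback t holomorphic_on D"
  unfolding holomorphic_on_open[OF open_D]
proof
  fix z0 assume z0: "z0 \<in> D"
  define c where "c = \<rho> z0 / 2"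
  define N where "N = {w. c < \<rho> w}"
  have c: "0 < c" "c < \<rho> z0" using z0 unfolding c_def by auto
  have N: "open N" "z0 \<in> N" "N \<subseteq> D"
    using c open_Collect_less[OF continuous_on_const cont_rho] unfolding N_def by auto
  obtain h T where h: "t < T" "flow_solution D V (pullback t z0) T h" "h t = z0" "\<And>\<tau>. \<tau> \<in> {0..t} \<Longrightarrow> \<rho> z0 \<le> \<rho> (h \<tau>)"
    using pullback_solution[OF t z0] by metis
  have "\<forall>z\<in>N. \<exists>k T'. t < T' \<and> flow_solution D V (pullback t z) T' k \<and> k t = z \<and> (\<forall>\<tau>\<in>{0..t}. \<rho> z \<le> \<rho> (k \<tau>))"
  proof
    fix z assume "z \<in> N"
    then have "z \<in> D" using N by blast
    from pullback_solution[OF t this]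
    show "\<exists>k T'. t < T' \<and> flow_solution D V (pullback t z) T' k \<and> k t = z \<and> (\<forall>\<tau>\<in>{0..t}. \<rho> z \<le> \<rho> (k \<tau>))"
      by metis
  qed
  then obtain k T' where k: "\<And>z. z \<in> N \<Longrightarrow> t < T' z" "\<And>z. z \<in> N \<Longrightarrow> flow_solution D V (pullback t z) (T' z) (k z)"
    "\<And>z. z \<in> N \<Longrightarrow> k z t = z" "\<And>z \<tau>. z \<in> N \<Longrightarrow> \<tau> \<in> {0..t} \<Longrightarrow> \<rho> z \<le> \<rho> (k z \<tau>)"
    by metis
  define I where "I z = integral {0..t} (\<lambda>s. W s (k z s) (h s))" for z
  define J where "J = integral {0..t} (\<lambda>s. W s (h s) (h s))"
  have facts: "continuous_on {0..t} (\<lambda>s. W s (k z s) (h s))"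
    "s \<in> {0..t} \<Longrightarrow> norm (W s (k z s) (h s)) \<le> L c"
    "pullback t z - pullback t z0 = (z - z0) * exp (- I z)"
    "s \<in> {0..t} \<Longrightarrow> norm (k z s - h s) \<le> exp (L c * t) * exp (L c * t) * norm (z - z0)"
    if z: "z \<in> N" for z s
  proof -
    have *: "z \<in> D" "c \<le> \<rho> z" "c \<le> \<rho> z0" using z N c unfolding N_def by auto
    note pullback_difference[OF t *(1) z0 c(1) *(2,3) k(1)[OF z] k(2)[OF z] k(3)[OF z] k(4)[OF z] h]
    then show "continuous_on {0..t} (\<lambda>s. W s (k z s) (h s))"
      "s \<in> {0..t} \<Longrightarrow> norm (W s (k z s) (h s)) \<le> L c"
      "pullback t z - pullback t z0 = (z - z0) * exp (- I z)"
      "s \<in> {0..t} \<Longrightarrow> norm (k z s - h s) \<le> exp (L c * t) * exp (L c * t) * norm (z - z0)"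
      unfolding I_def by blast+
  qed
  have "((\<lambda>z. (pullback t z - pullback t z0) / (z - z0)) \<longlongrightarrow> exp (- J)) (at z0 within N)"
    unfolding tendsto_at_iff_sequentially
  proof (intro allI impI)
    fix X assume X: "\<forall>i. X i \<in> N - {z0}" "X \<longlonglongrightarrow> z0"
    have "(\<lambda>i. I (X i)) \<longlonglongrightarrow> J"
      unfolding I_def J_def
    proof (rule dominated_convergence(2)[where h = "\<lambda>_. L c"])
      show "(\<lambda>s. W s (k (X i) s) (h s)) integrable_on {0..t}" for i
        using facts(1)[of "X i"] X by (intro integrable_continuous_interval) blast
      show "(\<lambda>_. L c) integrable_on {0..t}" by (rule integrable_const_ivl)
      show "norm (W s (k (X i) s) (h s)) \<le> L c" if "s \<in> {0..t}" for i s
        using facts(2)[of "X i" s] that X by blast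
      fix s assume s: "s \<in> {0..t}"
      have "(\<lambda>i. norm (X i - z0)) \<longlonglongrightarrow> 0" using X(2) by (simp add: LIM_zero_iff tendsto_norm_zero_iff)
      from tendsto_mult_right_zero[OF this, of "exp (L c * t) * exp (L c * t)"]
      have "(\<lambda>i. k (X i) s - h s) \<longlonglongrightarrow> 0"
        by (rule Lim_null_comparison[rotated]) (use facts(4)[OF _ s] X(1) in auto)
      then have lim: "(\<lambda>i. k (X i) s) \<longlonglongrightarrow> h s" by (simp add: LIM_zero_iff)
      have inD: "k (X i) s \<in> D" "h s \<in> D" for i
        using k(1,2)[of "X i"] X(1) h s unfolding flow_solution_def by auto
      have "((\<lambda>p. case p of (t, a, b) \<Rightarrow> W t a b) \<circ> (\<lambda>i. (s, k (X i) s, h s))) \<longlonglongrightarrow> (case (s, h s, h s) of (t, a, b) \<Rightarrow> W t a b)"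
      proof (rule continuous_on_sequentially[THEN iffD1, OF W_cont, rule_format])
        show "(s, h s, h s) \<in> {0..} \<times> D \<times> D" using inD s by auto
        show "(\<forall>i. (s, k (X i) s, h s) \<in> {0..} \<times> D \<times> D)
          \<and> (\<lambda>i. (s, k (X i) s, h s)) \<longlonglongrightarrow> (s, h s, h s)"
          using inD s lim by (auto intro!: tendsto_intros)
      qed
      then show "(\<lambda>i. W s (k (X i) s) (h s)) \<longlonglongrightarrow> W s (h s) (h s)" by (simp add: o_def)
    qed
    then have "(\<lambda>i. exp (- I (X i))) \<longlonglongrightarrow> exp (- J)" by (intro tendsto_intros)
    moreover have "((\<lambda>z. (pullback t z - pullback t z0) / (z - z0)) \<circ> X) i = exp (- I (X i))" for i
      using facts(3)[of "X i"] X(1) by simp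
    ultimately show "((\<lambda>z. (pullback t z - pullback t z0) / (z - z0)) \<circ> X) \<longlonglongrightarrow> exp (- J)"
      by presburger
  qed
  then have "(pullback t has_field_derivative exp (- J)) (at z0 within N)"
    by (simp add: has_field_derivative_iff)
  then show "\<exists>f'. (pullback t has_field_derivative f') (at z0)"
    using at_within_open[OF N(2,1)] by auto
qed

text \<open>A point survives beyond time \<open>t\<close> exactly if some trajectory through it has an endpoint at time \<open>t\<close>.\<close>

lemma image_pullback:
  assumes t: "0 \<le> t"
  shows "pullback t ` D = {\<zeta> \<in> D. ereal t < lifetime D V \<zeta>}"
proof (intro set_eqI iffI)
  fix \<zeta> assume "\<zeta> \<in> pullback t ` D"
  then obtain z where z: "z \<in> D" "\<zeta> = pullback t z" by blast
  obtain h T where "t < T" "flow_solution D V \<zeta> T h"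
    using pullback_solution[OF t z(1)] z(2) by metis
  then have "ereal t < lifetime D V \<zeta>" unfolding lifetime_def less_Sup_iff by (auto intro!: exI[of _ "ereal T"])
  then show "\<zeta> \<in> {\<zeta> \<in> D. ereal t < lifetime D V \<zeta>}" using pullback_in_D[OF t z(1)] z(2) by simp
next
  fix \<zeta> assume "\<zeta> \<in> {\<zeta> \<in> D. ereal t < lifetime D V \<zeta>}"
  then obtain T h where h: "t < T" "flow_solution D V \<zeta> T h" unfolding lifetime_def less_Sup_iff by auto
  then have "h t \<in> D" using t unfolding flow_solution_def by auto
  then show "\<zeta> \<in> pullback t ` D" using pullback_eq[OF t h] by (metis image_eqI)
qed

text \<open>The hull is the closure of the set of points swallowed by time \<open>t\<close>, which is the complement in \<open>D\<close>
  of the range of \<open>pullback t\<close>. An injective holomorphic map has open range, so taking the closure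
  adds no point of \<open>D\<close>.\<close>

lemma complement_hull:
  assumes t: "0 \<le> t"
  shows "D - loewner_hull D V t = pullback t ` D"
proof -
  define U where "U = pullback t ` D"
  have "inj_on (pullback t) D" using pullback_inj[OF t] by (auto intro: inj_onI)
  then have U: "open U" unfolding U_def
    by (intro open_mapping_thm3 pullback_holomorphic[OF t] open_D)
  have sub: "U \<subseteq> D" unfolding U_def using pullback_in_D[OF t] by blast
  have hull: "loewner_hull D V t = closure (D - U)"
    unfolding loewner_hull_def U_def image_pullback[OF t] by (rule arg_cong[of _ _ closure]) auto
  have "U \<inter> closure (D - U) = {}" using open_Int_closure_eq_empty[OF U, of "D - U"] by auto
  moreover have "D - closure (D - U) \<subseteq> U" using closure_subset[of "D - U"] by auto
  ultimately have "D - closure (D - U) = U" using sub by auto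
  then show ?thesis unfolding hull U_def[symmetric] .
qed

lemma flow_eq:
  assumes "0 \<le> t" "t < T" "flow_solution D V \<zeta> T h"
  shows "flow D V t \<zeta> = h t"
  unfolding flow_def
proof (rule the_equality)
  show "\<exists>T k. flow_solution D V \<zeta> T k \<and> t < T \<and> k t = h t" using assms by blast
  show "w = h t" if "\<exists>T k. flow_solution D V \<zeta> T k \<and> t < T \<and> k t = w" for w
    using that solution_eq[OF _ assms(3) assms(1)] assms(2) by blast
qed

text \<open>\<^const>\<open>inverse_flow\<close> is an inverse on \<open>D - loewner_hull D V t\<close>, and that set is the range of
  \<open>pullback t\<close>.\<close>

lemma inverse_flow_pullback:
  assumes t: "0 \<le> t" and z: "z \<in> D"
  shows "inverse_flow D V t z = pullback t z"
proof -
  have flow: "flow D V t (pullback t w) = w" if w: "w \<in> D" for w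
  proof -
    obtain h T where "t < T" "flow_solution D V (pullback t w) T h" "h t = w"
      using pullback_solution[OF t w] by metis
    then show ?thesis using flow_eq[OF t] by metis
  qed
  then have "inj_on (flow D V t) (pullback t ` D)" by (auto intro!: inj_onI)
  from inv_into_f_f[OF this, of "pullback t z"] show ?thesis
    unfolding inverse_flow_def complement_hull[OF t] using z flow by auto
qed

lemma inverse_flow_eq:
  assumes "0 \<le> t" "t < T" "flow_solution D V \<zeta> T h"
  shows "inverse_flow D V t (h t) = \<zeta>"
proof -
  have "h t \<in> D" using assms unfolding flow_solution_def by auto
  then show ?thesis using inverse_flow_pullback[OF assms(1)] pullback_eq[OF assms] by simp
qed

lemma inverse_flow_solution:
  assumes "0 \<le> t" "z \<in> D"
  obtains h T where "t < T" "flow_solution D V (inverse_flow D V t z) T h" "h t = z"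
    "\<And>\<tau>. \<tau> \<in> {0..t} \<Longrightarrow> \<rho> z \<le> \<rho> (h \<tau>)"
  using pullback_solution[OF assms] unfolding inverse_flow_pullback[OF assms] by metis

lemma inverse_flow_level: "\<lbrakk>0 \<le> t; z \<in> D\<rbrakk> \<Longrightarrow> \<rho> z \<le> \<rho> (inverse_flow D V t z)"
  using pullback_level inverse_flow_pullback by simp

lemma inverse_flow_holomorphic: "0 \<le> t \<Longrightarrow> inverse_flow D V t holomorphic_on D"
  using pullback_holomorphic inverse_flow_pullback by (metis holomorphic_transform)

lemma inverse_flow_0:
  assumes "z \<in> D" shows "inverse_flow D V 0 z = z"
proof -
  obtain h T where "0 < T" "flow_solution D V (inverse_flow D V 0 z) T h" "h 0 = z"
    using inverse_flow_solution[OF order_refl assms] by metis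
  then show ?thesis unfolding flow_solution_def by auto
qed

lemma inverse_flow_displacement:
  assumes t: "0 \<le> t" and z: "z \<in> D"
  shows "norm (inverse_flow D V t z - z) \<le> B (\<rho> z) * t"
proof -
  obtain h T where h: "t < T" "flow_solution D V (inverse_flow D V t z) T h" "h t = z"
    "\<And>\<tau>. \<tau> \<in> {0..t} \<Longrightarrow> \<rho> z \<le> \<rho> (h \<tau>)"
    using inverse_flow_solution[OF t z] by metis
  have "h 0 = inverse_flow D V t z" using h(2) unfolding flow_solution_def by blast
  then show ?thesis using solution_increment[OF h(2) order_refl t h(1), of "\<rho> z"] h(3,4) z
    by (simp add: norm_minus_commute)
qed

text \<open>Follow the trajectory ending at \<open>z\<close> at time \<open>t\<^sub>2\<close>: at time \<open>t\<^sub>1\<close> it is at a point close to \<open>z\<close>, and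
  \<open>pullback t\<^sub>1\<close> takes both points back to time 0.\<close>

lemma inverse_flow_time_lipschitz:
  assumes t: "0 \<le> t\<^sub>1" "t\<^sub>1 \<le> t\<^sub>2" and z: "z \<in> D"
  shows "norm (inverse_flow D V t\<^sub>2 z - inverse_flow D V t\<^sub>1 z) \<le> exp (L (\<rho> z) * t\<^sub>1) * (B (\<rho> z) * (t\<^sub>2 - t\<^sub>1))"
proof -
  have t2: "0 \<le> t\<^sub>2" and z': "0 < \<rho> z" using t z by auto
  obtain h T where h: "t\<^sub>2 < T" "flow_solution D V (pullback t\<^sub>2 z) T h" "h t\<^sub>2 = z"
    "\<And>\<tau>. \<tau> \<in> {0..t\<^sub>2} \<Longrightarrow> \<rho> z \<le> \<rho> (h \<tau>)"
    using pullback_solution[OF t2 z] by metis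
  have "t\<^sub>1 < T" using h(1) t by simp
  then have "pullback t\<^sub>1 (h t\<^sub>1) = pullback t\<^sub>2 z" using pullback_eq[OF t(1) _ h(2)] by simp
  moreover have "norm (pullback t\<^sub>1 (h t\<^sub>1) - pullback t\<^sub>1 z) \<le> exp (L (\<rho> z) * t\<^sub>1) * norm (h t\<^sub>1 - z)"
    using h(4)[of t\<^sub>1] t z' by (intro pullback_lipschitz) auto
  moreover have "norm (h t\<^sub>1 - z) \<le> B (\<rho> z) * (t\<^sub>2 - t\<^sub>1)"
    using solution_increment[OF h(2) t h(1) z'] h(3,4) t by (simp add: norm_minus_commute)
  ultimately have "norm (pullback t\<^sub>2 z - pullback t\<^sub>1 z) \<le> exp (L (\<rho> z) * t\<^sub>1) * (B (\<rho> z) * (t\<^sub>2 - t\<^sub>1))"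
    by (smt (verit) exp_gt_zero mult_left_mono)
  then show ?thesis using inverse_flow_pullback t(1) t2 z by simp
qed

lemma inverse_flow_continuous_in_time:
  assumes z: "z \<in> D"
  shows "continuous_on {0..} (\<lambda>t. inverse_flow D V t z)"
  unfolding continuous_on_iff
proof (intro ballI allI impI)
  fix t e :: real assume t: "t \<in> {0..}" and e: "0 < e"
  have z': "0 < \<rho> z" using z by simp
  have B: "0 \<le> B (\<rho> z)" using V_bound[of 0 "\<rho> z" z] z' norm_ge_zero order_trans by (meson order_refl)
  have L: "0 \<le> L (\<rho> z)" using W_bound[of 0 "\<rho> z" z z] z' norm_ge_zero order_trans by (meson order_refl)
  define C where "C = exp (L (\<rho> z) * (t + 1)) * B (\<rho> z) + 1"
  have C: "0 < C" unfolding C_def using B by (simp add: add_nonneg_pos)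
  have bound: "norm (inverse_flow D V t\<^sub>2 z - inverse_flow D V t\<^sub>1 z) \<le> C * (t\<^sub>2 - t\<^sub>1)"
    if "0 \<le> t\<^sub>1" "t\<^sub>1 \<le> t\<^sub>2" "t\<^sub>1 \<le> t + 1" for t\<^sub>1 t\<^sub>2
  proof -
    have "exp (L (\<rho> z) * t\<^sub>1) * B (\<rho> z) \<le> exp (L (\<rho> z) * (t + 1)) * B (\<rho> z)"
      using that L B by (intro mult_right_mono) (auto intro: mult_left_mono)
    also have "\<dots> \<le> C" unfolding C_def by simp
    finally have "exp (L (\<rho> z) * t\<^sub>1) * B (\<rho> z) * (t\<^sub>2 - t\<^sub>1) \<le> C * (t\<^sub>2 - t\<^sub>1)"
      using that by (intro mult_right_mono) auto
    then show ?thesis using inverse_flow_time_lipschitz[OF that(1,2) z] by (simp add: mult.assoc)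
  qed
  show "\<exists>d>0. \<forall>t'\<in>{0..}. dist t' t < d \<longrightarrow> dist (inverse_flow D V t' z) (inverse_flow D V t z) < e"
  proof (intro exI[of _ "min 1 (e / C)"] conjI ballI impI)
    show "0 < min 1 (e / C)" using e C by simp
    fix t' assume t': "t' \<in> {0..}" "dist t' t < min 1 (e / C)"
    have "dist (inverse_flow D V t' z) (inverse_flow D V t z) \<le> C * \<bar>t' - t\<bar>"
    proof (cases "t \<le> t'")
      case True
      then show ?thesis using bound[of t t'] t by (simp add: dist_norm)
    next
      case False
      then show ?thesis using bound[of t' t] t' by (simp add: dist_norm norm_minus_commute)
    qed
    also have "\<dots> < C * (e / C)" using t'(2) C by (intro mult_strict_left_mono) (auto simp: dist_real_def)
    also have "\<dots> = e" using C by simp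
    finally show "dist (inverse_flow D V t' z) (inverse_flow D V t z) < e" .
  qed
qed

end

section \<open>Integrals along paths of measures\<close>

lemma finite_measures_onD:
  assumes "\<mu> \<in> finite_measures_on X"
  shows "finite_measure \<mu>" "sets \<mu> = sets (restrict_space borel X)" "space \<mu> = X"
  using assms sets_eq_imp_space_eq[of \<mu> "restrict_space borel X"]
  unfolding finite_measures_on_def by (auto simp: space_restrict_space)

lemma prob_measures_onD:
  assumes "\<nu> \<in> prob_measures_on X"
  shows "\<nu> \<in> finite_measures_on X" "prob_space \<nu>" "measure \<nu> X = 1"
proof -
  show *: "\<nu> \<in> finite_measures_on X" "prob_space \<nu>" using assms unfolding prob_measures_on_def by auto
  show "measure \<nu> X = 1"
    using prob_space.prob_space[OF *(2)] unfolding finite_measures_onD(3)[OF *(1)] .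
qed

lemma continuous_measurable_on:
  fixes f :: "'a::topological_space \<Rightarrow> 'b::topological_space"
  assumes "\<mu> \<in> finite_measures_on X" "continuous_on X f"
  shows "f \<in> borel_measurable \<mu>"
  using borel_measurable_continuous_on_restrict[OF assms(2)]
    measurable_cong_sets[OF finite_measures_onD(2)[OF assms(1)] refl] by blast

lemma continuous_integrable_on:
  fixes f :: "'a::topological_space \<Rightarrow> 'b::{banach, second_countable_topology}"
  assumes "\<mu> \<in> finite_measures_on X" "continuous_on X f" "\<And>x. x \<in> X \<Longrightarrow> norm (f x) \<le> C"
  shows "integrable \<mu> f"
  by (rule finite_measure.integrable_const_bound[OF finite_measures_onD(1)[OF assms(1)]])
    (use assms finite_measures_onD(3)[OF assms(1)] continuous_measurable_on[OF assms(1,2)] in auto)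

lemma integral_norm_le:
  fixes f :: "'a::topological_space \<Rightarrow> 'b::{banach, second_countable_topology}"
  assumes "\<mu> \<in> finite_measures_on X" "continuous_on X f" "\<And>x. x \<in> X \<Longrightarrow> norm (f x) \<le> C"
  shows "norm (LINT x|\<mu>. f x) \<le> C * measure \<mu> X"
proof -
  interpret finite_measure \<mu> by (rule finite_measures_onD(1)[OF assms(1)])
  have int: "integrable \<mu> f" by (rule continuous_integrable_on[OF assms])
  have "norm (LINT x|\<mu>. f x) \<le> (LINT x|\<mu>. norm (f x))"
    by (rule integral_norm_bound)
  also have "\<dots> \<le> (LINT x|\<mu>. C)"
    by (rule integral_mono[OF integrable_norm[OF int]])
      (use assms(3) finite_measures_onD(3)[OF assms(1)] in auto)
  finally show ?thesis using finite_measures_onD(3)[OF assms(1)] by (simp add: mult.commute)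
qed

lemma bounded_path_mass:
  assumes "s \<in> bounded_paths X A"
  obtains M where "0 < M" "\<And>t. 0 \<le> t \<Longrightarrow> measure (s t) X \<le> M"
proof -
  from assms obtain M where "\<And>t. 0 \<le> t \<Longrightarrow> measure (s t) X \<le> M"
    unfolding bounded_paths_def bdd_above_def by auto
  then show ?thesis using that[of "max M 1"] by (simp add: le_max_iff_disj)
qed

lemma path_complex_integral_continuous:
  fixes f :: "'a::topological_space \<Rightarrow> complex"
  assumes s: "s \<in> paths X A" and A: "A \<subseteq> finite_measures_on X"
    and f: "continuous_on X f" "\<And>x. x \<in> X \<Longrightarrow> norm (f x) \<le> C"
  shows "continuous_on {0..} (\<lambda>t. LINT x|s t. f x)"
proof -
  have *: "continuous_on {0..} (\<lambda>t. LINT x|s t. Re (f x))" "continuous_on {0..} (\<lambda>t. LINT x|s t. Im (f x))"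
  proof -
    have "bounded ((\<lambda>x. Re (f x)) ` X)" "bounded ((\<lambda>x. Im (f x)) ` X)"
      unfolding bounded_iff using f(2) abs_Re_le_cmod abs_Im_le_cmod
      by (auto intro!: exI[of _ C] intro: order_trans)
    then show "continuous_on {0..} (\<lambda>t. LINT x|s t. Re (f x))" "continuous_on {0..} (\<lambda>t. LINT x|s t. Im (f x))"
      using s[unfolded paths_iff] continuous_on_Re[OF f(1)] continuous_on_Im[OF f(1)] by auto
  qed
  have "(LINT x|s t. f x) = Complex (LINT x|s t. Re (f x)) (LINT x|s t. Im (f x))" if "t \<in> {0..}" for t
  proof -
    have "s t \<in> finite_measures_on X" using s[unfolded paths_iff] A that by auto
    then have "integrable (s t) f" using f by (rule continuous_integrable_on)
    then show ?thesis by (simp add: complex_eq_iff)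
  qed
  moreover have "continuous_on {0..} (\<lambda>t. Complex (LINT x|s t. Re (f x)) (LINT x|s t. Im (f x)))"
    unfolding Complex_eq by (intro continuous_intros *)
  ultimately show ?thesis by (metis (no_types, lifting) continuous_on_cong)
qed

text \<open>Weak continuity of the path handles the variation in \<open>t\<close> for a fixed kernel. The variation of the
  kernel is uniform in the integration variable, and it is multiplied by a mass that is bounded
  along the path.\<close>

lemma path_kernel_continuous:
  fixes k :: "'p::metric_space \<Rightarrow> 'a::topological_space \<Rightarrow> complex"
  assumes s: "s \<in> bounded_paths X A" and A: "A \<subseteq> finite_measures_on X"
    and k_cont: "\<And>p. p \<in> P \<Longrightarrow> continuous_on X (k p)"
    and k_bdd: "\<And>p. p \<in> P \<Longrightarrow> \<exists>C. \<forall>x\<in>X. norm (k p x) \<le> C"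
    and unif: "\<And>p. p \<in> P \<Longrightarrow> uniform_limit X k (k p) (at p within P)"
  shows "continuous_on ({0..} \<times> P) (\<lambda>(t, p). LINT x|s t. k p x)"
  unfolding continuous_on_iff
proof (intro ballI allI impI)
  fix y :: "real \<times> 'p" and e :: real assume "y \<in> {0..} \<times> P" and e: "0 < e"
  then obtain t0 :: real and p0 where y: "y = (t0, p0)" "0 \<le> t0" "p0 \<in> P" by auto
  obtain M where M: "0 < M" "\<And>t. 0 \<le> t \<Longrightarrow> measure (s t) X \<le> M"
    using bounded_path_mass[OF s] by blast
  have s': "s \<in> paths X A" using s unfolding bounded_paths_def by simp
  have fin: "s t \<in> finite_measures_on X" if "0 \<le> t" for t using s'[unfolded paths_iff] A that by auto
  define e' where "e' = e / (4 * M)"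
  have e': "0 < e'" using e M unfolding e'_def by simp
  have "\<forall>\<^sub>F q in at p0 within P. \<forall>x\<in>X. dist (k q x) (k p0 x) < e'"
    using unif[OF y(3)] e' unfolding uniform_limit_iff by blast
  then obtain d1 where d1: "0 < d1" "\<And>q. q \<in> P \<Longrightarrow> dist q p0 < d1 \<Longrightarrow> \<forall>x\<in>X. dist (k q x) (k p0 x) \<le> e'"
    unfolding eventually_at using e' by (metis dist_self less_imp_le)
  obtain C where C: "\<forall>x\<in>X. norm (k p0 x) \<le> C" using k_bdd[OF y(3)] by blast
  have "continuous_on {0..} (\<lambda>t. LINT x|s t. k p0 x)"
    by (rule path_complex_integral_continuous[OF s' A k_cont[OF y(3)], of C]) (use C in auto)
  then obtain d2 where d2: "0 < d2"
    "\<And>t. 0 \<le> t \<Longrightarrow> dist t t0 < d2 \<Longrightarrow> dist (LINT x|s t. k p0 x) (LINT x|s t0. k p0 x) < e / 2"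
    using continuous_on_iff[THEN iffD1, rule_format, of "{0..}" _ t0 "e/2"] y(2) e by fastforce
  show "\<exists>d>0. \<forall>y'\<in>{0..} \<times> P. dist y' y < d \<longrightarrow>
      dist (case y' of (t, p) \<Rightarrow> LINT x|s t. k p x) (case y of (t, p) \<Rightarrow> LINT x|s t. k p x) < e"
  proof (intro exI[of _ "min d1 d2"] conjI ballI impI)
    show "0 < min d1 d2" using d1 d2 by simp
    fix y' :: "real \<times> 'p" assume "y' \<in> {0..} \<times> P" and dist: "dist y' y < min d1 d2"
    then obtain t :: real and p where y': "y' = (t, p)" "0 \<le> t" "p \<in> P" by auto
    have "dist t t0 < d2" "dist p p0 < d1"
      using dist dist_fst_le[of y' y] dist_snd_le[of y' y] unfolding y y' by auto
    then have 1: "dist (LINT x|s t. k p0 x) (LINT x|s t0. k p0 x) < e / 2"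
      and 2: "\<And>x. x \<in> X \<Longrightarrow> norm (k p x - k p0 x) \<le> e'"
      using d2(2)[OF y'(2)] d1(2)[OF y'(3)] by (auto simp: dist_norm)
    obtain C' where C': "\<forall>x\<in>X. norm (k p x) \<le> C'" using k_bdd[OF y'(3)] by blast
    have int: "integrable (s t) (k p)" "integrable (s t) (k p0)"
      using continuous_integrable_on[OF fin[OF y'(2)] k_cont[OF y'(3)]] C'
        continuous_integrable_on[OF fin[OF y'(2)] k_cont[OF y(3)]] C by blast+
    have "dist (LINT x|s t. k p x) (LINT x|s t. k p0 x) = norm (LINT x|s t. (k p x - k p0 x))"
      using int by (simp add: dist_norm)
    also have "\<dots> \<le> e' * measure (s t) X"
      by (rule integral_norm_le[OF fin[OF y'(2)]])
        (auto intro!: continuous_intros k_cont y y' 2)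
    also have "\<dots> \<le> e' * M" using M(2)[OF y'(2)] e' by simp
    also have "\<dots> < e / 2" unfolding e'_def using M(1) e by (simp add: field_simps)
    finally show "dist (case y' of (t, p) \<Rightarrow> LINT x|s t. k p x) (case y of (t, p) \<Rightarrow> LINT x|s t. k p x) < e"
      using 1 dist_triangle[of "LINT x|s t. k p x" "LINT x|s t0. k p0 x" "LINT x|s t. k p0 x"]
      unfolding y y' by simp
  qed
qed

lemma compact_kernel_uniform_limit:
  fixes k :: "'p::metric_space \<Rightarrow> 'a::topological_space \<Rightarrow> 'b::metric_space"
  assumes "compact X" "continuous_on (P \<times> X) (\<lambda>(p, x). k p x)" "p \<in> P"
  shows "uniform_limit X k (k p) (at p within P)"
  unfolding uniform_limit_iff
proof (intro allI impI)
  fix e :: real assume e: "0 < e"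
  obtain U where U: "p \<in> U" "open U"
    "\<forall>q\<in>U \<inter> P. \<forall>x\<in>X. dist ((\<lambda>(p, x). k p x) (q, x)) ((\<lambda>(p, x). k p x) (p, x)) \<le> e / 2"
    using continuous_on_prod_compactE[OF assms(2,1,3), of "e/2"] e by (metis half_gt_zero)
  then have "\<forall>\<^sub>F q in at p within P. q \<in> U \<inter> P"
    by (auto simp: eventually_at_filter eventually_nhds)
  then show "\<forall>\<^sub>F q in at p within P. \<forall>x\<in>X. dist (k q x) (k p x) < e"
  proof eventually_elim
    case (elim q)
    have "dist (k q x) (k p x) < e" if "x \<in> X" for x
    proof -
      have "dist (k q x) (k p x) \<le> e / 2" using U(3) elim that by auto
      then show ?thesis using e by linarith
    qed
    then show ?case by blast
  qed
qed

section \<open>The chordal field\<close>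

lemma has_vector_derivative_monotone_on:
  fixes u :: "real \<Rightarrow> real"
  assumes "a \<le> b" "\<And>t. t \<in> {a..b} \<Longrightarrow> (u has_vector_derivative u' t) (at t within {a..b})"
    "\<And>t. t \<in> {a..b} \<Longrightarrow> 0 \<le> u' t"
  shows "u a \<le> u b"
proof -
  have "(u' has_integral (u b - u a)) {a..b}"
    by (rule fundamental_theorem_of_calculus[OF assms(1,2)])
  then have "0 \<le> u b - u a" by (rule has_integral_nonneg) (use assms(3) in auto)
  then show ?thesis by simp
qed

lemma M0_finite: "M0_real \<subseteq> finite_measures_on UNIV"
  unfolding M0_real_def by blast

lemma Im_le_resolvent: "Im z \<le> norm (z - complex_of_real x)"
  using abs_Im_le_cmod[of "z - complex_of_real x"] by simp

lemma resolvent_bound: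
  assumes "0 < c" "c \<le> Im z"
  shows "norm (1 / (z - complex_of_real x)) \<le> 1 / c"
  using assms Im_le_resolvent[of z x] by (simp add: norm_divide frac_le)

lemma resolvent_continuous:
  assumes "0 < Im z"
  shows "continuous_on X (\<lambda>x. 1 / (z - complex_of_real x))"
  using assms by (intro continuous_intros) (auto simp: complex_eq_iff)

lemma Im_resolvent: "Im (1 / (z - complex_of_real x)) = - Im z / (norm (z - complex_of_real x))\<^sup>2"
  by (simp add: Im_divide cmod_power2)

text \<open>Uniformity on the whole line holds because all denominators are bounded below by \<open>Im p\<close>.\<close>

lemma resolvent_uniform_limit:
  assumes "0 < Im p" and g: "(g \<longlongrightarrow> p) F"
  shows "uniform_limit UNIV (\<lambda>q x. 1 / (g q - complex_of_real x)) (\<lambda>x. 1 / (p - complex_of_real x)) F"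
proof (rule uniform_lim_divide[where b = "Im p"])
  show "uniform_limit UNIV (\<lambda>q x. 1) (\<lambda>x. 1::complex) F" by (rule uniform_limit_const)
  show "uniform_limit UNIV (\<lambda>q x. g q - complex_of_real x) (\<lambda>x. p - complex_of_real x) F"
  proof (rule uniform_limitI)
    fix e :: real assume "0 < e"
    then have "\<forall>\<^sub>F q in F. dist (g q) p < e" using g by (rule tendstoD[rotated])
    then show "\<forall>\<^sub>F q in F. \<forall>x\<in>UNIV. dist (g q - complex_of_real x) (p - complex_of_real x) < e"
      by eventually_elim (simp add: dist_norm)
  qed
  show "bounded (range (\<lambda>x::real. 1::complex))" by (simp add: image_constant_conv)
  show "Im p \<le> norm (p - complex_of_real x)" for x by (rule Im_le_resolvent)
qed (use assms in auto)

lemma resolvent_integrable: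
  assumes "\<mu> \<in> finite_measures_on UNIV" "0 < Im z"
  shows "integrable \<mu> (\<lambda>x. 1 / (z - complex_of_real x))"
  using continuous_integrable_on[OF assms(1) resolvent_continuous resolvent_bound[OF _ order_refl]] assms(2)
  by blast

context
  fixes s :: "real \<Rightarrow> real measure" and M :: real
  assumes s: "s \<in> bounded_paths UNIV M0_real"
    and M: "\<And>t. 0 \<le> t \<Longrightarrow> measure (s t) UNIV \<le> M"
begin

lemma chordal_finite: "0 \<le> t \<Longrightarrow> s t \<in> finite_measures_on UNIV"
  using s M0_finite unfolding bounded_paths_def paths_iff by blast

lemma Im_cauchy_transform:
  assumes "0 \<le> t" "0 < Im z"
  shows "Im (cauchy_transform (s t) z) = - Im z * (LINT x|s t. 1 / (norm (z - complex_of_real x))\<^sup>2)"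
proof -
  have "integrable (s t) (\<lambda>x. 1 / (z - complex_of_real x))"
    by (rule resolvent_integrable[OF chordal_finite[OF assms(1)] assms(2)])
  then have "Im (cauchy_transform (s t) z) = (LINT x|s t. Im (1 / (z - complex_of_real x)))"
    unfolding cauchy_transform_def by simp
  also have "\<dots> = (LINT x|s t. - Im z * (1 / (norm (z - complex_of_real x))\<^sup>2))"
    unfolding Im_resolvent by simp
  finally show ?thesis by (simp only: integral_mult_right_zero)
qed

text \<open>The divided difference of \<open>1 / (z - x)\<close> is \<open>- 1 / ((a - x) (b - x))\<close>, and \<open>\<bar>z - x\<bar> \<ge> Im z\<close> gives the bounds.
  The level \<open>Im\<close> decreases along solutions because a Cauchy transform has nonpositive imaginary part.\<close>

lemma chordal_field:
  "loewner_field Im (\<lambda>t. cauchy_transform (s t))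
     (\<lambda>t a b. LINT x|s t. - (1 / (a - complex_of_real x) * (1 / (b - complex_of_real x))))
     (\<lambda>c. 1 / c * M) (\<lambda>c. 1 / c * (1 / c) * M)"
proof
  show "continuous_on UNIV Im" by (intro continuous_intros)
  show "convex {w. c \<le> Im w}" for c using convex_halfspace_Im_ge[of c] by simp
  show "continuous_on ({0..} \<times> {w. 0 < Im w}) (\<lambda>(t, w). cauchy_transform (s t) w)"
    unfolding cauchy_transform_def
  proof (rule path_kernel_continuous[OF s M0_finite])
    fix p assume "p \<in> {w. 0 < Im w}"
    then have p: "0 < Im p" by simp
    show "continuous_on UNIV (\<lambda>x. 1 / (p - complex_of_real x))" by (rule resolvent_continuous[OF p])
    show "\<exists>C. \<forall>x\<in>UNIV. norm (1 / (p - complex_of_real x)) \<le> C" using resolvent_bound[OF p order_refl] by blast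
    show "uniform_limit UNIV (\<lambda>q x. 1 / (q - complex_of_real x)) (\<lambda>x. 1 / (p - complex_of_real x)) (at p within {w. 0 < Im w})"
      by (rule resolvent_uniform_limit[OF p tendsto_ident_at])
  qed
  define k where "k p x = - (1 / (fst p - complex_of_real x) * (1 / (snd p - complex_of_real x)))" for p :: "complex \<times> complex" and x
  have k_bound: "norm (k p x) \<le> 1 / c * (1 / c)" if "0 < c" "c \<le> Im (fst p)" "c \<le> Im (snd p)" for c p x
    unfolding k_def norm_minus_cancel norm_mult using that by (intro mult_mono resolvent_bound) auto
  have k_cont: "continuous_on UNIV (k p)" if "0 < Im (fst p)" "0 < Im (snd p)" for p
    unfolding k_def using that by (intro continuous_intros resolvent_continuous)
  have "continuous_on ({0..} \<times> ({w. 0 < Im w} \<times> {w. 0 < Im w})) (\<lambda>(t, p). LINT x|s t. k p x)"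
  proof (rule path_kernel_continuous[OF s M0_finite])
    fix p assume "p \<in> {w. 0 < Im w} \<times> {w. 0 < Im w}"
    then have p: "0 < Im (fst p)" "0 < Im (snd p)" by auto
    show "continuous_on UNIV (k p)" by (rule k_cont[OF p])
    show "\<exists>C. \<forall>x\<in>UNIV. norm (k p x) \<le> C"
      using k_bound[of "min (Im (fst p)) (Im (snd p))" p] p by auto
    have fst: "uniform_limit UNIV (\<lambda>q x. 1 / (fst q - complex_of_real x)) (\<lambda>x. 1 / (fst p - complex_of_real x)) (at p within {w. 0 < Im w} \<times> {w. 0 < Im w})"
      by (rule resolvent_uniform_limit[OF p(1) tendsto_fst[OF tendsto_ident_at]])
    have snd: "uniform_limit UNIV (\<lambda>q x. 1 / (snd q - complex_of_real x)) (\<lambda>x. 1 / (snd p - complex_of_real x)) (at p within {w. 0 < Im w} \<times> {w. 0 < Im w})"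
      by (rule resolvent_uniform_limit[OF p(2) tendsto_snd[OF tendsto_ident_at]])
    show "uniform_limit UNIV k (k p) (at p within {w. 0 < Im w} \<times> {w. 0 < Im w})"
      unfolding k_def
      by (intro uniform_limit_uminus uniform_lim_mult fst snd)
        (auto simp: bounded_iff intro!: resolvent_bound p)
  qed
  then show "continuous_on ({0..} \<times> {w. 0 < Im w} \<times> {w. 0 < Im w})
      (\<lambda>(t, a, b). LINT x|s t. - (1 / (a - complex_of_real x) * (1 / (b - complex_of_real x))))"
    unfolding k_def by (simp add: case_prod_beta')
  show "cauchy_transform (s t) a - cauchy_transform (s t) b =
      (LINT x|s t. - (1 / (a - complex_of_real x) * (1 / (b - complex_of_real x)))) * (a - b)"
    if t: "0 \<le> t" and a: "0 < Im a" and b: "0 < Im b" for t a b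
  proof -
    have int: "integrable (s t) (\<lambda>x. 1 / (z - complex_of_real x))" if "0 < Im z" for z
      by (rule resolvent_integrable[OF chordal_finite[OF t] that])
    have "cauchy_transform (s t) a - cauchy_transform (s t) b =
        (LINT x|s t. 1 / (a - complex_of_real x) - 1 / (b - complex_of_real x))"
      unfolding cauchy_transform_def using int a b by simp
    also have "\<dots> = (LINT x|s t. - (1 / (a - complex_of_real x) * (1 / (b - complex_of_real x))) * (a - b))"
    proof (rule Bochner_Integration.integral_cong[OF refl])
      fix x
      have "a - complex_of_real x \<noteq> 0" "b - complex_of_real x \<noteq> 0" using a b by (auto simp: complex_eq_iff)
      then show "1 / (a - complex_of_real x) - 1 / (b - complex_of_real x)
          = - (1 / (a - complex_of_real x) * (1 / (b - complex_of_real x))) * (a - b)"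
        by (simp add: divide_simps)
    qed
    finally show ?thesis by (simp only: integral_mult_left_zero)
  qed
  show "norm (cauchy_transform (s t) a) \<le> 1 / c * M" if "0 \<le> t" "0 < c" "c \<le> Im a" for t c a
  proof -
    have "norm (cauchy_transform (s t) a) \<le> 1 / c * measure (s t) UNIV"
      unfolding cauchy_transform_def using that
      by (intro integral_norm_le[OF chordal_finite] resolvent_continuous resolvent_bound) auto
    also have "\<dots> \<le> 1 / c * M" using M[OF that(1)] that(2) by (intro mult_left_mono) auto
    finally show ?thesis .
  qed
  show "norm (LINT x|s t. - (1 / (a - complex_of_real x) * (1 / (b - complex_of_real x)))) \<le> 1 / c * (1 / c) * M"
    if "0 \<le> t" "0 < c" "c \<le> Im a" "c \<le> Im b" for t c a b
  proof -
    have "norm (LINT x|s t. k (a, b) x) \<le> 1 / c * (1 / c) * measure (s t) UNIV"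
      using that by (intro integral_norm_le[OF chordal_finite] k_cont k_bound) auto
    also have "\<dots> \<le> 1 / c * (1 / c) * M" using M[OF that(1)] that(2) by (intro mult_left_mono) auto
    finally show ?thesis unfolding k_def by simp
  qed
  show "Im (h t\<^sub>2) \<le> Im (h t\<^sub>1)"
    if c: "0 < c" "\<exists>w. c \<le> Im w" and t: "0 \<le> t\<^sub>1" "t\<^sub>1 \<le> t\<^sub>2"
      and h: "\<And>t. t \<in> {t\<^sub>1..t\<^sub>2} \<Longrightarrow>
        (h has_vector_derivative cauchy_transform (s t) (closest_point {w. c \<le> Im w} (h t))) (at t within {t\<^sub>1..t\<^sub>2})"
    for c t\<^sub>1 t\<^sub>2 h
  proof -
    have "- Im (h t\<^sub>1) \<le> - Im (h t\<^sub>2)"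
    proof (rule has_vector_derivative_monotone_on[OF t(2)])
      fix t assume t': "t \<in> {t\<^sub>1..t\<^sub>2}"
      show "((\<lambda>t. - Im (h t)) has_vector_derivative
          - Im (cauchy_transform (s t) (closest_point {w. c \<le> Im w} (h t)))) (at t within {t\<^sub>1..t\<^sub>2})"
        by (intro has_vector_derivative_minus bounded_linear.has_vector_derivative[OF bounded_linear_Im] h t')
      have "closest_point {w. c \<le> Im w} (h t) \<in> {w. c \<le> Im w}"
        using c(2) by (intro closest_point_in_set closed_Collect_le continuous_intros) auto
      then have "0 < Im (closest_point {w. c \<le> Im w} (h t))" using c(1) by simp
      then show "0 \<le> - Im (cauchy_transform (s t) (closest_point {w. c \<le> Im w} (h t)))"
        using t t' by (subst Im_cauchy_transform) auto
    qed
    then show ?thesis by simp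
  qed
qed

end

section \<open>The radial field\<close>

lemma closest_point_cball:
  fixes w :: "'a::euclidean_space"
  assumes "0 \<le> r" "r < norm w"
  shows "closest_point (cball 0 r) w = (r / norm w) *\<^sub>R w"
proof -
  have w: "0 < norm w" using assms by linarith
  have "(r / norm w) *\<^sub>R w = closest_point (cball 0 r) w"
  proof (rule closest_point_unique)
    show "(r / norm w) *\<^sub>R w \<in> cball 0 r" using w assms by simp
    have "w - (r / norm w) *\<^sub>R w = (1 - r / norm w) *\<^sub>R w" by (simp add: scaleR_left_diff_distrib)
    then have "dist w ((r / norm w) *\<^sub>R w) = \<bar>1 - r / norm w\<bar> * norm w" by (simp add: dist_norm)
    also have "\<dots> = norm w - r" using w assms by (simp add: field_simps)
    finally have eq: "dist w ((r / norm w) *\<^sub>R w) = norm w - r" .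
    show "\<forall>z\<in>cball 0 r. dist w ((r / norm w) *\<^sub>R w) \<le> dist w z"
    proof
      fix z :: 'a assume "z \<in> cball 0 r"
      then show "dist w ((r / norm w) *\<^sub>R w) \<le> dist w z"
        using norm_triangle_ineq2[of w z] unfolding eq by (simp add: dist_norm)
    qed
  qed auto
  then show ?thesis ..
qed

lemma herglotz_denominator:
  fixes \<zeta> w :: complex
  assumes "\<zeta> \<in> sphere 0 1" "0 < c" "c \<le> 1 - norm w"
  shows "c \<le> norm (\<zeta> - w)" "\<zeta> - w \<noteq> 0"
proof -
  show *: "c \<le> norm (\<zeta> - w)" using norm_triangle_ineq2[of \<zeta> w] assms by simp
  show "\<zeta> - w \<noteq> 0" using * assms(2) by auto
qed

lemma herglotz_continuous:
  fixes w :: complex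
  assumes "norm w < 1"
  shows "continuous_on (sphere 0 1) (\<lambda>\<zeta>. (\<zeta> + w) / (\<zeta> - w))"
  using assms by (intro continuous_intros) auto

lemma herglotz_bound:
  fixes \<zeta> w :: complex
  assumes "\<zeta> \<in> sphere 0 1" "0 < c" "c \<le> 1 - norm w"
  shows "norm ((\<zeta> + w) / (\<zeta> - w)) \<le> 2 / c"
proof -
  have "norm (\<zeta> + w) \<le> 2" using norm_triangle_ineq[of \<zeta> w] assms by simp
  then show ?thesis unfolding norm_divide
    using herglotz_denominator[OF assms] assms(2) by (intro frac_le) auto
qed

lemma herglotz_integrable:
  fixes w :: complex
  assumes "\<mu> \<in> finite_measures_on (sphere 0 1)" "norm w < 1"
  shows "integrable \<mu> (\<lambda>\<zeta>. (\<zeta> + w) / (\<zeta> - w))"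
  using continuous_integrable_on[OF assms(1) herglotz_continuous[OF assms(2)] herglotz_bound[OF _ _ order_refl]] assms(2)
  by simp

lemma Re_herglotz:
  assumes "norm \<zeta> = 1"
  shows "Re ((\<zeta> + w) / (\<zeta> - w)) = (1 - (norm w)\<^sup>2) / (norm (\<zeta> - w))\<^sup>2"
proof -
  have "(Re \<zeta>)\<^sup>2 + (Im \<zeta>)\<^sup>2 = 1" using assms cmod_power2[of \<zeta>] by simp
  then have "(Re \<zeta> + Re w) * (Re \<zeta> - Re w) + (Im \<zeta> + Im w) * (Im \<zeta> - Im w) = 1 - (norm w)\<^sup>2"
    unfolding cmod_power2 by (simp add: algebra_simps power2_eq_square)
  then show ?thesis by (simp add: Re_divide cmod_power2)
qed

lemma Re_herglotz_integral_nonneg: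
  assumes "\<mu> \<in> finite_measures_on (sphere 0 1)" "norm w < 1"
  shows "0 \<le> Re (LINT \<zeta>|\<mu>. (\<zeta> + w) / (\<zeta> - w))"
proof -
  have "Re (LINT \<zeta>|\<mu>. (\<zeta> + w) / (\<zeta> - w)) = (LINT \<zeta>|\<mu>. Re ((\<zeta> + w) / (\<zeta> - w)))"
    using herglotz_integrable[OF assms] by simp
  also have "0 \<le> \<dots>"
  proof (rule Bochner_Integration.integral_nonneg)
    fix \<zeta> assume "\<zeta> \<in> space \<mu>"
    then have "norm \<zeta> = 1" using finite_measures_onD(3)[OF assms(1)] by simp
    then show "0 \<le> Re ((\<zeta> + w) / (\<zeta> - w))"
      using assms(2) by (simp add: Re_herglotz abs_square_le_1)
  qed
  finally show ?thesis .
qed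

context
  fixes s :: "real \<Rightarrow> complex measure" and M :: real
  assumes s: "s \<in> bounded_paths (sphere 0 1) M_circle"
    and M: "\<And>t. 0 \<le> t \<Longrightarrow> measure (s t) (sphere 0 1) \<le> M"
begin

lemma radial_finite: "0 \<le> t \<Longrightarrow> s t \<in> finite_measures_on (sphere 0 1)"
  using s unfolding bounded_paths_def paths_iff by blast

text \<open>The projection onto a disc around 0 multiplies \<open>h\<close> by a nonnegative factor \<open>\<kappa>\<close>. The derivative of
  \<open>\<bar>h\<bar>\<^sup>2\<close> is therefore \<open>2 \<kappa> \<bar>h\<bar>\<^sup>2 Re p\<close>, where \<open>p\<close> is a Herglotz integral and has nonnegative real part.\<close>

lemma radial_decreasing:
  assumes c: "0 < c" "\<exists>w::complex. c \<le> 1 - norm w" and t: "0 \<le> t\<^sub>1" "t\<^sub>1 \<le> t\<^sub>2"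
    and h: "\<And>t. t \<in> {t\<^sub>1..t\<^sub>2} \<Longrightarrow>
      (h has_vector_derivative radial_field (s t) (closest_point {w. c \<le> 1 - norm w} (h t))) (at t within {t\<^sub>1..t\<^sub>2})"
  shows "1 - norm (h t\<^sub>2) \<le> 1 - norm (h t\<^sub>1)"
proof -
  define r where "r = 1 - c"
  obtain w :: complex where "c \<le> 1 - norm w" using c(2) by blast
  then have r: "0 \<le> r" "r < 1" using c(1) norm_ge_zero[of w] unfolding r_def by linarith+
  have level: "{w::complex. c \<le> 1 - norm w} = cball 0 r" unfolding r_def by auto
  define p where "p t = (LINT \<zeta>|s t. (\<zeta> + closest_point (cball 0 r) (h t)) / (\<zeta> - closest_point (cball 0 r) (h t)))" for t
  define h' where "h' t = closest_point (cball 0 r) (h t) * p t" for t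
  have h_deriv: "(h has_vector_derivative h' t) (at t within {t\<^sub>1..t\<^sub>2})" if "t \<in> {t\<^sub>1..t\<^sub>2}" for t
    using h[OF that] unfolding level h'_def p_def radial_field_def .
  have "Re (h t\<^sub>1) * Re (h t\<^sub>1) + Im (h t\<^sub>1) * Im (h t\<^sub>1) \<le> Re (h t\<^sub>2) * Re (h t\<^sub>2) + Im (h t\<^sub>2) * Im (h t\<^sub>2)"
  proof (rule has_vector_derivative_monotone_on[OF t(2)])
    fix t assume t': "t \<in> {t\<^sub>1..t\<^sub>2}"
    have "((\<lambda>t. Re (h t)) has_vector_derivative Re (h' t)) (at t within {t\<^sub>1..t\<^sub>2})"
      "((\<lambda>t. Im (h t)) has_vector_derivative Im (h' t)) (at t within {t\<^sub>1..t\<^sub>2})"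
      using bounded_linear.has_vector_derivative[OF bounded_linear_Re h_deriv[OF t']]
        bounded_linear.has_vector_derivative[OF bounded_linear_Im h_deriv[OF t']] .
    then show "((\<lambda>t. Re (h t) * Re (h t) + Im (h t) * Im (h t)) has_vector_derivative
        (Re (h t) * Re (h' t) + Re (h' t) * Re (h t)) + (Im (h t) * Im (h' t) + Im (h' t) * Im (h t))) (at t within {t\<^sub>1..t\<^sub>2})"
      by (intro has_vector_derivative_add has_vector_derivative_mult)
    have "closest_point (cball 0 r) (h t) \<in> cball 0 r" using r by (intro closest_point_in_set) auto
    then have "norm (closest_point (cball 0 r) (h t)) < 1" using r by simp
    then have p: "0 \<le> Re (p t)" unfolding p_def
      using t t' by (intro Re_herglotz_integral_nonneg[OF radial_finite]) auto
    obtain \<kappa> where \<kappa>: "0 \<le> \<kappa>" "closest_point (cball 0 r) (h t) = complex_of_real \<kappa> * h t"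
    proof (cases "norm (h t) \<le> r")
      case True
      then have "closest_point (cball 0 r) (h t) = complex_of_real 1 * h t" by (simp add: closest_point_self)
      then show ?thesis by (intro that[of 1]) auto
    next
      case False
      then have "closest_point (cball 0 r) (h t) = complex_of_real (r / norm (h t)) * h t"
        using closest_point_cball[of r "h t"] r by (simp add: scaleR_conv_of_real)
      then show ?thesis using r by (intro that[of "r / norm (h t)"]) auto
    qed
    have "(Re (h t) * Re (h' t) + Re (h' t) * Re (h t)) + (Im (h t) * Im (h' t) + Im (h' t) * Im (h t))
        = 2 * \<kappa> * ((Re (h t))\<^sup>2 + (Im (h t))\<^sup>2) * Re (p t)"
      unfolding h'_def \<kappa>(2) by (simp add: algebra_simps power2_eq_square)
    also have "0 \<le> \<dots>" using \<kappa>(1) p by simp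
    finally show "0 \<le> (Re (h t) * Re (h' t) + Re (h' t) * Re (h t)) + (Im (h t) * Im (h' t) + Im (h' t) * Im (h t))" .
  qed
  then have "(norm (h t\<^sub>1))\<^sup>2 \<le> (norm (h t\<^sub>2))\<^sup>2" unfolding cmod_power2 by (simp add: power2_eq_square)
  then show ?thesis using power2_le_imp_le by auto
qed

text \<open>The divided difference of \<open>w (\<zeta> + w) / (\<zeta> - w)\<close> is
  \<open>(\<zeta>\<^sup>2 + (a + b) \<zeta> - a b) / ((\<zeta> - a) (\<zeta> - b))\<close>, and \<open>\<bar>\<zeta> - w\<bar> \<ge> 1 - \<bar>w\<bar>\<close> gives the bounds.\<close>

lemma radial_loewner_field:
  "loewner_field (\<lambda>w. 1 - norm w) (\<lambda>t. radial_field (s t))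
     (\<lambda>t a b. LINT \<zeta>|s t. (\<zeta>\<^sup>2 + (a + b) * \<zeta> - a * b) / ((\<zeta> - a) * (\<zeta> - b)))
     (\<lambda>c. 2 / c * M) (\<lambda>c. 4 / (c * c) * M)"
proof
  show "continuous_on UNIV (\<lambda>w::complex. 1 - norm w)" by (intro continuous_intros)
  have "{w::complex. c \<le> 1 - norm w} = cball 0 (1 - c)" for c by auto
  then show "convex {w::complex. c \<le> 1 - norm w}" for c by simp
  have bdd: "\<exists>C. \<forall>x\<in>sphere 0 1. norm (f x) \<le> C" if "continuous_on (sphere 0 1) f" for f :: "complex \<Rightarrow> complex"
    using compact_imp_bounded[OF compact_continuous_image[OF that compact_sphere]] unfolding bounded_iff by auto
  have "continuous_on ({0..} \<times> {w. 0 < 1 - norm w}) (\<lambda>(t, w). LINT \<zeta>|s t. (\<zeta> + w) / (\<zeta> - w))"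
  proof (rule path_kernel_continuous[OF s subset_refl])
    fix p :: complex assume p: "p \<in> {w. 0 < 1 - norm w}"
    then show cont: "continuous_on (sphere 0 1) (\<lambda>\<zeta>. (\<zeta> + p) / (\<zeta> - p))" by (intro herglotz_continuous) simp
    show "\<exists>C. \<forall>x\<in>sphere 0 1. norm ((x + p) / (x - p)) \<le> C" by (rule bdd[OF cont])
    show "uniform_limit (sphere 0 1) (\<lambda>q x. (x + q) / (x - q)) (\<lambda>x. (x + p) / (x - p)) (at p within {w. 0 < 1 - norm w})"
      by (rule compact_kernel_uniform_limit[OF compact_sphere _ p])
        (auto simp: case_prod_beta' intro!: continuous_intros)
  qed
  then show "continuous_on ({0..} \<times> {w. 0 < 1 - norm w}) (\<lambda>(t, w). radial_field (s t) w)"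
    unfolding radial_field_def case_prod_beta' by (intro continuous_intros)
  define k where "k p \<zeta> = (\<zeta>\<^sup>2 + (fst p + snd p) * \<zeta> - fst p * snd p) / ((\<zeta> - fst p) * (\<zeta> - snd p))"
    for p :: "complex \<times> complex" and \<zeta>
  have k_cont: "continuous_on (sphere 0 1) (k p)" if "0 < 1 - norm (fst p)" "0 < 1 - norm (snd p)" for p
    unfolding k_def using that by (intro continuous_intros) auto
  have k_bound: "norm (k p \<zeta>) \<le> 4 / (c * c)"
    if "0 < c" "c \<le> 1 - norm (fst p)" "c \<le> 1 - norm (snd p)" "\<zeta> \<in> sphere 0 1" for c p \<zeta>
  proof -
    have "norm (\<zeta>\<^sup>2 + (fst p + snd p) * \<zeta> - fst p * snd p) \<le> norm (\<zeta>\<^sup>2) + norm (fst p + snd p) * norm \<zeta> + norm (fst p) * norm (snd p)"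
      by (metis (no_types, opaque_lifting) add_mono_thms_linordered_semiring(3) norm_mult norm_triangle_ineq norm_triangle_ineq4 order_trans)
    also have "\<dots> \<le> 1 + (norm (fst p) + norm (snd p)) * 1 + 1 * 1"
    proof (intro add_mono mult_mono)
      show "norm (\<zeta>\<^sup>2) \<le> 1" "norm \<zeta> \<le> 1" using that(4) by (auto simp: norm_power)
      show "norm (fst p) \<le> 1" "norm (snd p) \<le> 1" using that by auto
    qed (auto intro: norm_triangle_ineq)
    also have "\<dots> \<le> 4" using that by simp
    finally have "norm (\<zeta>\<^sup>2 + (fst p + snd p) * \<zeta> - fst p * snd p) \<le> 4" .
    moreover have "c * c \<le> norm (\<zeta> - fst p) * norm (\<zeta> - snd p)"
      using herglotz_denominator(1)[OF that(4,1,2)] herglotz_denominator(1)[OF that(4,1,3)] that(1)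
      by (intro mult_mono) auto
    ultimately show ?thesis unfolding k_def norm_divide norm_mult
      using that(1) by (intro frac_le) auto
  qed
  have "continuous_on ({0..} \<times> ({w. 0 < 1 - norm w} \<times> {w. 0 < 1 - norm w})) (\<lambda>(t, p). LINT \<zeta>|s t. k p \<zeta>)"
  proof (rule path_kernel_continuous[OF s subset_refl])
    fix p :: "complex \<times> complex" assume p: "p \<in> {w. 0 < 1 - norm w} \<times> {w. 0 < 1 - norm w}"
    then show cont: "continuous_on (sphere 0 1) (k p)" by (intro k_cont) auto
    show "\<exists>C. \<forall>x\<in>sphere 0 1. norm (k p x) \<le> C" by (rule bdd[OF cont])
    show "uniform_limit (sphere 0 1) k (k p) (at p within {w. 0 < 1 - norm w} \<times> {w. 0 < 1 - norm w})"
      by (rule compact_kernel_uniform_limit[OF compact_sphere _ p])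
        (auto simp: k_def case_prod_beta' intro!: continuous_intros)
  qed
  then show "continuous_on ({0..} \<times> {w. 0 < 1 - norm w} \<times> {w. 0 < 1 - norm w})
      (\<lambda>(t, a, b). LINT \<zeta>|s t. (\<zeta>\<^sup>2 + (a + b) * \<zeta> - a * b) / ((\<zeta> - a) * (\<zeta> - b)))"
    unfolding k_def by (simp add: case_prod_beta')
  show "radial_field (s t) a - radial_field (s t) b =
      (LINT \<zeta>|s t. (\<zeta>\<^sup>2 + (a + b) * \<zeta> - a * b) / ((\<zeta> - a) * (\<zeta> - b))) * (a - b)"
    if t: "0 \<le> t" and a: "0 < 1 - norm a" and b: "0 < 1 - norm b" for t a b
  proof -
    have "radial_field (s t) a - radial_field (s t) b =
        (LINT \<zeta>|s t. a * ((\<zeta> + a) / (\<zeta> - a)) - b * ((\<zeta> + b) / (\<zeta> - b)))"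
    proof -
      have "integrable (s t) (\<lambda>\<zeta>. w * ((\<zeta> + w) / (\<zeta> - w)))" if "0 < 1 - norm w" for w
        using that by (intro integrable_mult_right herglotz_integrable[OF radial_finite[OF t]]) simp
      then show ?thesis unfolding radial_field_def integral_mult_right_zero[symmetric] using a b
        by (intro Bochner_Integration.integral_diff[symmetric]) auto
    qed
    also have "\<dots> = (LINT \<zeta>|s t. (\<zeta>\<^sup>2 + (a + b) * \<zeta> - a * b) / ((\<zeta> - a) * (\<zeta> - b)) * (a - b))"
    proof (rule Bochner_Integration.integral_cong[OF refl])
      fix \<zeta> assume "\<zeta> \<in> space (s t)"
      then have "\<zeta> \<in> sphere 0 1" using finite_measures_onD(3)[OF radial_finite[OF t]] by simp
      then have "\<zeta> - a \<noteq> 0" "\<zeta> - b \<noteq> 0" using a b by auto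
      then show "a * ((\<zeta> + a) / (\<zeta> - a)) - b * ((\<zeta> + b) / (\<zeta> - b))
          = (\<zeta>\<^sup>2 + (a + b) * \<zeta> - a * b) / ((\<zeta> - a) * (\<zeta> - b)) * (a - b)"
        by (simp add: divide_simps) (simp add: algebra_simps power2_eq_square)
    qed
    finally show ?thesis by (simp only: integral_mult_left_zero)
  qed
  show "norm (radial_field (s t) a) \<le> 2 / c * M" if "0 \<le> t" "0 < c" "c \<le> 1 - norm a" for t c a
  proof -
    have "norm (LINT \<zeta>|s t. (\<zeta> + a) / (\<zeta> - a)) \<le> 2 / c * measure (s t) (sphere 0 1)"
      using that by (intro integral_norm_le[OF radial_finite] herglotz_continuous herglotz_bound) auto
    also have "\<dots> \<le> 2 / c * M" using M[OF that(1)] that(2) by (intro mult_left_mono) auto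
    finally have "norm a * norm (LINT \<zeta>|s t. (\<zeta> + a) / (\<zeta> - a)) \<le> 1 * (2 / c * M)"
      using that by (intro mult_mono) auto
    then show ?thesis unfolding radial_field_def norm_mult by simp
  qed
  show "norm (LINT \<zeta>|s t. (\<zeta>\<^sup>2 + (a + b) * \<zeta> - a * b) / ((\<zeta> - a) * (\<zeta> - b))) \<le> 4 / (c * c) * M"
    if "0 \<le> t" "0 < c" "c \<le> 1 - norm a" "c \<le> 1 - norm b" for t c a b
  proof -
    have "norm (LINT \<zeta>|s t. k (a, b) \<zeta>) \<le> 4 / (c * c) * measure (s t) (sphere 0 1)"
      using that by (intro integral_norm_le[OF radial_finite] k_cont k_bound) auto
    also have "\<dots> \<le> 4 / (c * c) * M" using M[OF that(1)] that(2) by (intro mult_left_mono) auto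
    finally show ?thesis unfolding k_def by simp
  qed
qed (rule radial_decreasing)

end

section \<open>Circle averages and the Herglotz representation\<close>

lemma interval_density:
  fixes g :: "real \<Rightarrow> real" and f :: "real \<Rightarrow> 'b::euclidean_space"
  assumes g: "continuous_on {a..b} g" "\<And>x. x \<in> {a..b} \<Longrightarrow> 0 \<le> g x"
  shows interval_density_integral: "f \<in> borel_measurable borel \<Longrightarrow> continuous_on {a..b} f \<Longrightarrow>
      integral\<^sup>L (density lborel (\<lambda>x. ennreal (indicator {a..b} x * g x))) f = integral {a..b} (\<lambda>x. g x *\<^sub>R f x)"
    and interval_density_prob: "integral {a..b} g = 1 \<Longrightarrow>
      prob_space (density lborel (\<lambda>x. ennreal (indicator {a..b} x * g x)))"
proof -
  have meas: "(\<lambda>x. indicator {a..b} x * g x) \<in> borel_measurable borel"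
    using borel_measurable_continuous_on_indicator[OF _ g(1)] by simp
  have nonneg: "0 \<le> indicator {a..b} x * g x" for x using g(2)[of x] by (auto simp: indicator_def)
  show "integral\<^sup>L (density lborel (\<lambda>x. ennreal (indicator {a..b} x * g x))) f = integral {a..b} (\<lambda>x. g x *\<^sub>R f x)"
    if f: "f \<in> borel_measurable borel" "continuous_on {a..b} f"
  proof -
    have "integral\<^sup>L (density lborel (\<lambda>x. ennreal (indicator {a..b} x * g x))) f
        = (LINT x|lborel. (indicator {a..b} x * g x) *\<^sub>R f x)"
      by (rule integral_density) (use f(1) meas nonneg in auto)
    also have "\<dots> = (LINT x:{a..b}|lborel. g x *\<^sub>R f x)" unfolding set_lebesgue_integral_def by simp
    also have "\<dots> = integral {a..b} (\<lambda>x. g x *\<^sub>R f x)"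
    proof (rule set_borel_integral_eq_integral(2))
      show "set_integrable lborel {a..b} (\<lambda>x. g x *\<^sub>R f x)"
        unfolding set_integrable_def by (intro borel_integrable_compact continuous_intros g f compact_Icc)
    qed
    finally show ?thesis .
  qed
  assume one: "integral {a..b} g = 1"
  have int: "set_integrable lborel {a..b} g"
    unfolding set_integrable_def by (rule borel_integrable_compact[OF compact_Icc g(1)])
  show "prob_space (density lborel (\<lambda>x. ennreal (indicator {a..b} x * g x)))"
  proof
    have "emeasure (density lborel (\<lambda>x. ennreal (indicator {a..b} x * g x))) UNIV = (\<integral>\<^sup>+x. ennreal (indicator {a..b} x * g x) \<partial>lborel)"
      using meas by (subst emeasure_density) auto
    also have "\<dots> = ennreal (LINT x|lborel. indicator {a..b} x * g x)"
      using int nonneg by (intro nn_integral_eq_integral) (auto simp: set_integrable_def)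
    also have "(LINT x|lborel. indicator {a..b} x * g x) = 1"
      using set_borel_integral_eq_integral(2)[OF int] one unfolding set_lebesgue_integral_def by simp
    finally show "emeasure (density lborel (\<lambda>x. ennreal (indicator {a..b} x * g x))) (space (density lborel (\<lambda>x. ennreal (indicator {a..b} x * g x)))) = 1"
      by simp
  qed
qed

lemma circle_cauchy:
  assumes "continuous_on (cball 0 1) f" "f holomorphic_on ball 0 1" "norm z < 1"
  shows "((\<lambda>x. f (cis (2 * pi * x)) * (cis (2 * pi * x) / (cis (2 * pi * x) - z))) has_integral f z) {0..1}"
proof -
  have "((\<lambda>u. f u / (u - z)) has_contour_integral (2 * of_real pi * \<i> * f z)) (circlepath 0 1)"
    using assms by (intro Cauchy_integral_circlepath) auto
  then have "((\<lambda>x. f (circlepath 0 1 x) / (circlepath 0 1 x - z) * vector_derivative (circlepath 0 1) (at x within {0..1}))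
      has_integral (2 * of_real pi * \<i> * f z)) {0..1}"
    unfolding has_contour_integral_def .
  then have "((\<lambda>x. (2 * of_real pi * \<i>) * (f (cis (2 * pi * x)) * (cis (2 * pi * x) / (cis (2 * pi * x) - z))))
      has_integral (2 * of_real pi * \<i> * f z)) {0..1}"
  proof (rule has_integral_eq[rotated])
    fix x :: real assume x: "x \<in> {0..1}"
    have e: "circlepath 0 1 x = cis (2 * pi * x)" "exp (2 * of_real pi * \<i> * of_real x) = cis (2 * pi * x)"
      unfolding circlepath cis_conv_exp by (simp_all add: mult_ac)
    show "f (circlepath 0 1 x) / (circlepath 0 1 x - z) * vector_derivative (circlepath 0 1) (at x within {0..1})
        = (2 * of_real pi * \<i>) * (f (cis (2 * pi * x)) * (cis (2 * pi * x) / (cis (2 * pi * x) - z)))"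
      using x by (simp add: vector_derivative_circlepath01 e)
  qed
  from has_integral_mult_right[OF this, of "1 / (2 * of_real pi * \<i>)"] show ?thesis by simp
qed

lemma circle_mean:
  assumes "continuous_on (cball 0 1) f" "f holomorphic_on ball 0 1"
  shows "((\<lambda>x. f (cis (2 * pi * x))) has_integral f 0) {0..1}"
  using circle_cauchy[OF assms, of 0] by simp

text \<open>Split \<open>Re q = (q + cnj q) / 2\<close>. The part with \<open>q\<close> is Cauchy's formula. In the part with \<open>cnj q\<close>,
  conjugating the kernel on the circle gives \<open>(1 + cnj z u) / (1 - cnj z u)\<close>, which is holomorphic in
  the disc, and the mean value property applies.\<close>

lemma schwarz_integral:
  assumes q: "continuous_on (cball 0 1) q" "q holomorphic_on ball 0 1" and z: "norm z < 1"
  shows "((\<lambda>x. of_real (Re (q (cis (2 * pi * x)))) * ((cis (2 * pi * x) + z) / (cis (2 * pi * x) - z)))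
    has_integral (q z - \<i> * of_real (Im (q 0)))) {0..1}"
proof -
  define e where "e x = cis (2 * pi * x)" for x
  have e: "norm (e x) = 1" "e x * cnj (e x) = 1" for x unfolding e_def by (auto simp: cis_cnj cis_mult)
  have ez: "e x - z \<noteq> 0" for x using e(1)[of x] z by auto
  have "((\<lambda>x. 2 * (q (e x) * (e x / (e x - z))) - q (e x)) has_integral (2 * q z - q 0)) {0..1}"
    unfolding e_def by (intro has_integral_diff has_integral_mult_right circle_cauchy circle_mean assms)
  moreover have "2 * (q (e x) * (e x / (e x - z))) - q (e x) = q (e x) * ((e x + z) / (e x - z))" for x
    using ez[of x] by (simp add: field_simps)
  ultimately have A: "((\<lambda>x. q (e x) * ((e x + z) / (e x - z))) has_integral (2 * q z - q 0)) {0..1}" by simp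
  have nz: "1 - cnj z * u \<noteq> 0" if "norm u \<le> 1" for u
  proof
    assume "1 - cnj z * u = 0"
    then have "cnj z * u = 1" by simp
    then have "norm (cnj z * u) = 1" by (simp only: norm_one)
    moreover have "norm z * norm u \<le> norm z * 1" using that by (intro mult_left_mono) auto
    ultimately show False using z by (simp add: norm_mult)
  qed
  have "((\<lambda>x. q (e x) * ((1 + cnj z * e x) / (1 - cnj z * e x))) has_integral q 0 * ((1 + cnj z * 0) / (1 - cnj z * 0))) {0..1}"
    unfolding e_def
  proof (rule circle_mean)
    show "continuous_on (cball 0 1) (\<lambda>u. q u * ((1 + cnj z * u) / (1 - cnj z * u)))"
      by (intro continuous_intros q) (use nz in auto)
    show "(\<lambda>u. q u * ((1 + cnj z * u) / (1 - cnj z * u))) holomorphic_on ball 0 1"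
      by (intro holomorphic_intros q) (use nz in auto)
  qed
  then have B': "(cnj \<circ> (\<lambda>x. q (e x) * ((1 + cnj z * e x) / (1 - cnj z * e x))) has_integral cnj (q 0)) {0..1}"
    unfolding has_integral_cnj by simp
  have cnj_eq: "(cnj \<circ> (\<lambda>x. q (e x) * ((1 + cnj z * e x) / (1 - cnj z * e x)))) x = cnj (q (e x)) * ((e x + z) / (e x - z))" for x
  proof -
    have "(1 + z * cnj (e x)) * (e x - z) = (e x + z) * (1 - z * cnj (e x))"
      using e(2)[of x] by (simp add: algebra_simps)
    moreover have "1 - z * cnj (e x) \<noteq> 0" using nz[of "e x"] e(1)[of x]
      by (metis complex_cnj_cnj complex_cnj_diff complex_cnj_mult complex_cnj_one complex_cnj_zero order_refl)
    ultimately have eq: "(1 + z * cnj (e x)) / (1 - z * cnj (e x)) = (e x + z) / (e x - z)"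
      using ez[of x] by (simp add: frac_eq_eq)
    have "cnj (q (e x) * ((1 + cnj z * e x) / (1 - cnj z * e x)))
        = cnj (q (e x)) * ((1 + z * cnj (e x)) / (1 - z * cnj (e x)))" by simp
    then show ?thesis unfolding eq o_def .
  qed
  have B: "((\<lambda>x. cnj (q (e x)) * ((e x + z) / (e x - z))) has_integral cnj (q 0)) {0..1}"
    by (rule has_integral_eq[OF cnj_eq B'])
  have C: "((\<lambda>x. 1/2 * (q (e x) * ((e x + z) / (e x - z)) + cnj (q (e x)) * ((e x + z) / (e x - z))))
      has_integral (1/2 * ((2 * q z - q 0) + cnj (q 0)))) {0..1}"
    by (intro has_integral_mult_right has_integral_add A B)
  have eq1: "1/2 * (q (e x) * ((e x + z) / (e x - z)) + cnj (q (e x)) * ((e x + z) / (e x - z)))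
      = of_real (Re (q (e x))) * ((e x + z) / (e x - z))" for x
    unfolding distrib_right[symmetric] complex_add_cnj by simp
  have eq2: "1/2 * ((2 * q z - q 0) + cnj (q 0)) = q z - \<i> * of_real (Im (q 0))"
    by (simp add: complex_eq_iff)
  show ?thesis using C unfolding eq1 eq2 unfolding e_def .
qed

text \<open>On a circle of radius \<open>r < 1\<close> the real part of \<open>p\<close> is a probability density, and \<open>schwarz_integral\<close>
  is the representation of the dilated function \<open>p (r z)\<close>. As \<open>r \<rightarrow> 1\<close> these probability measures
  have a weak limit point, which represents \<open>p\<close>. Compactness is taken from Helly's theorem
  on the line, so the measures are kept on \<open>[0, 1]\<close> as long as possible and moved to
  the circle at the end.\<close>

theorem herglotz_representation:
  assumes p: "p holomorphic_on ball 0 1" "\<And>z. norm z < 1 \<Longrightarrow> 0 \<le> Re (p z)" "p 0 = 1"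
  obtains \<nu> where "\<nu> \<in> M1_circle"
    "\<And>z. norm z < 1 \<Longrightarrow> p z = (LINT \<zeta>|\<nu>. (\<zeta> + z) / (\<zeta> - z))"
proof -
  define e where "e x = cis (2 * pi * x)" for x
  have e_norm: "norm (e x) = 1" for x unfolding e_def by simp
  have e_cont: "continuous_on S e" for S unfolding e_def by (intro continuous_intros)
  define r where "r n = 1 - 1 / (real n + 2)" for n
  have r: "0 < r n" "r n < 1" for n unfolding r_def by (auto simp: field_simps)
  define q where "q n z = p (of_real (r n) * z)" for n z
  have disc: "norm (of_real (r n) * z) < 1" if "norm z \<le> 1" for n and z :: complex
  proof -
    have "norm (of_real (r n) * z) = r n * norm z" using r(1)[of n] by (simp add: norm_mult)
    also have "\<dots> \<le> r n * 1" using that r(1)[of n] by (intro mult_left_mono) auto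
    also have "\<dots> < 1" using r(2) by simp
    finally show ?thesis .
  qed
  have disc_img: "(\<lambda>z::complex. of_real (r n) * z) ` cball 0 1 \<subseteq> ball 0 1" for n
    by (intro image_subsetI) (simp only: mem_ball_0 mem_cball_0 disc)
  have p_cont: "continuous_on (ball 0 1) p" by (rule holomorphic_on_imp_continuous_on[OF p(1)])
  have q_cont: "continuous_on (cball 0 1) (q n)" for n
    unfolding q_def by (rule continuous_on_compose2[OF p_cont _ disc_img]) (intro continuous_intros)
  have q_hol: "q n holomorphic_on ball 0 1" for n
  proof -
    have "p \<circ> (\<lambda>z. of_real (r n) * z) holomorphic_on ball 0 1"
      using disc_img[of n] by (intro holomorphic_on_compose_gen[OF _ p(1)] holomorphic_intros) force
    then show ?thesis unfolding q_def o_def .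
  qed
  have q0: "q n 0 = 1" for n unfolding q_def using p(3) by simp
  define g where "g n x = Re (q n (e x))" for n x
  have g_cont: "continuous_on {0..1} (g n)" for n
    unfolding g_def by (intro continuous_on_Re continuous_on_compose2[OF q_cont e_cont]) (auto simp: e_norm)
  have g_nonneg: "0 \<le> g n x" for n x unfolding g_def q_def by (intro p(2) disc) (simp add: e_norm)
  define N where "N n = density lborel (\<lambda>x. ennreal (indicator {0..1} x * g n x))" for n
  have g_int: "integral {0..1} (g n) = 1" for n
  proof -
    have "((\<lambda>x. q n (e x)) has_integral q n 0) {0..1}" unfolding e_def by (rule circle_mean[OF q_cont q_hol])
    from has_integral_Re[OF this] show ?thesis unfolding g_def q0 by (simp add: integral_unique)
  qed
  have N_prob: "prob_space (N n)" for n
    unfolding N_def by (rule interval_density_prob[OF g_cont g_nonneg g_int])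
  have N_real: "real_distribution (N n)" for n
    using N_prob[of n] unfolding real_distribution_def real_distribution_axioms_def N_def by simp
  \<comment> \<open>Tightness is stated with half-open intervals; \<open>{-1<..1}\<close> contains the carrier \<open>[0, 1]\<close>.\<close>
  have N_mass: "measure (N n) {-1<..1} = 1" for n
  proof -
    interpret prob_space "N n" by (rule N_prob)
    have "AE x in N n. x \<in> {-1<..1}" unfolding N_def
      using borel_measurable_continuous_on_indicator[OF _ g_cont[of n]]
      by (subst AE_density) (auto simp: indicator_def)
    then show ?thesis by (subst prob_eq_1) (auto simp: N_def)
  qed
  have "tight N" unfolding tight_def
  proof (intro conjI allI impI N_real)
    fix \<epsilon> :: real assume "0 < \<epsilon>"
    then show "\<exists>a b. a < b \<and> (\<forall>n. measure (N n) {a<..b} > 1 - \<epsilon>)"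
      by (intro exI[of _ "-1"] exI[of _ 1]) (simp add: N_mass)
  qed
  from tight_imp_convergent_subsubsequence[OF this strict_mono_id]
  obtain \<sigma> M where \<sigma>: "strict_mono \<sigma>" and M: "real_distribution M" and conv: "weak_conv_m (N \<circ> id \<circ> \<sigma>) M"
    by blast
  interpret M: real_distribution M by (rule M)
  define \<nu> where "\<nu> = distr M (restrict_space borel (sphere 0 1)) e"
  have e_meas: "e \<in> measurable M (restrict_space borel (sphere 0 1))"
  proof (rule measurable_restrict_space2)
    have "e \<in> borel_measurable borel" by (rule borel_measurable_continuous_onI[OF e_cont])
    then show "e \<in> borel_measurable M" using measurable_cong_sets[OF M.events_eq_borel refl] by blast
    show "e \<in> space M \<rightarrow> sphere 0 1" by (simp add: e_norm)
  qed
  have \<nu>: "\<nu> \<in> M1_circle"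
    unfolding prob_measures_on_def finite_measures_on_def \<nu>_def
    using M.prob_space_distr[OF e_meas] prob_space.finite_measure by auto
  have rep: "p z = (LINT \<zeta>|\<nu>. (\<zeta> + z) / (\<zeta> - z))" if z: "norm z < 1" for z
  proof -
    define f where "f x = (e x + z) / (e x - z)" for x
    have ez: "e x - z \<noteq> 0" for x using e_norm[of x] z by auto
    have f_cont: "continuous_on S f" for S unfolding f_def using ez by (intro continuous_intros e_cont) auto
    have f_meas: "f \<in> borel_measurable borel" by (rule borel_measurable_continuous_onI[OF f_cont])
    have f_bound: "norm (f x) \<le> 2 / (1 - norm z)" for x
      unfolding f_def using z by (intro herglotz_bound) (auto simp: e_norm)
    have "(\<lambda>n. integral\<^sup>L ((N \<circ> id \<circ> \<sigma>) n) f) \<longlonglongrightarrow> integral\<^sup>L M f"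
    proof (rule weak_conv_imp_integral_bdd_continuous_conv[OF _ M conv _ f_bound])
      show "real_distribution ((N \<circ> id \<circ> \<sigma>) n)" for n by (simp add: N_real)
      show "isCont f x" for x using f_cont[of UNIV] by (simp add: continuous_on_eq_continuous_at)
    qed
    moreover have "integral\<^sup>L (N n) f = p (of_real (r n) * z)" for n
    proof -
      have "integral\<^sup>L (N n) f = integral {0..1} (\<lambda>x. g n x *\<^sub>R f x)"
        unfolding N_def by (rule interval_density_integral[OF g_cont g_nonneg f_meas f_cont])
      also have "\<dots> = q n z - \<i> * of_real (Im (q n 0))"
        using schwarz_integral[OF q_cont q_hol z, of n] unfolding g_def f_def e_def
        by (simp add: integral_unique scaleR_conv_of_real)
      finally show ?thesis unfolding q0 by (simp add: q_def)
    qed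
    ultimately have "(\<lambda>n. p (of_real (r (\<sigma> n)) * z)) \<longlonglongrightarrow> integral\<^sup>L M f" by simp
    moreover have "(\<lambda>n. p (of_real (r (\<sigma> n)) * z)) \<longlonglongrightarrow> p z"
    proof -
      have "(\<lambda>n. 1 / (real n + 2)) \<longlonglongrightarrow> 0" by real_asymp
      then have "r \<longlonglongrightarrow> 1 - 0" unfolding r_def[abs_def] by (intro tendsto_intros)
      then have "(r \<circ> \<sigma>) \<longlonglongrightarrow> 1" using LIMSEQ_subseq_LIMSEQ[OF _ \<sigma>] by auto
      then have "(\<lambda>n. of_real (r (\<sigma> n)) * z) \<longlonglongrightarrow> of_real 1 * z" unfolding o_def by (intro tendsto_intros)
      moreover have "isCont p z" using p_cont z by (simp add: continuous_on_eq_continuous_at)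
      ultimately show ?thesis using isCont_tendsto_compose by (metis mult_1 of_real_1)
    qed
    ultimately have "p z = integral\<^sup>L M f" using LIMSEQ_unique by blast
    also have "\<dots> = (LINT \<zeta>|\<nu>. (\<zeta> + z) / (\<zeta> - z))"
      unfolding \<nu>_def f_def
      by (subst integral_distr[OF e_meas])
        (use z in \<open>auto intro!: borel_measurable_continuous_on_restrict herglotz_continuous\<close>)
    finally show ?thesis .
  qed
  show ?thesis by (rule that[OF \<nu> rep])
qed

section \<open>Weak convergence on the circle\<close>

lemma tendsto_by_approximation:
  fixes f :: "'i \<Rightarrow> 'a::metric_space"
  assumes "\<And>e. 0 < e \<Longrightarrow> \<exists>g m. (g \<longlongrightarrow> m) F \<and> (\<forall>\<^sub>F i in F. dist (f i) (g i) \<le> e) \<and> dist l m \<le> e"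
  shows "(f \<longlongrightarrow> l) F"
proof (rule tendstoI)
  fix e :: real assume e: "0 < e"
  then have "0 < e / 4" by simp
  from assms[OF this] obtain g m where g: "(g \<longlongrightarrow> m) F" "\<forall>\<^sub>F i in F. dist (f i) (g i) \<le> e / 4" "dist l m \<le> e / 4"
    by blast
  have "\<forall>\<^sub>F i in F. dist (g i) m < e / 4" using g(1) e by (intro tendstoD) auto
  with g(2) show "\<forall>\<^sub>F i in F. dist (f i) l < e"
  proof eventually_elim
    case (elim i)
    have "dist (f i) l \<le> dist (f i) (g i) + dist (g i) m + dist l m"
      using dist_triangle[of "f i" l "g i"] dist_triangle[of "g i" l m] by (simp add: dist_commute)
    then show ?case using elim g(3) e by linarith
  qed
qed

text \<open>The functions \<open>max 0 (1 - n * infdist x C)\<close> are continuous and decrease to the indicator of a closed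
  set \<open>C\<close>; closed sets are stable under intersection and generate the Borel sets. The measures are pushed
  forward from \<open>X\<close> to the whole space to have them on one generated algebra.\<close>

lemma measure_eqI_continuous:
  fixes \<mu> \<nu> :: "'a::metric_space measure"
  assumes \<mu>: "\<mu> \<in> finite_measures_on X" and \<nu>: "\<nu> \<in> finite_measures_on X"
    and eq: "\<And>\<phi> :: 'a \<Rightarrow> real. continuous_on X \<phi> \<Longrightarrow> bounded (\<phi> ` X) \<Longrightarrow> (LINT x|\<mu>. \<phi> x) = (LINT x|\<nu>. \<phi> x)"
  shows "\<mu> = \<nu>"
proof (rule measure_eqI)
  show sets: "sets \<mu> = sets \<nu>" using finite_measures_onD(2)[OF \<mu>] finite_measures_onD(2)[OF \<nu>] by simp
  define ext where "ext m = distr m borel (\<lambda>x. x)" for m :: "'a measure"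
  have id_meas: "(\<lambda>x. x) \<in> borel_measurable m" if "m \<in> finite_measures_on X" for m :: "'a measure"
    by (rule continuous_measurable_on[OF that continuous_on_id])
  have ext_emeasure: "emeasure (ext m) C = emeasure m (C \<inter> X)"
    if "m \<in> finite_measures_on X" "C \<in> sets borel" for m and C
    unfolding ext_def using emeasure_distr[OF id_meas[OF that(1)] that(2)] finite_measures_onD(3)[OF that(1)] by simp
  have closed: "emeasure (ext \<mu>) C = emeasure (ext \<nu>) C" if C: "closed C" for C
  proof (cases "C = {}")
    case False
    define \<phi> where "\<phi> n x = max 0 (1 - real n * infdist x C)" for n x
    have \<phi>_cont: "continuous_on X (\<phi> n)" for n unfolding \<phi>_def by (intro continuous_intros)
    have \<phi>_bdd: "norm (\<phi> n x) \<le> 1" for n x unfolding \<phi>_def by (auto simp: infdist_nonneg)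
    have lim: "(\<lambda>n. \<phi> n x) \<longlonglongrightarrow> indicator C x" for x
    proof (cases "x \<in> C")
      case True
      then show ?thesis unfolding \<phi>_def by simp
    next
      case out: False
      then have d: "0 < infdist x C"
        using in_closed_iff_infdist_zero[OF C False] infdist_nonneg[of x C] by (metis less_eq_real_def)
      obtain N where N: "1 / infdist x C < real N" using reals_Archimedean2 by blast
      have "\<phi> n x = 0" if "N \<le> n" for n
      proof -
        have "1 / infdist x C < real n" using N that by linarith
        then have "1 < real n * infdist x C" using d by (simp add: field_simps)
        then show ?thesis unfolding \<phi>_def by simp
      qed
      then have "\<forall>\<^sub>F n in sequentially. \<phi> n x = 0" by (auto simp: eventually_sequentially)
      then show ?thesis using out by (simp add: tendsto_eventually)
    qed
    have conv: "(\<lambda>n. LINT x|m. \<phi> n x) \<longlonglongrightarrow> measure m (C \<inter> X)" if m: "m \<in> finite_measures_on X" for m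
    proof -
      interpret finite_measure m by (rule finite_measures_onD(1)[OF m])
      have C_meas: "C \<inter> X \<in> sets m" using measurable_sets[OF id_meas[OF m], of C] C finite_measures_onD(3)[OF m] by auto
      have "(\<lambda>n. LINT x|m. \<phi> n x) \<longlonglongrightarrow> (LINT x|m. indicator C x)"
      proof (rule integral_dominated_convergence[where w = "\<lambda>_. 1"])
        show "\<phi> n \<in> borel_measurable m" for n by (rule continuous_measurable_on[OF m \<phi>_cont])
        show "indicator C \<in> borel_measurable m"
          using borel_measurable_indicator[OF borel_closed[OF C]] id_meas[OF m] measurable_compose by blast
      qed (use lim \<phi>_bdd in auto)
      also have "(LINT x|m. indicator C x :: real) = (LINT x|m. indicator (C \<inter> X) x)"
        by (rule Bochner_Integration.integral_cong) (use finite_measures_onD(3)[OF m] in \<open>auto simp: indicator_def\<close>)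
      also have "\<dots> = measure m (C \<inter> X)" using C_meas by simp
      finally show ?thesis .
    qed
    have "(LINT x|\<mu>. \<phi> n x) = (LINT x|\<nu>. \<phi> n x)" for n
      using \<phi>_bdd by (intro eq[OF \<phi>_cont]) (auto simp: bounded_iff)
    then have "measure \<mu> (C \<inter> X) = measure \<nu> (C \<inter> X)"
      using conv[OF \<mu>] conv[OF \<nu>] LIMSEQ_unique by auto
    then show ?thesis
      using ext_emeasure[OF \<mu> borel_closed[OF C]] ext_emeasure[OF \<nu> borel_closed[OF C]]
        finite_measure.emeasure_eq_measure[OF finite_measures_onD(1)[OF \<mu>]]
        finite_measure.emeasure_eq_measure[OF finite_measures_onD(1)[OF \<nu>]] by simp
  qed simp
  have ext_eq: "ext \<mu> = ext \<nu>"
  proof (rule measure_eqI_generator_eq[of "Collect closed" UNIV _ _ "\<lambda>_. UNIV"])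
    show "Int_stable (Collect closed :: 'a set set)" by (auto simp: Int_stable_def)
    show "emeasure (ext \<mu>) C = emeasure (ext \<nu>) C" if "C \<in> Collect closed" for C using closed that by simp
    show "sets (ext \<mu>) = sigma_sets UNIV (Collect closed)" "sets (ext \<nu>) = sigma_sets UNIV (Collect closed)"
      unfolding ext_def by (simp_all add: borel_eq_closed)
    show "emeasure (ext \<mu>) UNIV \<noteq> \<infinity>"
      using ext_emeasure[OF \<mu>, of UNIV] finite_measure.emeasure_finite[OF finite_measures_onD(1)[OF \<mu>]] by simp
  qed auto
  fix A assume "A \<in> sets \<mu>"
  then obtain A' where A': "A' \<in> sets borel" "A = A' \<inter> X"
    unfolding finite_measures_onD(2)[OF \<mu>] sets_restrict_space by auto
  show "emeasure \<mu> A = emeasure \<nu> A"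
    using ext_emeasure[OF \<mu> A'(1)] ext_emeasure[OF \<nu> A'(1)] ext_eq A'(2) by simp
qed

lemma psi_kernel_eq:
  assumes "norm \<zeta> = 1" "norm z < 1"
  shows "z * cnj \<zeta> / (1 - z * cnj \<zeta>) = z / (\<zeta> - z)" "1 - z * cnj \<zeta> \<noteq> 0" "\<zeta> - z \<noteq> 0"
proof -
  show nz: "\<zeta> - z \<noteq> 0" using assms by auto
  have c: "\<zeta> * cnj \<zeta> = 1" using assms(1) complex_norm_square[of \<zeta>] by simp
  have "\<zeta> * (1 - z * cnj \<zeta>) = \<zeta> - z" using c by (simp add: algebra_simps)
  then show nz': "1 - z * cnj \<zeta> \<noteq> 0" using nz by auto
  have "z * cnj \<zeta> * (\<zeta> - z) = z * (1 - z * cnj \<zeta>)" using c by (simp add: algebra_simps)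
  then show "z * cnj \<zeta> / (1 - z * cnj \<zeta>) = z / (\<zeta> - z)" using nz nz' by (simp add: frac_eq_eq)
qed

lemma psi_eq:
  assumes "\<nu> \<in> finite_measures_on (sphere 0 1)" "norm z < 1"
  shows "psi \<nu> z = (LINT \<zeta>|\<nu>. z / (\<zeta> - z))"
  unfolding psi_def
  by (rule Bochner_Integration.integral_cong[OF refl])
    (use psi_kernel_eq[OF _ assms(2)] finite_measures_onD(3)[OF assms(1)] in auto)

lemma psi_herglotz:
  assumes "\<nu> \<in> M1_circle" "norm z < 1"
  shows "(LINT \<zeta>|\<nu>. (\<zeta> + z) / (\<zeta> - z)) = 1 + 2 * psi \<nu> z"
proof -
  note \<nu> = prob_measures_onD[OF assms(1)]
  interpret prob_space \<nu> by (rule \<nu>(2))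
  have "2 * psi \<nu> z = (LINT \<zeta>|\<nu>. 2 * (z / (\<zeta> - z)))" unfolding psi_eq[OF \<nu>(1) assms(2)]
    by (simp only: integral_mult_right_zero)
  also have "\<dots> = (LINT \<zeta>|\<nu>. (\<zeta> + z) / (\<zeta> - z) - 1)"
  proof (rule Bochner_Integration.integral_cong[OF refl])
    fix \<zeta> assume "\<zeta> \<in> space \<nu>"
    then have "\<zeta> - z \<noteq> 0" using finite_measures_onD(3)[OF \<nu>(1)] assms(2) by auto
    then show "2 * (z / (\<zeta> - z)) = (\<zeta> + z) / (\<zeta> - z) - 1" by (simp add: field_simps)
  qed
  also have "\<dots> = (LINT \<zeta>|\<nu>. (\<zeta> + z) / (\<zeta> - z)) - 1"
    using herglotz_integrable[OF \<nu>(1) assms(2)] prob_space by simp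
  finally show ?thesis by simp
qed

definition moment :: "complex measure \<Rightarrow> nat \<Rightarrow> complex" where
  "moment \<nu> n = (LINT \<zeta>|\<nu>. cnj \<zeta> ^ n)"

text \<open>The geometric series for the kernel \<open>w / (1 - w)\<close> with \<open>w = z * cnj \<zeta>\<close>, integrated; the factor 2
  bounds \<open>1 / \<bar>1 - w\<bar>\<close> for \<open>\<bar>z\<bar> \<le> 1/2\<close>.\<close>

lemma psi_moment_expansion:
  assumes \<nu>: "\<nu> \<in> M1_circle" and z: "norm z \<le> 1 / 2"
  shows "norm (psi \<nu> z - (\<Sum>k=1..n. moment \<nu> k * z ^ k)) \<le> 2 * norm z ^ Suc n"
proof -
  note \<nu>' = prob_measures_onD[OF \<nu>]
  have z1: "norm z < 1" using z by simp
  define R where "R \<zeta> = (z * cnj \<zeta>) ^ Suc n / (1 - z * cnj \<zeta>)" for \<zeta>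
  have R_cont: "continuous_on (sphere 0 1) R"
    unfolding R_def using psi_kernel_eq(2)[OF _ z1] by (intro continuous_intros) auto
  have R_bound: "norm (R \<zeta>) \<le> 2 * norm z ^ Suc n" if "\<zeta> \<in> sphere 0 1" for \<zeta>
  proof -
    have "1 / 2 \<le> norm (1 - z * cnj \<zeta>)"
      using norm_triangle_ineq2[of 1 "z * cnj \<zeta>"] z that by (simp add: norm_mult)
    then have "norm z ^ Suc n / norm (1 - z * cnj \<zeta>) \<le> norm z ^ Suc n / (1 / 2)"
      by (intro divide_left_mono) auto
    then show ?thesis unfolding R_def norm_divide norm_power norm_mult using that by simp
  qed
  have mono_int: "integrable \<nu> (\<lambda>\<zeta>. z ^ k * cnj \<zeta> ^ k)" for k
    by (rule continuous_integrable_on[OF \<nu>'(1), where C = "norm z ^ k"])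
      (auto intro!: continuous_intros simp: norm_mult norm_power)
  have R_int: "integrable \<nu> R" by (rule continuous_integrable_on[OF \<nu>'(1) R_cont R_bound])
  have "psi \<nu> z = (LINT \<zeta>|\<nu>. R \<zeta> + (\<Sum>k=1..n. z ^ k * cnj \<zeta> ^ k))"
    unfolding psi_def
  proof (rule Bochner_Integration.integral_cong[OF refl])
    fix \<zeta> assume "\<zeta> \<in> space \<nu>"
    then have nz: "1 - z * cnj \<zeta> \<noteq> 0"
      using psi_kernel_eq(2)[OF _ z1] finite_measures_onD(3)[OF \<nu>'(1)] by auto
    define w where "w = z * cnj \<zeta>"
    have "w / (1 - w) = w ^ Suc n / (1 - w) + (\<Sum>k=1..n. w ^ k)"
    proof (induction n)
      case (Suc n)
      have "w ^ Suc n / (1 - w) = w ^ Suc (Suc n) / (1 - w) + w ^ Suc n"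
        using nz unfolding w_def by (simp add: field_simps)
      then show ?case using Suc by simp
    qed simp
    then show "z * cnj \<zeta> / (1 - z * cnj \<zeta>) = R \<zeta> + (\<Sum>k=1..n. z ^ k * cnj \<zeta> ^ k)"
      unfolding w_def R_def by (simp add: power_mult_distrib)
  qed
  also have "\<dots> = (LINT \<zeta>|\<nu>. R \<zeta>) + (LINT \<zeta>|\<nu>. (\<Sum>k=1..n. z ^ k * cnj \<zeta> ^ k))"
    by (intro Bochner_Integration.integral_add[OF R_int] Bochner_Integration.integrable_sum mono_int)
  also have "(LINT \<zeta>|\<nu>. (\<Sum>k=1..n. z ^ k * cnj \<zeta> ^ k)) = (\<Sum>k=1..n. LINT \<zeta>|\<nu>. z ^ k * cnj \<zeta> ^ k)"
    by (intro Bochner_Integration.integral_sum mono_int)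
  also have "(\<Sum>k=1..n. LINT \<zeta>|\<nu>. z ^ k * cnj \<zeta> ^ k) = (\<Sum>k=1..n. moment \<nu> k * z ^ k)"
    unfolding moment_def by (simp add: mult.commute)
  finally have "psi \<nu> z - (\<Sum>k=1..n. moment \<nu> k * z ^ k) = (LINT \<zeta>|\<nu>. R \<zeta>)" by simp
  then show ?thesis using integral_norm_le[OF \<nu>'(1) R_cont R_bound] \<nu>'(3) by simp
qed

text \<open>By induction on \<open>n\<close>: after removal of the lower moments, the moment of order \<open>n\<close> is the value of
  \<open>psi\<close> at a small point \<open>z\<close> divided by \<open>z ^ n\<close>, up to an error of order \<open>\<bar>z\<bar>\<close> that is uniform over all
  probability measures.\<close>

lemma moment_convergence:
  fixes \<nu> :: "nat \<Rightarrow> complex measure"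
  assumes \<nu>: "\<And>i. \<nu> i \<in> M1_circle" and \<nu>0: "\<nu>0 \<in> M1_circle"
    and psi: "\<And>z. norm z < 1 \<Longrightarrow> (\<lambda>i. psi (\<nu> i) z) \<longlonglongrightarrow> psi \<nu>0 z"
  shows "(\<lambda>i. moment (\<nu> i) n) \<longlonglongrightarrow> moment \<nu>0 n"
proof (induction n rule: less_induct)
  case (less n)
  show ?case
  proof (cases n)
    case 0
    have "moment m 0 = 1" if "m \<in> M1_circle" for m
      unfolding moment_def using prob_space.prob_space[OF prob_measures_onD(2)[OF that]] by simp
    then show ?thesis using 0 \<nu> \<nu>0 by simp
  next
    case (Suc n')
    show ?thesis
    proof (rule tendsto_by_approximation)
      fix e :: real assume e: "0 < e"
      define d where "d = min (1/2) (e/2)"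
      define z where "z = complex_of_real d"
      have d: "0 < d" "d \<le> 1/2" "2 * d \<le> e" using e unfolding d_def by auto
      then have z: "norm z = d" "z \<noteq> 0" unfolding z_def by auto
      define A where "A m = (psi m z - (\<Sum>k=1..n'. moment m k * z ^ k)) / z ^ n" for m
      have "(\<lambda>i. A (\<nu> i)) \<longlonglongrightarrow> A \<nu>0"
        unfolding A_def using z d Suc by (intro tendsto_intros psi less.IH) auto
      moreover have "dist (moment m n) (A m) \<le> e" if m: "m \<in> M1_circle" for m
      proof -
        have "A m - moment m n = (psi m z - (\<Sum>k=1..n. moment m k * z ^ k)) / z ^ n"
          unfolding A_def Suc using z(2) by (simp add: field_simps)
        then have "norm (A m - moment m n) = norm (psi m z - (\<Sum>k=1..n. moment m k * z ^ k)) / d ^ n"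
          using z by (simp add: norm_divide norm_power)
        also have "\<dots> \<le> (2 * d ^ Suc n) / d ^ n"
          using psi_moment_expansion[OF m, of z n, unfolded z(1), OF d(2)] d(1)
          by (intro divide_right_mono zero_le_power) auto
        also have "\<dots> = 2 * d" using d by simp
        also have "\<dots> \<le> e" by (rule d(3))
        finally show ?thesis by (simp add: dist_norm norm_minus_commute)
      qed
      ultimately show "\<exists>g m. g \<longlonglongrightarrow> m \<and> (\<forall>\<^sub>F i in sequentially. dist (moment (\<nu> i) n) (g i) \<le> e) \<and> dist (moment \<nu>0 n) m \<le> e"
        using \<nu> \<nu>0 by (intro exI[of _ "\<lambda>i. A (\<nu> i)"] exI[of _ "A \<nu>0"]) auto
    qed
  qed
qed

text \<open>On the circle \<open>cnj \<zeta> = \<zeta>\<^sup>-\<^sup>1\<close>, so these are the trigonometric polynomials. Nonnegative powers of \<open>\<zeta>\<close> and \<open>cnj \<zeta>\<close> make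
  them polynomials in \<open>Re \<zeta>\<close> and \<open>Im \<zeta>\<close>, to which the Stone-Weierstrass theorem applies.\<close>

inductive trig_polynomial :: "(complex \<Rightarrow> complex) \<Rightarrow> bool" where
  monomial: "trig_polynomial (\<lambda>\<zeta>. c * \<zeta> ^ j * cnj \<zeta> ^ k)"
| add: "trig_polynomial f \<Longrightarrow> trig_polynomial g \<Longrightarrow> trig_polynomial (\<lambda>\<zeta>. f \<zeta> + g \<zeta>)"

lemma trig_polynomial_mult:
  assumes "trig_polynomial f" "trig_polynomial g"
  shows "trig_polynomial (\<lambda>\<zeta>. f \<zeta> * g \<zeta>)"
  using assms(1)
proof induction
  case (monomial c j k)
  show ?case using assms(2)
  proof induction
    case (monomial c' j' k')
    have "(\<lambda>\<zeta>. c * \<zeta> ^ j * cnj \<zeta> ^ k * (c' * \<zeta> ^ j' * cnj \<zeta> ^ k')) = (\<lambda>\<zeta>. (c * c') * \<zeta> ^ (j + j') * cnj \<zeta> ^ (k + k'))"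
      by (simp add: power_add mult_ac)
    then show ?case using trig_polynomial.monomial by metis
  next
    case (add f g)
    then show ?case using trig_polynomial.add by (simp add: distrib_left)
  qed
next
  case (add f g)
  then show ?case using trig_polynomial.add by (simp add: distrib_right)
qed

lemma trig_polynomial_real:
  fixes g :: "complex \<Rightarrow> real"
  assumes "real_polynomial_function g"
  shows "trig_polynomial (\<lambda>\<zeta>. complex_of_real (g \<zeta>))"
  using assms
proof induction
  case (linear f)
  define a b where "a = (of_real (f 1) - \<i> * of_real (f \<i>)) / 2" and "b = (of_real (f 1) + \<i> * of_real (f \<i>)) / 2"
  have f_eq: "f \<zeta> = Re \<zeta> * f 1 + Im \<zeta> * f \<i>" for \<zeta>
  proof -
    have lin: "linear f" using linear by (rule bounded_linear.linear)
    have "f \<zeta> = f (Re \<zeta> *\<^sub>R 1 + Im \<zeta> *\<^sub>R \<i>)" by (rule arg_cong[of _ _ f]) (simp add: complex_eq_iff)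
    then show ?thesis by (simp add: linear_add[OF lin] linear_scale[OF lin])
  qed
  have "complex_of_real (f \<zeta>) = a * \<zeta> ^ 1 * cnj \<zeta> ^ 0 + b * \<zeta> ^ 0 * cnj \<zeta> ^ 1" for \<zeta>
    unfolding a_def b_def f_eq[of \<zeta>] by (intro complex_eqI) (simp_all add: field_simps)
  then show ?case using trig_polynomial.add[OF trig_polynomial.monomial[of a 1 0] trig_polynomial.monomial[of b 0 1]] by simp
next
  case (const c)
  show ?case using trig_polynomial.monomial[of "of_real c" 0 0] by simp
next
  case (add f g)
  then show ?case using trig_polynomial.add by simp
next
  case (mult f g)
  then show ?case using trig_polynomial_mult by simp
qed

lemma trig_polynomial_continuous: "trig_polynomial f \<Longrightarrow> continuous_on S f"
  by (induction rule: trig_polynomial.induct) (auto intro!: continuous_intros)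

lemma circle_integrable:
  fixes f :: "complex \<Rightarrow> 'b::{banach, second_countable_topology}"
  assumes "\<nu> \<in> finite_measures_on (sphere 0 1)" "continuous_on (sphere 0 1) f"
  shows "integrable \<nu> f"
proof -
  have "bounded (f ` sphere 0 1)" by (intro compact_imp_bounded compact_continuous_image assms compact_sphere)
  then obtain C where "\<forall>x\<in>sphere 0 1. norm (f x) \<le> C" unfolding bounded_iff by auto
  then show ?thesis using continuous_integrable_on[OF assms] by blast
qed

lemma trig_polynomial_convergence:
  fixes \<nu> :: "nat \<Rightarrow> complex measure"
  assumes \<nu>: "\<And>i. \<nu> i \<in> M1_circle" and \<nu>0: "\<nu>0 \<in> M1_circle"
    and psi: "\<And>z. norm z < 1 \<Longrightarrow> (\<lambda>i. psi (\<nu> i) z) \<longlonglongrightarrow> psi \<nu>0 z"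
    and f: "trig_polynomial f"
  shows "(\<lambda>i. LINT \<zeta>|\<nu> i. f \<zeta>) \<longlonglongrightarrow> (LINT \<zeta>|\<nu>0. f \<zeta>)"
  using f
proof induction
  case (monomial c j k)
  have "(LINT \<zeta>|m. c * \<zeta> ^ j * cnj \<zeta> ^ k) = c * (if j \<le> k then moment m (k - j) else cnj (moment m (j - k)))"
    if m: "m \<in> M1_circle" for m
  proof -
    have "(LINT \<zeta>|m. c * \<zeta> ^ j * cnj \<zeta> ^ k) = (LINT \<zeta>|m. c * (if j \<le> k then cnj \<zeta> ^ (k - j) else cnj (cnj \<zeta> ^ (j - k))))"
    proof (rule Bochner_Integration.integral_cong[OF refl])
      fix \<zeta> assume "\<zeta> \<in> space m"
      then have "norm \<zeta> = 1" using finite_measures_onD(3)[OF prob_measures_onD(1)[OF m]] by simp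
      then have c: "\<zeta> * cnj \<zeta> = 1" using complex_norm_square[of \<zeta>] by simp
      have pow: "(\<zeta> * cnj \<zeta>) ^ l = 1" for l unfolding c by simp
      show "c * \<zeta> ^ j * cnj \<zeta> ^ k = c * (if j \<le> k then cnj \<zeta> ^ (k - j) else cnj (cnj \<zeta> ^ (j - k)))"
      proof (cases "j \<le> k")
        case True
        then have "cnj \<zeta> ^ k = cnj \<zeta> ^ j * cnj \<zeta> ^ (k - j)"
            using power_add[of "cnj \<zeta>" j "k - j"] by simp
        then show ?thesis using True pow[of j] by (simp add: power_mult_distrib)
      next
        case False
        then have "\<zeta> ^ j = \<zeta> ^ (j - k) * \<zeta> ^ k"
            using power_add[of \<zeta> "j - k" k] by simp
        then show ?thesis using False pow[of k] by (simp add: power_mult_distrib)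
      qed
    qed
    then show ?thesis unfolding moment_def by (simp del: complex_cnj_power)
  qed
  then show ?case
    using \<nu> \<nu>0 moment_convergence[OF \<nu> \<nu>0 psi] by (auto intro!: tendsto_intros)
next
  case (add f g)
  have "(LINT \<zeta>|m. f \<zeta> + g \<zeta>) = (LINT \<zeta>|m. f \<zeta>) + (LINT \<zeta>|m. g \<zeta>)" if "m \<in> M1_circle" for m
    by (intro Bochner_Integration.integral_add circle_integrable prob_measures_onD(1)[OF that] trig_polynomial_continuous add.hyps)
  then show ?case using add.IH \<nu> \<nu>0 by (auto intro!: tendsto_intros)
qed

text \<open>Pointwise convergence of \<open>psi\<close> gives convergence of all moments, hence of the integrals of
  trigonometric polynomials, and these are uniformly dense in the continuous functions.\<close>

theorem circle_weak_convergence: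
  fixes \<nu> :: "nat \<Rightarrow> complex measure" and \<phi> :: "complex \<Rightarrow> real"
  assumes \<nu>: "\<And>i. \<nu> i \<in> M1_circle" and \<nu>0: "\<nu>0 \<in> M1_circle"
    and psi: "\<And>z. norm z < 1 \<Longrightarrow> (\<lambda>i. psi (\<nu> i) z) \<longlonglongrightarrow> psi \<nu>0 z"
    and \<phi>: "continuous_on (sphere 0 1) \<phi>"
  shows "(\<lambda>i. LINT \<zeta>|\<nu> i. \<phi> \<zeta>) \<longlonglongrightarrow> (LINT \<zeta>|\<nu>0. \<phi> \<zeta>)"
proof (rule tendsto_by_approximation)
  fix e :: real assume e: "0 < e"
  obtain g where g: "real_polynomial_function g" "\<And>\<zeta>. \<zeta> \<in> sphere 0 1 \<Longrightarrow> \<bar>\<phi> \<zeta> - g \<zeta>\<bar> < e"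
    using Stone_Weierstrass_real_polynomial_function[OF compact_sphere \<phi> e] by metis
  note trig = trig_polynomial_real[OF g(1)]
  have g_cont: "continuous_on (sphere 0 1) g"
    using continuous_on_Re[OF trig_polynomial_continuous[OF trig, of "sphere 0 1"]] by simp
  have "(\<lambda>i. complex_of_real (LINT \<zeta>|\<nu> i. g \<zeta>)) \<longlonglongrightarrow> complex_of_real (LINT \<zeta>|\<nu>0. g \<zeta>)"
    using trig_polynomial_convergence[OF \<nu> \<nu>0 psi trig] by simp
  then have "(\<lambda>i. LINT \<zeta>|\<nu> i. g \<zeta>) \<longlonglongrightarrow> (LINT \<zeta>|\<nu>0. g \<zeta>)" unfolding tendsto_of_real_iff .
  moreover have "dist (LINT \<zeta>|m. \<phi> \<zeta>) (LINT \<zeta>|m. g \<zeta>) \<le> e" if m: "m \<in> M1_circle" for m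
  proof -
    have "(LINT \<zeta>|m. \<phi> \<zeta>) - (LINT \<zeta>|m. g \<zeta>) = (LINT \<zeta>|m. \<phi> \<zeta> - g \<zeta>)"
      using circle_integrable[OF prob_measures_onD(1)[OF m] \<phi>] circle_integrable[OF prob_measures_onD(1)[OF m] g_cont] by simp
    moreover have "norm (LINT \<zeta>|m. \<phi> \<zeta> - g \<zeta>) \<le> e * measure m (sphere 0 1)"
      using g(2) by (intro integral_norm_le[OF prob_measures_onD(1)[OF m]] continuous_intros \<phi> g_cont) (auto intro: less_imp_le)
    ultimately show ?thesis using prob_measures_onD(3)[OF m] by (simp add: dist_norm)
  qed
  ultimately show "\<exists>g m. g \<longlonglongrightarrow> m \<and> (\<forall>\<^sub>F i in sequentially. dist (LINT \<zeta>|\<nu> i. \<phi> \<zeta>) (g i) \<le> e)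
      \<and> dist (LINT \<zeta>|\<nu>0. \<phi> \<zeta>) m \<le> e"
    using \<nu> \<nu>0 by (intro exI[of _ "\<lambda>i. LINT \<zeta>|\<nu> i. g \<zeta>"] exI[of _ "LINT \<zeta>|\<nu>0. g \<zeta>"]) auto
qed

text \<open>Weak convergence of the constant sequence \<open>\<mu>\<close> to \<open>\<nu>\<close>.\<close>

lemma psi_injective:
  assumes "\<mu> \<in> M1_circle" "\<nu> \<in> M1_circle" "\<And>z. norm z < 1 \<Longrightarrow> psi \<mu> z = psi \<nu> z"
  shows "\<mu> = \<nu>"
proof (rule measure_eqI_continuous[OF prob_measures_onD(1)[OF assms(1)] prob_measures_onD(1)[OF assms(2)]])
  fix \<phi> :: "complex \<Rightarrow> real" assume "continuous_on (sphere 0 1) \<phi>"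
  from circle_weak_convergence[of "\<lambda>_. \<mu>", OF assms(1,2) _ this]
  have "(\<lambda>i::nat. LINT \<zeta>|\<mu>. \<phi> \<zeta>) \<longlonglongrightarrow> (LINT \<zeta>|\<nu>. \<phi> \<zeta>)" using assms(3) by simp
  then show "(LINT \<zeta>|\<mu>. \<phi> \<zeta>) = (LINT \<zeta>|\<nu>. \<phi> \<zeta>)" by (simp add: LIMSEQ_const_iff)
qed

section \<open>The Cayley transform and measures on the line\<close>

definition cayley :: "real \<Rightarrow> complex" where
  "cayley x = (of_real x - \<i>) / (of_real x + \<i>)"

definition cayley_inv :: "complex \<Rightarrow> real" where
  "cayley_inv \<zeta> = Re (\<i> * (1 + \<zeta>) / (1 - \<zeta>))"

lemma of_real_plus_i_nonzero: "complex_of_real x + \<i> \<noteq> 0"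
  by (simp add: complex_eq_iff)

lemma norm_cayley: "norm (cayley x) = 1"
proof -
  have "norm (of_real x - \<i>) = norm (of_real x + \<i>)" by (simp add: cmod_def)
  then show ?thesis unfolding cayley_def using of_real_plus_i_nonzero[of x] by (simp add: norm_divide)
qed

lemma one_minus_cayley: "1 - cayley x = 2 * \<i> / (of_real x + \<i>)"
  unfolding cayley_def using of_real_plus_i_nonzero[of x] by (simp add: field_simps)

lemma cayley_neq_1: "cayley x \<noteq> 1"
  using one_minus_cayley[of x] of_real_plus_i_nonzero[of x] by auto

lemma cayley_inv_cayley: "cayley_inv (cayley x) = x"
proof -
  have num: "1 + cayley x = 2 * of_real x / (of_real x + \<i>)"
    unfolding cayley_def using of_real_plus_i_nonzero[of x] by (simp add: field_simps)
  show ?thesis unfolding cayley_inv_def num one_minus_cayley using of_real_plus_i_nonzero[of x] by simp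
qed

lemma cayley_cayley_inv:
  assumes "norm \<zeta> = 1" "\<zeta> \<noteq> 1"
  shows "cayley (cayley_inv \<zeta>) = \<zeta>"
proof -
  have nz: "1 - \<zeta> \<noteq> 0" using assms by simp
  have "Im (\<i> * (1 + \<zeta>) / (1 - \<zeta>)) = Re ((1 + \<zeta>) / (1 - \<zeta>))" by (simp flip: times_divide_eq_right)
  also have "\<dots> = 0"
    using Re_herglotz[of 1 \<zeta>] assms by simp
  finally have x: "of_real (cayley_inv \<zeta>) = \<i> * (1 + \<zeta>) / (1 - \<zeta>)"
    unfolding cayley_inv_def by (simp add: complex_eq_iff)
  have "\<i> * (1 + \<zeta>) / (1 - \<zeta>) - \<i> = 2 * \<i> * \<zeta> / (1 - \<zeta>)" "\<i> * (1 + \<zeta>) / (1 - \<zeta>) + \<i> = 2 * \<i> / (1 - \<zeta>)"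
    using nz by (simp_all add: field_simps)
  then show ?thesis unfolding cayley_def x using nz by simp
qed

text \<open>The density relating Herglotz and Cauchy kernels: \<open>1 + x\<^sup>2\<close> on the line corresponds to
  \<open>4 / \<bar>1 - \<zeta>\<bar>\<^sup>2\<close> on the circle, which blows up at the point 1 that corresponds to infinity.\<close>

lemma one_plus_cayley_inv_sq:
  assumes "norm \<zeta> = 1" "\<zeta> \<noteq> 1"
  shows "1 + (cayley_inv \<zeta>)\<^sup>2 = 4 / (norm (1 - \<zeta>))\<^sup>2"
proof -
  define x where "x = cayley_inv \<zeta>"
  have "1 - \<zeta> = 2 * \<i> / (of_real x + \<i>)" using one_minus_cayley[of x] cayley_cayley_inv[OF assms] unfolding x_def by simp
  then have "norm (1 - \<zeta>) = 2 / norm (of_real x + \<i>)" by (simp add: norm_divide norm_mult)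
  moreover have "(norm (of_real x + \<i>))\<^sup>2 = 1 + x\<^sup>2" by (simp add: cmod_power2)
  ultimately show ?thesis unfolding x_def[symmetric] by (simp add: power_divide)
qed

lemma cayley_continuous: "continuous_on S cayley"
  unfolding cayley_def using of_real_plus_i_nonzero by (intro continuous_intros) auto

lemma cayley_inv_continuous: "continuous_on (- {1}) cayley_inv"
  unfolding cayley_inv_def by (intro continuous_intros) auto

lemma half_plane_point:
  assumes "norm w < 1"
  shows "0 < Im (\<i> * (1 + w) / (1 - w))" "(\<i> * (1 + w) / (1 - w) - \<i>) / (\<i> * (1 + w) / (1 - w) + \<i>) = w"
proof -
  have nz: "1 - w \<noteq> 0" using assms by auto
  have "Im (\<i> * (1 + w) / (1 - w)) = Re ((1 + w) / (1 - w))" by (simp flip: times_divide_eq_right)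
  also have "\<dots> = (1 - (norm w)\<^sup>2) / (norm (1 - w))\<^sup>2" using Re_herglotz[of 1 w] by simp
  also have "\<dots> > 0" using assms nz by (simp add: abs_square_less_1)
  finally show "0 < Im (\<i> * (1 + w) / (1 - w))" .
  have "\<i> * (1 + w) / (1 - w) - \<i> = 2 * \<i> * w / (1 - w)" "\<i> * (1 + w) / (1 - w) + \<i> = 2 * \<i> / (1 - w)"
    using nz by (simp_all add: field_simps)
  then show "(\<i> * (1 + w) / (1 - w) - \<i>) / (\<i> * (1 + w) / (1 - w) + \<i>) = w" using nz by simp
qed

lemma disc_point:
  assumes "0 < Im z"
  shows "norm ((z - \<i>) / (z + \<i>)) < 1" "z + \<i> \<noteq> 0"
proof -
  show nz: "z + \<i> \<noteq> 0" using assms by (auto simp: complex_eq_iff)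
  have "(norm (z - \<i>))\<^sup>2 < (norm (z + \<i>))\<^sup>2" using assms unfolding cmod_power2 by (simp add: power2_eq_square algebra_simps)
  then have "norm (z - \<i>) < norm (z + \<i>)" by (rule power_less_imp_less_base) simp
  then show "norm ((z - \<i>) / (z + \<i>)) < 1" using nz by (simp add: norm_divide)
qed

lemma half_plane_disc_point:
  assumes "0 < Im z"
  shows "\<i> * (1 + (z - \<i>) / (z + \<i>)) / (1 - (z - \<i>) / (z + \<i>)) = z"
proof -
  have nz: "z + \<i> \<noteq> 0" by (rule disc_point(2)[OF assms])
  have "1 + (z - \<i>) / (z + \<i>) = 2 * z / (z + \<i>)" "1 - (z - \<i>) / (z + \<i>) = 2 * \<i> / (z + \<i>)"
    using nz by (simp_all add: field_simps)
  then show ?thesis using nz by simp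
qed

text \<open>The Herglotz kernel at corresponding points is an affine function of the resolvent, with coefficients
  that depend on \<open>z\<close> only. So \<open>psi\<close> of the measure moved to the circle and the Cauchy transform
  determine each other.\<close>

lemma cayley_kernel:
  assumes "0 < Im z"
  shows "(cayley x + (z - \<i>) / (z + \<i>)) / (cayley x - (z - \<i>) / (z + \<i>)) = \<i> * ((1 + z\<^sup>2) / (z - of_real x) - z)"
proof -
  define a where "a = complex_of_real x + \<i>"
  define b where "b = z + \<i>"
  have nz: "a \<noteq> 0" "b \<noteq> 0"
    unfolding a_def b_def by (rule of_real_plus_i_nonzero, rule disc_point(2)[OF assms])
  have nz': "z - of_real x \<noteq> 0" using assms by (auto simp: complex_eq_iff)
  have "cayley x + (z - \<i>) / (z + \<i>) = (2 * (1 + of_real x * z)) / (a * b)"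
    unfolding cayley_def a_def[symmetric] b_def[symmetric] using nz
    by (simp add: divide_simps) (simp add: a_def b_def algebra_simps)
  moreover have "cayley x - (z - \<i>) / (z + \<i>) = (2 * \<i> * (of_real x - z)) / (a * b)"
    unfolding cayley_def a_def[symmetric] b_def[symmetric] using nz
    by (simp add: divide_simps) (simp add: a_def b_def algebra_simps)
  ultimately have "(cayley x + (z - \<i>) / (z + \<i>)) / (cayley x - (z - \<i>) / (z + \<i>))
      = (2 * (1 + of_real x * z)) / (2 * \<i> * (of_real x - z))" using nz by simp
  also have "\<dots> = \<i> * ((1 + z\<^sup>2) / (z - of_real x) - z)"
  proof -
    have "of_real x - z \<noteq> 0" using nz' by auto
    then show ?thesis using nz' by (simp add: divide_simps) (simp add: algebra_simps power2_eq_square)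
  qed
  finally show ?thesis .
qed

definition on_circle :: "real measure \<Rightarrow> complex measure" where
  "on_circle \<nu> = distr \<nu> (restrict_space borel (sphere 0 1)) cayley"

lemma cayley_measurable:
  assumes "\<nu> \<in> prob_measures_on UNIV"
  shows "cayley \<in> measurable \<nu> (restrict_space borel (sphere 0 1))"
proof (rule measurable_restrict_space2)
  show "cayley \<in> borel_measurable \<nu>"
    by (rule continuous_measurable_on[OF prob_measures_onD(1)[OF assms] cayley_continuous])
  show "cayley \<in> space \<nu> \<rightarrow> sphere 0 1" by (simp add: norm_cayley)
qed

lemma on_circle_M1: "\<nu> \<in> prob_measures_on UNIV \<Longrightarrow> on_circle \<nu> \<in> M1_circle"
  unfolding on_circle_def prob_measures_on_def[of "sphere 0 1"] finite_measures_on_def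
  using prob_space.prob_space_distr[OF prob_measures_onD(2) cayley_measurable] prob_space.finite_measure by auto

lemma on_circle_integral:
  fixes f :: "complex \<Rightarrow> 'b::{banach, second_countable_topology}"
  assumes "\<nu> \<in> prob_measures_on UNIV" "continuous_on (sphere 0 1) f"
  shows "(LINT \<zeta>|on_circle \<nu>. f \<zeta>) = (LINT x|\<nu>. f (cayley x))"
  unfolding on_circle_def
  by (rule integral_distr[OF cayley_measurable[OF assms(1)] borel_measurable_continuous_on_restrict[OF assms(2)]])

lemma psi_on_circle:
  assumes \<nu>: "\<nu> \<in> prob_measures_on UNIV" and z: "0 < Im z"
  shows "1 + 2 * psi (on_circle \<nu>) ((z - \<i>) / (z + \<i>)) = \<i> * ((1 + z\<^sup>2) * cauchy_transform \<nu> z - z)"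
proof -
  interpret prob_space \<nu> by (rule prob_measures_onD(2)[OF \<nu>])
  define w where "w = (z - \<i>) / (z + \<i>)"
  have w: "norm w < 1" unfolding w_def by (rule disc_point(1)[OF z])
  have "1 + 2 * psi (on_circle \<nu>) w = (LINT \<zeta>|on_circle \<nu>. (\<zeta> + w) / (\<zeta> - w))"
    by (rule psi_herglotz[OF on_circle_M1[OF \<nu>] w, symmetric])
  also have "\<dots> = (LINT x|\<nu>. (cayley x + w) / (cayley x - w))"
    by (rule on_circle_integral[OF \<nu> herglotz_continuous[OF w]])
  also have "\<dots> = (LINT x|\<nu>. \<i> * ((1 + z\<^sup>2) * (1 / (z - of_real x)) - z))"
    unfolding w_def cayley_kernel[OF z] by simp
  also have "\<dots> = \<i> * ((1 + z\<^sup>2) * cauchy_transform \<nu> z - z)"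
    unfolding cauchy_transform_def
    using resolvent_integrable[OF prob_measures_onD(1)[OF \<nu>] z] prob_space
    by (simp only: integral_mult_right_zero Bochner_Integration.integral_diff integrable_mult_right
        integrable_const lebesgue_integral_const) simp
  finally show ?thesis unfolding w_def .
qed

text \<open>This cutoff function has its integral encoded in the Cauchy transform, so that tightness can be read off from
  pointwise convergence of Cauchy transforms.\<close>

lemma cutoff_integral:
  assumes \<nu>: "\<nu> \<in> prob_measures_on UNIV" and R: "0 < R"
  shows "(LINT x|\<nu>. R\<^sup>2 / (R\<^sup>2 + x\<^sup>2)) = - R * Im (cauchy_transform \<nu> (\<i> * of_real R))"
proof -
  have z: "0 < Im (\<i> * of_real R)" using R by simp
  have "- R * Im (cauchy_transform \<nu> (\<i> * of_real R)) = - R * (LINT x|\<nu>. Im (1 / (\<i> * of_real R - of_real x)))"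
    unfolding cauchy_transform_def using resolvent_integrable[OF prob_measures_onD(1)[OF \<nu>] z] by simp
  also have "\<dots> = (LINT x|\<nu>. - R * Im (1 / (\<i> * of_real R - of_real x)))" by (simp only: integral_mult_right_zero)
  also have "\<dots> = (LINT x|\<nu>. R\<^sup>2 / (R\<^sup>2 + x\<^sup>2))"
    unfolding Im_resolvent cmod_power2 by (simp add: power2_eq_square add.commute)
  finally show ?thesis ..
qed

text \<open>A bounded function on the line becomes discontinuous at the point 1 of the circle in general. The cutoff is
  of order \<open>\<bar>1 - \<zeta>\<bar>\<^sup>2\<close> there and removes the discontinuity.\<close>

lemma cutoff_circle_continuous:
  fixes \<phi> :: "real \<Rightarrow> real"
  assumes \<phi>: "continuous_on UNIV \<phi>" "\<And>x. \<bar>\<phi> x\<bar> \<le> C" and R: "1 \<le> R"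
  shows "continuous_on (sphere 0 1)
    (\<lambda>\<zeta>. if \<zeta> = 1 then 0 else \<phi> (cayley_inv \<zeta>) * (R\<^sup>2 / (R\<^sup>2 + (cayley_inv \<zeta>)\<^sup>2)))"
    (is "continuous_on _ ?g")
  unfolding continuous_on_eq_continuous_within
proof
  fix \<zeta>0 :: complex assume \<zeta>0: "\<zeta>0 \<in> sphere 0 1"
  have den: "R\<^sup>2 + y\<^sup>2 \<noteq> 0" for y using R by (simp add: sum_power2_eq_zero_iff)
  show "continuous (at \<zeta>0 within sphere 0 1) ?g"
  proof (cases "\<zeta>0 = 1")
    case False
    have "continuous_on (- {1}) (\<lambda>\<zeta>. \<phi> (cayley_inv \<zeta>) * (R\<^sup>2 / (R\<^sup>2 + (cayley_inv \<zeta>)\<^sup>2)))"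
      using den by (intro continuous_intros continuous_on_compose2[OF \<phi>(1) cayley_inv_continuous] cayley_inv_continuous) auto
    then have "continuous_on (- {1}) ?g" by (rule continuous_on_eq) auto
    then have "isCont ?g \<zeta>0" using False by (simp add: continuous_on_eq_continuous_at open_delete open_Compl)
    then show ?thesis by (rule continuous_at_imp_continuous_at_within)
  next
    case True
    have "0 \<le> C" using \<phi>(2)[of 0] by linarith
    have g_le: "norm (?g \<zeta>) \<le> C * R\<^sup>2 / 4 * (norm (1 - \<zeta>))\<^sup>2" if "\<zeta> \<in> sphere 0 1" for \<zeta>
    proof (cases "\<zeta> = 1")
      case False
      define x where "x = cayley_inv \<zeta>"
      have x: "1 + x\<^sup>2 = 4 / (norm (1 - \<zeta>))\<^sup>2"
        unfolding x_def using one_plus_cayley_inv_sq[of \<zeta>] that False by simp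
      have "1 + x\<^sup>2 \<le> R\<^sup>2 + x\<^sup>2" using R by simp
      moreover have "0 < 1 + x\<^sup>2" by (simp add: add_pos_nonneg)
      ultimately have "R\<^sup>2 / (R\<^sup>2 + x\<^sup>2) \<le> R\<^sup>2 / (1 + x\<^sup>2)"
        by (intro divide_left_mono mult_pos_pos) auto
      also have "\<dots> = R\<^sup>2 / 4 * (norm (1 - \<zeta>))\<^sup>2" unfolding x by simp
      finally have "\<bar>\<phi> x\<bar> * (R\<^sup>2 / (R\<^sup>2 + x\<^sup>2)) \<le> C * (R\<^sup>2 / 4 * (norm (1 - \<zeta>))\<^sup>2)"
        using \<phi>(2)[of x] \<open>0 \<le> C\<close> by (intro mult_mono) auto
      then show ?thesis using False unfolding x_def by (simp add: abs_mult)
    qed (use \<open>0 \<le> C\<close> in simp)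
    have "\<forall>\<^sub>F \<zeta> in at 1 within sphere 0 1. \<zeta> \<in> sphere (0::complex) 1" by (simp add: eventually_at_filter)
    then have "\<forall>\<^sub>F \<zeta> in at 1 within sphere 0 1. norm (?g \<zeta>) \<le> C * R\<^sup>2 / 4 * (norm (1 - \<zeta>))\<^sup>2"
      by (rule eventually_mono) (rule g_le)
    moreover
    have lim: "((\<lambda>\<zeta>::complex. C * R\<^sup>2 / 4 * (norm (1 - \<zeta>))\<^sup>2) \<longlongrightarrow> C * R\<^sup>2 / 4 * (norm (1 - 1::complex))\<^sup>2) (at 1 within sphere 0 1)"
      by (intro tendsto_intros)
    have "((\<lambda>\<zeta>::complex. C * R\<^sup>2 / 4 * (norm (1 - \<zeta>))\<^sup>2) \<longlongrightarrow> 0) (at 1 within sphere 0 1)"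
      using lim by simp
    ultimately have "(?g \<longlongrightarrow> 0) (at 1 within sphere 0 1)" by (rule Lim_null_comparison)
    then show ?thesis unfolding True continuous_within by simp
  qed
qed

text \<open>Moving the measures to the circle gives convergence for test functions that are multiplied by the
  cutoff \<open>\<kappa> R\<close>. The error is at most \<open>C (1 - \<integral> \<kappa> R)\<close>: it is small for the limit
  measure when \<open>R\<close> is large, and then for almost all measures of the sequence, because \<open>\<integral> \<kappa> R\<close> is
  a value of the Cauchy transform.\<close>

theorem line_weak_convergence:
  fixes \<nu> :: "nat \<Rightarrow> real measure" and \<phi> :: "real \<Rightarrow> real"
  assumes \<nu>: "\<And>i. \<nu> i \<in> prob_measures_on UNIV" and \<nu>0: "\<nu>0 \<in> prob_measures_on UNIV"
    and lim: "\<And>z. 0 < Im z \<Longrightarrow> (\<lambda>i. cauchy_transform (\<nu> i) z) \<longlonglongrightarrow> cauchy_transform \<nu>0 z"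
    and \<phi>: "continuous_on UNIV \<phi>" "\<And>x. \<bar>\<phi> x\<bar> \<le> C"
  shows "(\<lambda>i. LINT x|\<nu> i. \<phi> x) \<longlonglongrightarrow> (LINT x|\<nu>0. \<phi> x)"
proof (rule tendsto_by_approximation)
  have C: "0 \<le> C" using \<phi>(2)[of 0] by linarith
  have psi_lim: "(\<lambda>i. psi (on_circle (\<nu> i)) w) \<longlonglongrightarrow> psi (on_circle \<nu>0) w" if w: "norm w < 1" for w
  proof -
    define z where "z = \<i> * (1 + w) / (1 - w)"
    have z: "0 < Im z" "(z - \<i>) / (z + \<i>) = w" unfolding z_def using half_plane_point[OF w] by auto
    have psi_eq: "psi (on_circle m) w = (\<i> * ((1 + z\<^sup>2) * cauchy_transform m z - z) - 1) / 2"
      if "m \<in> prob_measures_on UNIV" for m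
      using psi_on_circle[OF that z(1)] unfolding z(2) by (simp add: field_simps)
    show ?thesis unfolding psi_eq[OF \<nu>] psi_eq[OF \<nu>0] by (intro tendsto_intros lim z) auto
  qed
  fix e :: real assume e: "0 < e"
  define \<kappa> where "\<kappa> R x = R\<^sup>2 / (R\<^sup>2 + x\<^sup>2)" for R x :: real
  have \<kappa>: "0 \<le> \<kappa> R x" "\<kappa> R x \<le> 1" for R x
  proof -
    show "0 \<le> \<kappa> R x" unfolding \<kappa>_def by simp
    have "0 \<le> R\<^sup>2 + x\<^sup>2" "R\<^sup>2 \<le> R\<^sup>2 + x\<^sup>2" by auto
    then show "\<kappa> R x \<le> 1" unfolding \<kappa>_def by (cases "R\<^sup>2 + x\<^sup>2 = 0") (simp_all only: divide_le_eq_1 div_by_0 order_less_le zero_le_one simp_thms, auto)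
  qed
  have \<kappa>_cont: "continuous_on UNIV (\<kappa> R)" if "1 \<le> R" for R
    unfolding \<kappa>_def using that by (intro continuous_intros) (auto simp: sum_power2_eq_zero_iff)
  have close: "dist (LINT x|m. \<phi> x) (LINT x|m. \<phi> x * \<kappa> R x) \<le> C * (1 - (LINT x|m. \<kappa> R x))"
    if m: "m \<in> prob_measures_on UNIV" and R: "1 \<le> R" for m :: "real measure" and R
  proof -
    interpret prob_space m by (rule prob_measures_onD(2)[OF m])
    have int: "integrable m f" if "continuous_on UNIV f" "\<And>x. norm (f x) \<le> K" for f :: "real \<Rightarrow> real" and K
      using continuous_integrable_on[OF prob_measures_onD(1)[OF m] that] .
    have i1: "integrable m \<phi>" using int[OF \<phi>(1), of C] \<phi>(2) by simp
    have i2: "integrable m (\<kappa> R)" using int[OF \<kappa>_cont[OF R], of 1] \<kappa> by simp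
    have i3: "integrable m (\<lambda>x. \<phi> x * \<kappa> R x)"
    proof (rule int[of _ C])
      show "continuous_on UNIV (\<lambda>x. \<phi> x * \<kappa> R x)" by (intro continuous_intros \<phi>(1) \<kappa>_cont[OF R])
      show "norm (\<phi> x * \<kappa> R x) \<le> C" for x
        using mult_mono[OF \<phi>(2)[of x] \<kappa>(2)[of R x] C \<kappa>(1)] \<kappa>(1)[of R x] by (simp add: abs_mult)
    qed
    have "norm (LINT x|m. \<phi> x - \<phi> x * \<kappa> R x) \<le> (LINT x|m. C * (1 - \<kappa> R x))"
    proof (rule Bochner_Integration.integral_norm_bound_integral)
      show "norm (\<phi> x - \<phi> x * \<kappa> R x) \<le> C * (1 - \<kappa> R x)" for x
      proof -
        have "\<phi> x - \<phi> x * \<kappa> R x = \<phi> x * (1 - \<kappa> R x)" by (simp add: algebra_simps)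
        then have "norm (\<phi> x - \<phi> x * \<kappa> R x) = \<bar>\<phi> x\<bar> * (1 - \<kappa> R x)"
          using \<kappa>(2)[of R x] by (simp add: abs_mult)
        then show ?thesis using \<phi>(2)[of x] \<kappa>(2)[of R x] by (simp add: mult_right_mono)
      qed
    qed (use i1 i2 i3 in auto)
    then show ?thesis using i1 i2 i3 prob_space by (simp add: dist_norm)
  qed
  have "(\<lambda>n. LINT x|\<nu>0. \<kappa> (real n + 1) x) \<longlonglongrightarrow> (LINT x|\<nu>0. 1)"
  proof (rule integral_dominated_convergence[where w = "\<lambda>_. 1"])
    interpret prob_space \<nu>0 by (rule prob_measures_onD(2)[OF \<nu>0])
    show "\<kappa> (real n + 1) \<in> borel_measurable \<nu>0" for n
      using continuous_measurable_on[OF prob_measures_onD(1)[OF \<nu>0] \<kappa>_cont] by simp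
    have "(\<lambda>n. \<kappa> (real n + 1) x) \<longlonglongrightarrow> 1" for x unfolding \<kappa>_def by real_asymp
    then show "AE x in \<nu>0. (\<lambda>n. \<kappa> (real n + 1) x) \<longlonglongrightarrow> 1" by simp
    show "integrable \<nu>0 (\<lambda>_. 1 :: real)" by simp
  qed (use \<kappa> in auto)
  moreover have "(LINT x|\<nu>0. 1) = (1::real)"
    using prob_space.prob_space[OF prob_measures_onD(2)[OF \<nu>0]] by simp
  ultimately have "(\<lambda>n. C * (1 - (LINT x|\<nu>0. \<kappa> (real n + 1) x))) \<longlonglongrightarrow> C * (1 - 1)"
    by (intro tendsto_intros) simp
  then have "\<forall>\<^sub>F n in sequentially. C * (1 - (LINT x|\<nu>0. \<kappa> (real n + 1) x)) < e"
    using e by (intro order_tendstoD(2)) auto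
  then have "\<exists>n. C * (1 - (LINT x|\<nu>0. \<kappa> (real n + 1) x)) < e"
    by (rule eventually_happens'[OF sequentially_bot])
  then obtain n :: nat where n: "C * (1 - (LINT x|\<nu>0. \<kappa> (real n + 1) x)) < e" by blast
  define R where "R = real n + 1"
  have R: "1 \<le> R" "0 < R" unfolding R_def by auto
  have e0: "C * (1 - (LINT x|\<nu>0. \<kappa> R x)) < e" using n unfolding R_def .
  have \<kappa>_int: "(LINT x|m. \<kappa> R x) = - R * Im (cauchy_transform m (\<i> * of_real R))"
    if "m \<in> prob_measures_on UNIV" for m
    unfolding \<kappa>_def by (rule cutoff_integral[OF that R(2)])
  have "(\<lambda>i. C * (1 - (LINT x|\<nu> i. \<kappa> R x))) \<longlonglongrightarrow> C * (1 - (LINT x|\<nu>0. \<kappa> R x))"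
    unfolding \<kappa>_int[OF \<nu>] \<kappa>_int[OF \<nu>0] using R by (intro tendsto_intros lim) simp
  then have ev: "\<forall>\<^sub>F i in sequentially. C * (1 - (LINT x|\<nu> i. \<kappa> R x)) < e"
    using e0 by (rule order_tendstoD(2))
  define g where "g \<zeta> = (if \<zeta> = 1 then 0 else \<phi> (cayley_inv \<zeta>) * (R\<^sup>2 / (R\<^sup>2 + (cayley_inv \<zeta>)\<^sup>2)))" for \<zeta>
  have g_cont: "continuous_on (sphere 0 1) g" unfolding g_def by (rule cutoff_circle_continuous[OF \<phi> R(1)])
  have g_int: "(LINT \<zeta>|on_circle m. g \<zeta>) = (LINT x|m. \<phi> x * \<kappa> R x)" if "m \<in> prob_measures_on UNIV" for m
    unfolding on_circle_integral[OF that g_cont] by (simp add: g_def \<kappa>_def cayley_neq_1 cayley_inv_cayley)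
  have "(\<lambda>i. LINT x|\<nu> i. \<phi> x * \<kappa> R x) \<longlonglongrightarrow> (LINT x|\<nu>0. \<phi> x * \<kappa> R x)"
    using circle_weak_convergence[OF on_circle_M1[OF \<nu>] on_circle_M1[OF \<nu>0] psi_lim g_cont]
    unfolding g_int[OF \<nu>] g_int[OF \<nu>0] .
  moreover have "\<forall>\<^sub>F i in sequentially. dist (LINT x|\<nu> i. \<phi> x) (LINT x|\<nu> i. \<phi> x * \<kappa> R x) \<le> e"
    using ev by eventually_elim (use close[OF \<nu> R(1)] in \<open>meson less_imp_le order_trans\<close>)
  moreover have "dist (LINT x|\<nu>0. \<phi> x) (LINT x|\<nu>0. \<phi> x * \<kappa> R x) \<le> e"
    using close[OF \<nu>0 R(1)] e0 by linarith
  ultimately show "\<exists>g m. g \<longlonglongrightarrow> m \<and> (\<forall>\<^sub>F i in sequentially. dist (LINT x|\<nu> i. \<phi> x) (g i) \<le> e)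
      \<and> dist (LINT x|\<nu>0. \<phi> x) m \<le> e"
    by blast
qed

lemma cauchy_transform_injective:
  assumes "\<mu> \<in> prob_measures_on UNIV" "\<nu> \<in> prob_measures_on UNIV"
    "\<And>z. 0 < Im z \<Longrightarrow> cauchy_transform \<mu> z = cauchy_transform \<nu> z"
  shows "\<mu> = \<nu>"
proof (rule measure_eqI_continuous[OF prob_measures_onD(1)[OF assms(1)] prob_measures_onD(1)[OF assms(2)]])
  fix \<phi> :: "real \<Rightarrow> real" assume \<phi>: "continuous_on UNIV \<phi>" "bounded (range \<phi>)"
  then obtain C where "\<And>x. \<bar>\<phi> x\<bar> \<le> C" unfolding bounded_iff by auto
  from line_weak_convergence[of "\<lambda>_. \<mu>", OF assms(1,2) _ \<phi>(1) this]
  have "(\<lambda>i::nat. LINT x|\<mu>. \<phi> x) \<longlonglongrightarrow> (LINT x|\<nu>. \<phi> x)" using assms(3) by simp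
  then show "(LINT x|\<mu>. \<phi> x) = (LINT x|\<nu>. \<phi> x)" by (simp add: LIMSEQ_const_iff)
qed

section \<open>Recognising Cauchy transforms\<close>

lemma borel_measurable_restricted:
  assumes "\<sigma> \<in> finite_measures_on X" "f \<in> measurable borel N"
  shows "f \<in> measurable \<sigma> N"
  using measurable_restrict_space1[OF assms(2), of X] measurable_cong_sets[OF finite_measures_onD(2)[OF assms(1)] refl]
  by blast

text \<open>The points \<open>(\<i> n - \<i>) / (\<i> n + \<i>)\<close> are the images of \<open>\<i> n\<close> in the disc. They are real and tend to 1, and the
  limit is the density \<open>1 + x\<^sup>2\<close> in circle coordinates, infinite at the point that corresponds to infinity.\<close>

lemma poisson_limit:
  assumes \<zeta>: "norm \<zeta> = 1"
  shows "(\<lambda>n. ennreal (real n * Re ((\<zeta> + (\<i> * of_nat n - \<i>) / (\<i> * of_nat n + \<i>)) / (\<zeta> - (\<i> * of_nat n - \<i>) / (\<i> * of_nat n + \<i>)))))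
    \<longlonglongrightarrow> (if \<zeta> = 1 then \<infinity> else ennreal (4 / (norm (1 - \<zeta>))\<^sup>2))"
proof -
  define w where "w n = (real n - 1) / (real n + 1)" for n
  have w_eq: "(\<i> * of_nat n - \<i>) / (\<i> * of_nat n + \<i>) = complex_of_real (w n)" for n
  proof -
    have "(\<i> * of_nat n - \<i>) / (\<i> * of_nat n + \<i>) = (\<i> * (of_nat n - 1)) / (\<i> * (of_nat n + 1))" by (simp add: algebra_simps)
    then show ?thesis unfolding w_def by simp
  qed
  have "Re ((\<zeta> + complex_of_real (w n)) / (\<zeta> - complex_of_real (w n))) = (1 - (w n)\<^sup>2) / (norm (\<zeta> - complex_of_real (w n)))\<^sup>2" for n
    using Re_herglotz[OF \<zeta>, of "complex_of_real (w n)"] by simp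
  then have P_eq: "real n * Re ((\<zeta> + complex_of_real (w n)) / (\<zeta> - complex_of_real (w n)))
      = real n * (1 - (w n)\<^sup>2) / (norm (\<zeta> - complex_of_real (w n)))\<^sup>2" for n by simp
  show ?thesis unfolding w_eq P_eq
  proof (cases "\<zeta> = 1")
    case True
    have "norm (1 - complex_of_real (w n)) = \<bar>1 - w n\<bar>" for n by (metis norm_of_real of_real_1 of_real_diff)
    then have eqn: "real n * (1 - (w n)\<^sup>2) / (norm (\<zeta> - complex_of_real (w n)))\<^sup>2 = real n * (1 - (w n)\<^sup>2) / (1 - w n)\<^sup>2" for n
      unfolding True by simp
    have lim: "filterlim (\<lambda>n. real n * (1 - (w n)\<^sup>2) / (1 - w n)\<^sup>2) at_top sequentially"
      unfolding w_def by real_asymp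
    show "(\<lambda>n. ennreal (real n * (1 - (w n)\<^sup>2) / (norm (\<zeta> - complex_of_real (w n)))\<^sup>2))
        \<longlonglongrightarrow> (if \<zeta> = 1 then \<infinity> else ennreal (4 / (norm (1 - \<zeta>))\<^sup>2))"
      unfolding eqn using True lim by (simp add: ennreal_tendsto_top_eq_at_top)
  next
    case False
    have "(\<lambda>n. real n * (1 - (w n)\<^sup>2)) \<longlonglongrightarrow> 4" "w \<longlonglongrightarrow> 1" unfolding w_def by real_asymp+
    then have "(\<lambda>n. real n * (1 - (w n)\<^sup>2) / (norm (\<zeta> - complex_of_real (w n)))\<^sup>2) \<longlonglongrightarrow> 4 / (norm (\<zeta> - complex_of_real 1))\<^sup>2"
      using False by (intro tendsto_intros) auto
    then show "(\<lambda>n. ennreal (real n * (1 - (w n)\<^sup>2) / (norm (\<zeta> - complex_of_real (w n)))\<^sup>2))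
        \<longlonglongrightarrow> (if \<zeta> = 1 then \<infinity> else ennreal (4 / (norm (1 - \<zeta>))\<^sup>2))"
      using False by (simp add: norm_minus_commute tendsto_ennrealI)
  qed
qed

text \<open>In the disc, \<open>F\<close> is up to constants a function with nonnegative real part, so it has a Herglotz
  measure \<open>\<sigma>\<close>. The growth condition on the imaginary axis shows that \<open>\<sigma>\<close> has no mass at the point 1 and
  that \<open>4 / \<bar>1 - \<zeta>\<bar>\<^sup>2\<close> is integrable. Moving \<open>\<sigma>\<close> with this density to the line
  turns the Herglotz kernel into the resolvent, up to an additive constant. The constant vanishes and
  the total mass is 1 since \<open>z F z \<rightarrow> 1\<close>.\<close>

theorem cauchy_representation:
  assumes hol: "F holomorphic_on {z. 0 < Im z}" and neg: "\<And>z. 0 < Im z \<Longrightarrow> Im (F z) < 0"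
    and asym: "(\<lambda>n. \<i> * of_nat n * F (\<i> * of_nat n)) \<longlonglongrightarrow> 1"
  obtains \<nu> where "\<nu> \<in> prob_measures_on UNIV" "\<And>z. 0 < Im z \<Longrightarrow> F z = cauchy_transform \<nu> z"
proof -
  define m c where "m = - Im (F \<i>)" and "c = Re (F \<i>)"
  have m: "0 < m" unfolding m_def using neg[of \<i>] by simp
  define p where "p w = (\<i> * F (\<i> * (1 + w) / (1 - w)) - \<i> * of_real c) / of_real m" for w
  have p_hol: "p holomorphic_on ball 0 1"
  proof -
    have "F \<circ> (\<lambda>w. \<i> * (1 + w) / (1 - w)) holomorphic_on ball 0 1"
    proof (rule holomorphic_on_compose_gen[OF _ hol])
      show "(\<lambda>w. \<i> * (1 + w) / (1 - w)) holomorphic_on ball 0 1" by (intro holomorphic_intros) auto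
      show "(\<lambda>w. \<i> * (1 + w) / (1 - w)) ` ball 0 1 \<subseteq> {z. 0 < Im z}"
        using half_plane_point(1) by (intro image_subsetI) (simp only: mem_ball_0 mem_Collect_eq)
    qed
    then have "(\<lambda>w. F (\<i> * (1 + w) / (1 - w))) holomorphic_on ball 0 1" unfolding o_def .
    then show ?thesis unfolding p_def using m by (intro holomorphic_intros) auto
  qed
  have p_Re: "0 \<le> Re (p w)" if "norm w < 1" for w
    unfolding p_def using neg[OF half_plane_point(1)[OF that]] m
    by (simp add: Re_divide_of_real divide_nonpos_pos order_less_imp_le)
  have p_0: "p 0 = 1"
    unfolding p_def using m by (simp add: complex_eq_iff m_def c_def)
  obtain \<sigma> where \<sigma>: "\<sigma> \<in> M1_circle" and p_rep: "\<And>w. norm w < 1 \<Longrightarrow> p w = (LINT \<zeta>|\<sigma>. (\<zeta> + w) / (\<zeta> - w))"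
  proof (rule herglotz_representation[OF p_hol p_Re p_0])
    fix \<nu> assume "\<nu> \<in> M1_circle" "\<And>w. norm w < 1 \<Longrightarrow> p w = (LINT \<zeta>|\<nu>. (\<zeta> + w) / (\<zeta> - w))"
    then show thesis by (rule that)
  qed
  note \<sigma>_fin = prob_measures_onD(1)[OF \<sigma>]
  have space: "space \<sigma> = sphere 0 1" by (rule finite_measures_onD(3)[OF \<sigma>_fin])
  interpret \<sigma>: prob_space \<sigma> by (rule prob_measures_onD(2)[OF \<sigma>])
  define u where "u z = (z - \<i>) / (z + \<i>)" for z
  have u: "norm (u z) < 1" if "0 < Im z" for z unfolding u_def by (rule disc_point(1)[OF that])
  have F_eq: "F z = of_real c - \<i> * of_real m * (LINT \<zeta>|\<sigma>. (\<zeta> + u z) / (\<zeta> - u z))" if z: "0 < Im z" for z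
  proof -
    have "(LINT \<zeta>|\<sigma>. (\<zeta> + u z) / (\<zeta> - u z)) = (\<i> * F z - \<i> * of_real c) / of_real m"
      unfolding p_rep[OF u[OF z], symmetric] unfolding p_def u_def half_plane_disc_point[OF z] ..
    then have "of_real m * (LINT \<zeta>|\<sigma>. (\<zeta> + u z) / (\<zeta> - u z)) = \<i> * F z - \<i> * of_real c" using m by simp
    then have "\<i> * (of_real m * (LINT \<zeta>|\<sigma>. (\<zeta> + u z) / (\<zeta> - u z))) = \<i> * (\<i> * F z - \<i> * of_real c)" by simp
    then show ?thesis by (simp add: algebra_simps)
  qed

  \<comment> \<open>By Fatou's lemma along \<open>z = \<i> n\<close>, the integral of the limit \<open>H\<close> of \<open>n\<close> times the Poisson kernels is
      finite; \<open>H\<close> is infinite at 1 and equals \<open>4 / \<bar>1 - \<zeta>\<bar>\<^sup>2\<close> elsewhere.\<close>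
  define P where "P n \<zeta> = real n * Re ((\<zeta> + u (\<i> * of_nat n)) / (\<zeta> - u (\<i> * of_nat n)))" for n \<zeta>
  define H where "H \<zeta> = liminf (\<lambda>n. ennreal (P n \<zeta>))" for \<zeta>
  have H_eq: "H \<zeta> = (if \<zeta> = 1 then \<infinity> else ennreal (4 / (norm (1 - \<zeta>))\<^sup>2))" if "norm \<zeta> = 1" for \<zeta>
    unfolding H_def P_def u_def using lim_imp_Liminf[OF sequentially_bot poisson_limit[OF that]] .
  have P_meas: "(\<lambda>\<zeta>. ennreal (P n \<zeta>)) \<in> borel_measurable \<sigma>" for n
  proof -
    have "(\<lambda>\<zeta>. (\<zeta> + u (\<i> * of_nat n)) / (\<zeta> - u (\<i> * of_nat n))) \<in> borel_measurable borel"
      by (intro borel_measurable_divide borel_measurable_add borel_measurable_diff borel_measurable_const measurable_ident_sets) auto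
    from measurable_compose[OF this borel_measurable_Re] have "P n \<in> borel_measurable borel"
      unfolding P_def by (intro borel_measurable_times borel_measurable_const)
    then have "P n \<in> borel_measurable \<sigma>" by (rule borel_measurable_restricted[OF \<sigma>_fin])
    then show ?thesis by measurable
  qed
  have H_meas: "H \<in> borel_measurable \<sigma>" unfolding H_def using P_meas by measurable
  have P_int: "(\<integral>\<^sup>+\<zeta>. ennreal (P n \<zeta>) \<partial>\<sigma>) = ennreal (Re (\<i> * of_nat n * F (\<i> * of_nat n)) / m)" if n: "0 < n" for n
  proof -
    have z: "0 < Im (\<i> * of_nat n)" using n by simp
    have int: "integrable \<sigma> (\<lambda>\<zeta>. (\<zeta> + u (\<i> * of_nat n)) / (\<zeta> - u (\<i> * of_nat n)))"
      by (rule herglotz_integrable[OF \<sigma>_fin u[OF z]])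
    have "(LINT \<zeta>|\<sigma>. P n \<zeta>) = real n * Re (LINT \<zeta>|\<sigma>. (\<zeta> + u (\<i> * of_nat n)) / (\<zeta> - u (\<i> * of_nat n)))"
      unfolding P_def using int by simp
    also have "\<dots> = Re (\<i> * of_nat n * F (\<i> * of_nat n)) / m"
      unfolding F_eq[OF z] using m by simp
    finally have val: "(LINT \<zeta>|\<sigma>. P n \<zeta>) = Re (\<i> * of_nat n * F (\<i> * of_nat n)) / m" .
    have "(\<integral>\<^sup>+\<zeta>. ennreal (P n \<zeta>) \<partial>\<sigma>) = ennreal (LINT \<zeta>|\<sigma>. P n \<zeta>)"
    proof (rule nn_integral_eq_integral)
      show "integrable \<sigma> (P n)" unfolding P_def using int by simp
      show "AE \<zeta> in \<sigma>. 0 \<le> P n \<zeta>"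
        using u[OF z] by (intro AE_I2) (simp add: P_def space Re_herglotz abs_square_le_1)
    qed
    then show ?thesis unfolding val .
  qed
  have "(\<lambda>n. Re (\<i> * of_nat n * F (\<i> * of_nat n)) / m) \<longlonglongrightarrow> Re 1 / m"
    using m by (intro tendsto_intros asym) auto
  then have "(\<lambda>n. ennreal (Re (\<i> * of_nat n * F (\<i> * of_nat n)) / m)) \<longlonglongrightarrow> ennreal (Re 1 / m)" by (rule tendsto_ennrealI)
  moreover have "\<forall>\<^sub>F n in sequentially. ennreal (Re (\<i> * of_nat n * F (\<i> * of_nat n)) / m) = (\<integral>\<^sup>+\<zeta>. ennreal (P n \<zeta>) \<partial>\<sigma>)"
    using eventually_gt_at_top[of 0] by eventually_elim (simp add: P_int)
  ultimately have "(\<lambda>n. (\<integral>\<^sup>+\<zeta>. ennreal (P n \<zeta>) \<partial>\<sigma>)) \<longlonglongrightarrow> ennreal (Re 1 / m)"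
    by (rule Lim_transform_eventually)
  from lim_imp_Liminf[OF sequentially_bot this] nn_integral_liminf[of "\<lambda>n \<zeta>. ennreal (P n \<zeta>)" \<sigma>] P_meas
  have H_int: "(\<integral>\<^sup>+\<zeta>. H \<zeta> \<partial>\<sigma>) \<le> ennreal (Re 1 / m)" unfolding H_def by simp
  then have H_fin: "(\<integral>\<^sup>+\<zeta>. H \<zeta> \<partial>\<sigma>) < \<infinity>"
    using le_less_trans[OF H_int ennreal_less_top] by (simp add: infinity_ennreal_def)
  have "AE \<zeta> in \<sigma>. H \<zeta> \<noteq> \<infinity>" using H_fin by (intro nn_integral_PInf_AE[OF H_meas]) auto
  then have AE1: "AE \<zeta> in \<sigma>. norm \<zeta> = 1 \<and> \<zeta> \<noteq> 1"
    by (rule AE_mp) (auto intro!: AE_I2 simp: space H_eq)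

  define k where "k \<zeta> = 4 / (norm (1 - \<zeta>))\<^sup>2" for \<zeta> :: complex
  define x where "x = cayley_inv"
  have k_x: "AE \<zeta> in \<sigma>. k \<zeta> = 1 + (x \<zeta>)\<^sup>2 \<and> cayley (x \<zeta>) = \<zeta>"
    using AE1 by eventually_elim (simp add: k_def x_def one_plus_cayley_inv_sq cayley_cayley_inv)
  have k_meas: "k \<in> borel_measurable \<sigma>"
    by (rule borel_measurable_restricted[OF \<sigma>_fin]) (unfold k_def, measurable)
  have x_meas: "x \<in> borel_measurable \<sigma>"
    by (rule borel_measurable_restricted[OF \<sigma>_fin]) (unfold x_def cayley_inv_def, measurable)
  have k_nonneg: "0 \<le> k \<zeta>" for \<zeta> unfolding k_def by simp
  have k_int: "integrable \<sigma> k"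
  proof (rule integrableI_bounded[OF k_meas])
    have "AE \<zeta> in \<sigma>. ennreal (norm (k \<zeta>)) = H \<zeta>"
      using AE1 by eventually_elim (simp add: H_eq k_def)
    then have "(\<integral>\<^sup>+\<zeta>. ennreal (norm (k \<zeta>)) \<partial>\<sigma>) = (\<integral>\<^sup>+\<zeta>. H \<zeta> \<partial>\<sigma>)"
      by (rule nn_integral_cong_AE)
    then show "(\<integral>\<^sup>+\<zeta>. ennreal (norm (k \<zeta>)) \<partial>\<sigma>) < \<infinity>" using H_fin by simp
  qed
  have x_int: "integrable \<sigma> x"
  proof (rule Bochner_Integration.integrable_bound[OF k_int x_meas])
    show "AE \<zeta> in \<sigma>. norm (x \<zeta>) \<le> norm (k \<zeta>)"
      using k_x
    proof eventually_elim
      case (elim \<zeta>)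
      have "0 \<le> (\<bar>x \<zeta>\<bar> - 1)\<^sup>2" by simp
      then have "2 * \<bar>x \<zeta>\<bar> \<le> 1 + (x \<zeta>)\<^sup>2" by (simp add: power2_diff)
      then show ?case using elim by (simp add: abs_of_nonneg)
    qed
  qed
  define \<nu> where "\<nu> = distr (density \<sigma> (\<lambda>\<zeta>. ennreal (m * k \<zeta>))) borel x"
  have x_meas': "x \<in> borel_measurable (density \<sigma> (\<lambda>\<zeta>. ennreal (m * k \<zeta>)))" using x_meas by simp
  have \<nu>_fin: "\<nu> \<in> finite_measures_on UNIV"
    unfolding finite_measures_on_def
  proof (intro CollectI conjI)
    show "sets \<nu> = sets (restrict_space borel UNIV)" unfolding \<nu>_def by simp
    show "finite_measure \<nu>"
    proof
      have "emeasure \<nu> (space \<nu>) = emeasure (density \<sigma> (\<lambda>\<zeta>. ennreal (m * k \<zeta>))) (space \<sigma>)"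
        unfolding \<nu>_def using emeasure_distr[OF x_meas', of UNIV] by simp
      also have "\<dots> = (\<integral>\<^sup>+\<zeta>. ennreal (m * k \<zeta>) \<partial>\<sigma>)"
        using k_meas by (subst emeasure_density) (auto intro!: nn_integral_cong)
      also have "\<dots> = ennreal (LINT \<zeta>|\<sigma>. m * k \<zeta>)"
        using k_int m k_nonneg by (intro nn_integral_eq_integral) auto
      finally show "emeasure \<nu> (space \<nu>) \<noteq> \<infinity>" by simp
    qed
  qed
  have \<nu>_int: "(LINT y|\<nu>. f y) = (LINT \<zeta>|\<sigma>. (m * k \<zeta>) *\<^sub>R f (x \<zeta>))" if f: "f \<in> borel_measurable borel" for f :: "real \<Rightarrow> complex"
  proof -
    have "(LINT y|\<nu>. f y) = (LINT \<zeta>|density \<sigma> (\<lambda>\<zeta>. ennreal (m * k \<zeta>)). f (x \<zeta>))"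
      unfolding \<nu>_def by (rule integral_distr[OF x_meas' f])
    also have "\<dots> = (LINT \<zeta>|\<sigma>. (m * k \<zeta>) *\<^sub>R f (x \<zeta>))"
      using measurable_compose[OF x_meas f] k_meas m k_nonneg by (intro integral_density) auto
    finally show ?thesis .
  qed
  define C :: complex where "C = of_real c + of_real (m * (LINT \<zeta>|\<sigma>. x \<zeta>))"
  have F_C: "F z = C + cauchy_transform \<nu> z" if z: "0 < Im z" for z
  proof -
    define f where "f y = 1 / (z - complex_of_real y)" for y
    have f_meas: "f \<in> borel_measurable borel"
      unfolding f_def by (rule borel_measurable_continuous_onI[OF resolvent_continuous[OF z]])
    have int: "integrable \<sigma> (\<lambda>\<zeta>. (m * k \<zeta>) *\<^sub>R f (x \<zeta>))"
    proof (rule Bochner_Integration.integrable_bound)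
      show "integrable \<sigma> (\<lambda>\<zeta>. m * k \<zeta> * (1 / Im z))" using k_int by simp
      show "(\<lambda>\<zeta>. (m * k \<zeta>) *\<^sub>R f (x \<zeta>)) \<in> borel_measurable \<sigma>"
        using measurable_compose[OF x_meas f_meas] k_meas by measurable
      show "AE \<zeta> in \<sigma>. norm ((m * k \<zeta>) *\<^sub>R f (x \<zeta>)) \<le> norm (m * k \<zeta> * (1 / Im z))"
      proof (rule AE_I2)
        fix \<zeta>
        have "norm (f (x \<zeta>)) \<le> 1 / Im z" unfolding f_def by (rule resolvent_bound[OF z order_refl])
        then have "\<bar>m * k \<zeta>\<bar> * norm (f (x \<zeta>)) \<le> \<bar>m * k \<zeta>\<bar> * (1 / Im z)" by (rule mult_left_mono) simp
        then show "norm ((m * k \<zeta>) *\<^sub>R f (x \<zeta>)) \<le> norm (m * k \<zeta> * (1 / Im z))"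
          using z by (simp add: abs_mult)
      qed
    qed
    have "- (\<i> * of_real m * (LINT \<zeta>|\<sigma>. (\<zeta> + u z) / (\<zeta> - u z))) = (LINT \<zeta>|\<sigma>. - \<i> * of_real m * ((\<zeta> + u z) / (\<zeta> - u z)))"
      by (simp only: integral_mult_right_zero) simp
    also have "\<dots> = (LINT \<zeta>|\<sigma>. (m * k \<zeta>) *\<^sub>R f (x \<zeta>) + of_real (m * x \<zeta>))"
    proof (rule integral_cong_AE)
      show "(\<lambda>\<zeta>. - \<i> * of_real m * ((\<zeta> + u z) / (\<zeta> - u z))) \<in> borel_measurable \<sigma>"
        using herglotz_integrable[OF \<sigma>_fin u[OF z]] by (intro borel_measurable_integrable integrable_mult_right)
      show "(\<lambda>\<zeta>. (m * k \<zeta>) *\<^sub>R f (x \<zeta>) + of_real (m * x \<zeta>)) \<in> borel_measurable \<sigma>"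
        using int x_int by (intro borel_measurable_integrable Bochner_Integration.integrable_add integrable_of_real integrable_mult_right)
      show "AE \<zeta> in \<sigma>. - \<i> * of_real m * ((\<zeta> + u z) / (\<zeta> - u z)) = (m * k \<zeta>) *\<^sub>R f (x \<zeta>) + of_real (m * x \<zeta>)"
        using k_x
      proof eventually_elim
        case (elim \<zeta>)
        define y where "y = complex_of_real (x \<zeta>)"
        have nz: "z - y \<noteq> 0" using z unfolding y_def by (auto simp: complex_eq_iff)
        have K: "(\<zeta> + u z) / (\<zeta> - u z) = \<i> * ((1 + z\<^sup>2) / (z - y) - z)"
          using cayley_kernel[OF z, of "x \<zeta>"] elim unfolding u_def y_def by simp
        have rot: "- \<i> * of_real m * (\<i> * X) = of_real m * X" for X :: complex by (simp add: algebra_simps)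
        have split: "(1 + z\<^sup>2) / (z - y) - z = (1 + y\<^sup>2) * (1 / (z - y)) + y"
          using nz by (simp add: field_simps power2_eq_square)
        have dens: "(m * k \<zeta>) *\<^sub>R f (x \<zeta>) = of_real m * ((1 + y\<^sup>2) * (1 / (z - y)))"
          unfolding f_def y_def using elim by (simp add: scaleR_conv_of_real)
        show ?case unfolding K rot split dens unfolding y_def by (simp add: distrib_left)
      qed
    qed
    also have "\<dots> = (LINT \<zeta>|\<sigma>. (m * k \<zeta>) *\<^sub>R f (x \<zeta>)) + (LINT \<zeta>|\<sigma>. of_real (m * x \<zeta>))"
      using int x_int by (intro Bochner_Integration.integral_add integrable_of_real integrable_mult_right)
    also have "(LINT \<zeta>|\<sigma>. complex_of_real (m * x \<zeta>)) = of_real (m * (LINT \<zeta>|\<sigma>. x \<zeta>))"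
      by (simp only: integral_complex_of_real integral_mult_right_zero)
    also have "(LINT \<zeta>|\<sigma>. (m * k \<zeta>) *\<^sub>R f (x \<zeta>)) = cauchy_transform \<nu> z"
      unfolding \<nu>_int[OF f_meas, symmetric] unfolding cauchy_transform_def f_def ..
    finally show ?thesis unfolding F_eq[OF z] C_def by simp
  qed

  interpret \<nu>: finite_measure \<nu> by (rule finite_measures_onD(1)[OF \<nu>_fin])
  have inv_n: "(\<lambda>n. 1 / (\<i> * of_nat n)) \<longlonglongrightarrow> (0::complex)"
  proof (rule Lim_null_comparison)
    show "\<forall>\<^sub>F n in sequentially. norm (1 / (\<i> * of_nat n) :: complex) \<le> 1 / real n" by (simp add: norm_divide norm_mult)
    show "(\<lambda>n. 1 / real n) \<longlonglongrightarrow> 0" by real_asymp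
  qed
  have G_asym: "(\<lambda>n. \<i> * of_nat n * cauchy_transform \<nu> (\<i> * of_nat n)) \<longlonglongrightarrow> of_real (measure \<nu> UNIV)"
  proof -
    have "(\<lambda>n. LINT y|\<nu>. \<i> * of_nat n * (1 / (\<i> * of_nat n - complex_of_real y))) \<longlonglongrightarrow> (LINT y|\<nu>. 1)"
    proof (rule integral_dominated_convergence[where w = "\<lambda>_. 1"])
      have nz: "\<i> * of_nat n - complex_of_real y \<noteq> 0" if "0 < n" for n y using that by (auto simp: complex_eq_iff)
      have meas0: "(\<lambda>y. \<i> * of_nat n * (1 / (\<i> * of_nat n - complex_of_real y))) \<in> borel_measurable borel" for n
        by measurable
      show "(\<lambda>y. \<i> * of_nat n * (1 / (\<i> * of_nat n - complex_of_real y))) \<in> borel_measurable \<nu>" for n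
        by (rule borel_measurable_restricted[OF \<nu>_fin meas0])
      show "AE y in \<nu>. (\<lambda>n. \<i> * of_nat n * (1 / (\<i> * of_nat n - complex_of_real y))) \<longlonglongrightarrow> 1"
      proof (rule AE_I2)
        fix y
        have "(\<lambda>n. 1 / (1 - complex_of_real y * (1 / (\<i> * of_nat n)))) \<longlonglongrightarrow> 1 / (1 - complex_of_real y * 0)"
          by (intro tendsto_intros inv_n) auto
        moreover have "\<forall>\<^sub>F n in sequentially. 1 / (1 - complex_of_real y * (1 / (\<i> * of_nat n)))
            = \<i> * of_nat n * (1 / (\<i> * of_nat n - complex_of_real y))"
          using eventually_gt_at_top[of 0]
        proof eventually_elim
          case (elim n)
          define a where "a = \<i> * (of_nat n :: complex)"
          have "a \<noteq> 0" "a - of_real y \<noteq> 0" using elim nz[of n y] unfolding a_def by auto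
          moreover from this have "1 - complex_of_real y * (1 / a) \<noteq> 0" by (simp add: field_simps)
          ultimately show ?case unfolding a_def[symmetric] by (simp add: field_simps)
        qed
        ultimately have "(\<lambda>n. \<i> * of_nat n * (1 / (\<i> * of_nat n - complex_of_real y))) \<longlonglongrightarrow> 1 / (1 - complex_of_real y * 0)"
          by (rule Lim_transform_eventually)
        then show "(\<lambda>n. \<i> * of_nat n * (1 / (\<i> * of_nat n - complex_of_real y))) \<longlonglongrightarrow> 1" by simp
      qed
      show "AE y in \<nu>. norm (\<i> * of_nat n * (1 / (\<i> * of_nat n - complex_of_real y))) \<le> 1" for n
      proof (rule AE_I2)
        fix y
        have "real n \<le> norm (\<i> * of_nat n - complex_of_real y)" using Im_le_resolvent[of "\<i> * of_nat n" y] by simp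
        then show "norm (\<i> * of_nat n * (1 / (\<i> * of_nat n - complex_of_real y))) \<le> 1"
          by (auto simp: norm_mult norm_divide divide_le_eq_1)
      qed
    qed auto
    moreover have "(LINT y|\<nu>. 1) = complex_of_real (measure \<nu> UNIV)"
      using finite_measures_onD(3)[OF \<nu>_fin] by (simp add: scaleR_conv_of_real)
    ultimately show ?thesis unfolding cauchy_transform_def by (simp only: integral_mult_right_zero)
  qed
  have F_lim: "(\<lambda>n. F (\<i> * of_nat n)) \<longlonglongrightarrow> 0" and G_lim: "(\<lambda>n. cauchy_transform \<nu> (\<i> * of_nat n)) \<longlonglongrightarrow> 0"
  proof -
    have *: "f \<longlonglongrightarrow> 0" if "(\<lambda>n. \<i> * of_nat n * f n) \<longlonglongrightarrow> a" for f and a :: complex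
    proof -
      have "(\<lambda>n. 1 / (\<i> * of_nat n) * (\<i> * of_nat n * f n)) \<longlonglongrightarrow> 0 * a" by (intro tendsto_mult inv_n that)
      moreover have "\<forall>\<^sub>F n in sequentially. 1 / (\<i> * of_nat n) * (\<i> * of_nat n * f n) = f n"
        using eventually_gt_at_top[of 0] by eventually_elim simp
      ultimately have "f \<longlonglongrightarrow> 0 * a" by (rule Lim_transform_eventually)
      then show ?thesis by simp
    qed
    show "(\<lambda>n. F (\<i> * of_nat n)) \<longlonglongrightarrow> 0" by (rule *[OF asym])
    show "(\<lambda>n. cauchy_transform \<nu> (\<i> * of_nat n)) \<longlonglongrightarrow> 0" by (rule *[OF G_asym])
  qed
  have F_ev: "\<forall>\<^sub>F n in sequentially. F (\<i> * of_nat n) - cauchy_transform \<nu> (\<i> * of_nat n) = C"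
    using eventually_gt_at_top[of 0] by eventually_elim (simp add: F_C)
  have "(\<lambda>n. F (\<i> * of_nat n) - cauchy_transform \<nu> (\<i> * of_nat n)) \<longlonglongrightarrow> 0 - 0"
    by (intro tendsto_diff F_lim G_lim)
  then have "(\<lambda>n::nat. C) \<longlonglongrightarrow> 0 - 0" using F_ev by (rule Lim_transform_eventually)
  then have C0: "C = 0" by (simp add: LIMSEQ_const_iff)
  have "\<forall>\<^sub>F n in sequentially. \<i> * of_nat n * cauchy_transform \<nu> (\<i> * of_nat n) = \<i> * of_nat n * F (\<i> * of_nat n)"
    using eventually_gt_at_top[of 0] by eventually_elim (simp add: F_C C0)
  with G_asym have "(\<lambda>n. \<i> * of_nat n * F (\<i> * of_nat n)) \<longlonglongrightarrow> of_real (measure \<nu> UNIV)"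
    by (rule Lim_transform_eventually)
  from LIMSEQ_unique[OF this asym] have "complex_of_real (measure \<nu> UNIV) = 1" .
  then have "measure \<nu> UNIV = 1" by simp
  then have "prob_space \<nu>"
    using finite_measures_onD(3)[OF \<nu>_fin] by (intro prob_spaceI) (simp add: \<nu>.emeasure_eq_measure)
  then have "\<nu> \<in> prob_measures_on UNIV" unfolding prob_measures_on_def using \<nu>_fin by simp
  then show ?thesis using F_C C0 by (intro that[of \<nu>]) auto
qed

section \<open>The chordal map\<close>

text \<open>The complement of the support is a union of open null sets; by the Lindeloef property countably
  many of them suffice.\<close>

lemma null_outside_support:
  assumes \<mu>: "\<mu> \<in> finite_measures_on (UNIV :: real set)" and supp: "msupport \<mu> \<subseteq> {-R..R}"
  shows "AE x in \<mu>. \<bar>x\<bar> \<le> R"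
proof -
  define \<U> where "\<U> = {U. open U \<and> emeasure \<mu> U = 0}"
  have sets: "sets \<mu> = sets borel" using finite_measures_onD(2)[OF \<mu>] by simp
  obtain \<U>' where \<U>': "\<U>' \<subseteq> \<U>" "countable \<U>'" "\<Union>\<U>' = \<Union>\<U>"
    using Lindelof[of \<U>] unfolding \<U>_def by blast
  have "\<Union>\<U>' \<in> null_sets \<mu>"
  proof (rule null_sets_UN'[OF \<U>'(2), of "\<lambda>U. U", simplified])
    fix U assume "U \<in> \<U>'"
    then show "U \<in> null_sets \<mu>" using \<U>'(1) sets unfolding \<U>_def null_sets_def by auto
  qed
  moreover have "{x \<in> space \<mu>. \<not> \<bar>x\<bar> \<le> R} \<subseteq> \<Union>\<U>'"
  proof
    fix x assume "x \<in> {x \<in> space \<mu>. \<not> \<bar>x\<bar> \<le> R}"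
    then have "x \<notin> {-R..R}" by auto
    then have "x \<notin> msupport \<mu>" using supp by blast
    then show "x \<in> \<Union>\<U>'" unfolding \<U>'(3) \<U>_def msupport_def by auto
  qed
  ultimately show ?thesis by (rule AE_I')
qed

text \<open>The bound makes the increments of the distribution function quadratically small, so its derivative is 0 and it is
  constant on \<open>S\<close>.\<close>

lemma null_of_quadratic_bound:
  assumes \<nu>: "\<nu> \<in> prob_measures_on (UNIV :: real set)" and S: "open S" "convex S"
    and bound: "\<And>x y. x \<in> S \<Longrightarrow> 0 < y \<Longrightarrow> measure \<nu> {x - y<..<x + y} \<le> K * y\<^sup>2"
    and ab: "a \<in> S" "b \<in> S" "a < b"
  shows "measure \<nu> {a<..b} = 0"
proof -
  interpret prob_space \<nu> by (rule prob_measures_onD(2)[OF \<nu>])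
  have sets: "sets \<nu> = sets borel" using finite_measures_onD(2)[OF prob_measures_onD(1)[OF \<nu>]] by simp
  define F where "F x = measure \<nu> {..x}" for x
  have F_diff: "F y - F x = measure \<nu> {x<..y}" if "x \<le> y" for x y
  proof -
    have "{..y} = {..x} \<union> {x<..y}" using that by auto
    moreover have "{..x} \<inter> {x<..y} = {}" by auto
    ultimately have "measure \<nu> {..y} = measure \<nu> {..x} + measure \<nu> {x<..y}"
      using finite_measure_Union[of "{..x}" "{x<..y}"] sets by simp
    then show ?thesis unfolding F_def by simp
  qed
  have K: "0 \<le> K" using order_trans[OF measure_nonneg bound[OF ab(1), of 1]] by simp
  have F_close: "\<bar>F y - F x\<bar> \<le> 4 * K * \<bar>y - x\<bar> * \<bar>y - x\<bar>" if x: "x \<in> S" and "y \<noteq> x" for x y :: real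
  proof -
    define r where "r = 2 * \<bar>y - x\<bar>"
    have r: "0 < r" using that unfolding r_def by simp
    have "\<bar>F y - F x\<bar> \<le> measure \<nu> {x - r<..<x + r}"
    proof (cases "x \<le> y")
      case True
      then have "measure \<nu> {x<..y} \<le> measure \<nu> {x - r<..<x + r}"
        using r sets unfolding r_def by (intro finite_measure_mono) auto
      then show ?thesis using F_diff[OF True] by simp
    next
      case False
      then have "measure \<nu> {y<..x} \<le> measure \<nu> {x - r<..<x + r}"
        using r sets unfolding r_def by (intro finite_measure_mono) auto
      then show ?thesis using F_diff[of y x] False measure_nonneg[of \<nu> "{y<..x}"] by linarith
    qed
    also have "\<dots> \<le> K * r\<^sup>2" by (rule bound[OF x r])
    also have "\<dots> = 4 * K * \<bar>y - x\<bar> * \<bar>y - x\<bar>" unfolding r_def by (simp add: power2_eq_square)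
    finally show ?thesis .
  qed
  have "(F has_field_derivative 0) (at x within S)" if x: "x \<in> S" for x
  proof -
    have "((\<lambda>y. (F y - F x) / (y - x)) \<longlongrightarrow> 0) (at x within S)"
    proof (rule Lim_null_comparison)
      have "norm ((F y - F x) / (y - x)) \<le> 4 * K * \<bar>y - x\<bar>" if "y \<noteq> x" for y
        using divide_right_mono[OF F_close[OF x that] abs_ge_zero[of "y - x"]] that by (simp add: abs_divide)
      then show "\<forall>\<^sub>F y in at x within S. norm ((F y - F x) / (y - x)) \<le> 4 * K * \<bar>y - x\<bar>"
        by (simp add: eventually_at_filter)
      have lim: "((\<lambda>y. 4 * K * \<bar>y - x\<bar>) \<longlongrightarrow> 4 * K * \<bar>x - x\<bar>) (at x within S)" by (intro tendsto_intros)
      then show "((\<lambda>y. 4 * K * \<bar>y - x\<bar>) \<longlongrightarrow> 0) (at x within S)" by simp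
    qed
    then show ?thesis by (simp add: has_field_derivative_iff)
  qed
  then obtain c where "\<And>x. x \<in> S \<Longrightarrow> F x = c"
    using has_field_derivative_zero_constant[OF S(2), of F] by blast
  then have "F a = F b" using ab by simp
  then show ?thesis using F_diff[of a b] ab(3) by simp
qed

lemma Im_inverse: "Im (1 / w) = - Im w / (norm w)\<^sup>2"
  using Im_resolvent[of w 0] by simp

lemma return_prob: "return borel (a::real) \<in> prob_measures_on UNIV"
  unfolding prob_measures_on_def finite_measures_on_def
  using prob_space_return[of a "borel :: real measure"] prob_space.finite_measure by auto

lemma return_cauchy_transform: "0 < Im z \<Longrightarrow> cauchy_transform (return borel a) z = 1 / (z - of_real a)"
  unfolding cauchy_transform_def
  by (rule integral_return) (auto intro: borel_measurable_continuous_onI resolvent_continuous)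

text \<open>The Poisson kernel \<open>y / ((x - u)\<^sup>2 + y\<^sup>2)\<close> is at least \<open>1 / (2 y)\<close> for \<open>\<bar>x - u\<bar> < y\<close>.\<close>

lemma poisson_interval_bound:
  assumes \<nu>: "\<nu> \<in> prob_measures_on UNIV" and y: "0 < y"
    and bound: "- Im (cauchy_transform \<nu> (Complex x y)) \<le> K * y"
  shows "measure \<nu> {x - y<..<x + y} \<le> 2 * K * y\<^sup>2"
proof -
  interpret prob_space \<nu> by (rule prob_measures_onD(2)[OF \<nu>])
  have sets: "sets \<nu> = sets borel" using finite_measures_onD(2)[OF prob_measures_onD(1)[OF \<nu>]] by simp
  define z where "z = Complex x y"
  have z: "0 < Im z" unfolding z_def using y by simp
  have int: "integrable \<nu> (\<lambda>u. - Im (1 / (z - complex_of_real u)))"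
    using resolvent_integrable[OF prob_measures_onD(1)[OF \<nu>] z] by (intro integrable_minus integrable_Im)
  have "measure \<nu> {x - y<..<x + y} * (1 / (2 * y)) = (LINT u|\<nu>. indicator {x - y<..<x + y} u * (1 / (2 * y)))"
    using sets by simp
  also have "\<dots> \<le> (LINT u|\<nu>. - Im (1 / (z - complex_of_real u)))"
  proof (rule integral_mono[OF _ int])
    show "integrable \<nu> (\<lambda>u. indicator {x - y<..<x + y} u * (1 / (2 * y)))"
      using sets by (intro integrable_mult_left integrable_real_indicator) (auto simp: emeasure_eq_measure)
    fix u
    have eq: "- Im (1 / (z - complex_of_real u)) = y / ((x - u)\<^sup>2 + y\<^sup>2)"
      unfolding Im_resolvent cmod_power2 by (simp add: z_def)
    show "indicator {x - y<..<x + y} u * (1 / (2 * y)) \<le> - Im (1 / (z - complex_of_real u))"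
    proof (cases "u \<in> {x - y<..<x + y}")
      case True
      then have "\<bar>x - u\<bar> \<le> y" by auto
      then have "(x - u)\<^sup>2 \<le> y\<^sup>2" using power_mono[of "\<bar>x - u\<bar>" y 2] by simp
      then have "y / (2 * y\<^sup>2) \<le> y / ((x - u)\<^sup>2 + y\<^sup>2)"
        using y by (intro divide_left_mono mult_pos_pos add_nonneg_pos) auto
      then show ?thesis unfolding eq using True y by (simp add: power2_eq_square)
    next
      case False
      then show ?thesis unfolding eq using y by simp
    qed
  qed
  also have "\<dots> = - Im (cauchy_transform \<nu> z)"
    unfolding cauchy_transform_def using resolvent_integrable[OF prob_measures_onD(1)[OF \<nu>] z] by simp
  also have "\<dots> \<le> K * y" using bound unfolding z_def .
  finally show ?thesis using y by (simp add: field_simps power2_eq_square)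
qed

context
  fixes s :: "real \<Rightarrow> real measure"
  assumes s: "s \<in> bounded_paths UNIV M0_real"
begin

lemma chordal_mass:
  obtains M where "0 < M" "\<And>t. 0 \<le> t \<Longrightarrow> measure (s t) UNIV \<le> M"
    "loewner_field Im (\<lambda>t. cauchy_transform (s t))
     (\<lambda>t a b. LINT x|s t. - (1 / (a - complex_of_real x) * (1 / (b - complex_of_real x))))
     (\<lambda>c. 1 / c * M) (\<lambda>c. 1 / c * (1 / c) * M)"
proof -
  obtain M where M: "0 < M" "\<And>t. 0 \<le> t \<Longrightarrow> measure (s t) UNIV \<le> M"
    using bounded_path_mass[OF s] by blast
  show ?thesis by (rule that[OF M chordal_field[OF s M(2)]])
qed

lemma chordal_f_properties:
  assumes t: "0 \<le> t"
  shows chordal_f_holomorphic: "chordal_f s t holomorphic_on {z. 0 < Im z}"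
    and chordal_f_Im: "\<And>z. 0 < Im z \<Longrightarrow> Im z \<le> Im (chordal_f s t z)"
    and chordal_f_near_id: "\<exists>M. \<forall>z. 0 < Im z \<longrightarrow> norm (chordal_f s t z - z) \<le> M / Im z"
    and chordal_f_eq: "\<And>T \<zeta> h. t < T \<Longrightarrow> flow_solution {w. 0 < Im w} (\<lambda>t. cauchy_transform (s t)) \<zeta> T h \<Longrightarrow>
      chordal_f s t (h t) = \<zeta>"
    and chordal_f_solution: "\<And>z. 0 < Im z \<Longrightarrow>
      \<exists>h T. t < T \<and> flow_solution {w. 0 < Im w} (\<lambda>t. cauchy_transform (s t)) (chordal_f s t z) T h \<and> h t = z"
    and chordal_f_continuous: "\<And>z. 0 < Im z \<Longrightarrow> continuous_on {0..} (\<lambda>t. chordal_f s t z)"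
    and chordal_f_time_0: "\<And>z. 0 < Im z \<Longrightarrow> chordal_f s 0 z = z"
proof -
  obtain M where L: "loewner_field Im (\<lambda>t. cauchy_transform (s t))
     (\<lambda>t a b. LINT x|s t. - (1 / (a - complex_of_real x) * (1 / (b - complex_of_real x))))
     (\<lambda>c. 1 / c * M) (\<lambda>c. 1 / c * (1 / c) * M)" using chordal_mass by blast
  note facts = loewner_field.inverse_flow_holomorphic[OF L t] loewner_field.inverse_flow_level[OF L t]
    loewner_field.inverse_flow_displacement[OF L t] loewner_field.inverse_flow_eq[OF L t]
    loewner_field.inverse_flow_solution[OF L t]
    loewner_field.inverse_flow_continuous_in_time[OF L] loewner_field.inverse_flow_0[OF L]
  note facts' = facts[folded chordal_f_def]
  show "chordal_f s t holomorphic_on {z. 0 < Im z}" by (rule facts'(1))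
  show "Im z \<le> Im (chordal_f s t z)" if "0 < Im z" for z using facts'(2)[of z] that by simp
  have "norm (chordal_f s t z - z) \<le> (M * t) / Im z" if "0 < Im z" for z
    using facts'(3)[of z] that by simp
  then show "\<exists>M. \<forall>z. 0 < Im z \<longrightarrow> norm (chordal_f s t z - z) \<le> M / Im z" by blast
  show "chordal_f s t (h t) = \<zeta>"
    if "t < T" "flow_solution {w. 0 < Im w} (\<lambda>t. cauchy_transform (s t)) \<zeta> T h" for T \<zeta> h
    using facts'(4)[OF that] .
  show "\<exists>h T. t < T \<and> flow_solution {w. 0 < Im w} (\<lambda>t. cauchy_transform (s t)) (chordal_f s t z) T h \<and> h t = z"
    if "0 < Im z" for z
  proof (rule facts'(5)[of z])
    show "z \<in> {w. 0 < Im w}" using that by simp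
  qed blast
  show "continuous_on {0..} (\<lambda>t. chordal_f s t z)" if "0 < Im z" for z using facts'(6)[of z] that by simp
  show "chordal_f s 0 z = z" if "0 < Im z" for z using facts'(7)[of z] that by simp
qed

text \<open>Since \<open>f\<^sub>t z - z\<close> is bounded by a multiple of \<open>1 / Im z\<close>, the function \<open>1 / f\<^sub>t\<close> has the growth on
  the imaginary axis that \<open>cauchy_representation\<close> asks for.\<close>

lemma chordal_measure_unique_existence:
  assumes t: "0 \<le> t"
  shows "\<exists>!\<nu>. chordal_measure s t \<nu>"
proof (rule ex_ex1I)
  have Im_pos: "0 < Im (chordal_f s t z)" if "0 < Im z" for z using chordal_f_Im[OF t that] that by simp
  have nz: "chordal_f s t z \<noteq> 0" if "0 < Im z" for z using Im_pos[OF that] by auto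
  obtain \<nu> where "\<nu> \<in> prob_measures_on UNIV" "\<And>z. 0 < Im z \<Longrightarrow> 1 / chordal_f s t z = cauchy_transform \<nu> z"
  proof (rule cauchy_representation[of "\<lambda>z. 1 / chordal_f s t z"])
    show "(\<lambda>z. 1 / chordal_f s t z) holomorphic_on {z. 0 < Im z}"
      using nz by (intro holomorphic_intros chordal_f_holomorphic[OF t]) simp
    show "Im (1 / chordal_f s t z) < 0" if "0 < Im z" for z
      unfolding Im_inverse using Im_pos[OF that] nz[OF that] by (simp add: divide_neg_pos)
    obtain C where C: "\<And>z. 0 < Im z \<Longrightarrow> norm (chordal_f s t z - z) \<le> C / Im z"
      using chordal_f_near_id[OF t] by blast
    have "(\<lambda>n. chordal_f s t (\<i> * of_nat n) / (\<i> * of_nat n) - 1) \<longlonglongrightarrow> 0"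
    proof (rule Lim_null_comparison)
      show "\<forall>\<^sub>F n in sequentially. norm (chordal_f s t (\<i> * of_nat n) / (\<i> * of_nat n) - 1) \<le> C / real n / real n"
        using eventually_gt_at_top[of 0]
      proof eventually_elim
        case (elim n)
        have "chordal_f s t (\<i> * of_nat n) / (\<i> * of_nat n) - 1 = (chordal_f s t (\<i> * of_nat n) - \<i> * of_nat n) / (\<i> * of_nat n)"
          using elim by (simp add: diff_divide_distrib)
        then have "norm (chordal_f s t (\<i> * of_nat n) / (\<i> * of_nat n) - 1) = norm (chordal_f s t (\<i> * of_nat n) - \<i> * of_nat n) / real n"
          by (simp add: norm_divide norm_mult)
        also have "\<dots> \<le> C / real n / real n"
          using C[of "\<i> * of_nat n"] elim by (intro divide_right_mono) auto
        finally show ?case .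
      qed
      show "(\<lambda>n. C / real n / real n) \<longlonglongrightarrow> 0" by real_asymp
    qed
    from tendsto_add[OF this tendsto_const[of 1]]
    have "(\<lambda>n. chordal_f s t (\<i> * of_nat n) / (\<i> * of_nat n)) \<longlonglongrightarrow> 1" by simp
    from tendsto_divide[OF tendsto_const[of 1] this]
    show "(\<lambda>n. \<i> * of_nat n * (1 / chordal_f s t (\<i> * of_nat n))) \<longlonglongrightarrow> 1" by simp
  next
    fix \<nu> assume "\<nu> \<in> prob_measures_on UNIV" "\<And>z. 0 < Im z \<Longrightarrow> 1 / chordal_f s t z = cauchy_transform \<nu> z"
    then show thesis by (rule that)
  qed
  then show "\<exists>\<nu>. chordal_measure s t \<nu>" unfolding chordal_measure_def by auto
  fix \<mu> \<nu> assume "chordal_measure s t \<mu>" "chordal_measure s t \<nu>"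
  then show "\<mu> = \<nu>" unfolding chordal_measure_def by (intro cauchy_transform_injective) auto
qed

lemma CL_chordal_measure: "0 \<le> t \<Longrightarrow> chordal_measure s t (CL s t)"
  unfolding CL_def by (rule theI'[OF chordal_measure_unique_existence])

lemma CL_prob: "0 \<le> t \<Longrightarrow> CL s t \<in> prob_measures_on UNIV"
  using CL_chordal_measure unfolding chordal_measure_def by blast

lemma CL_cauchy_transform: "0 \<le> t \<Longrightarrow> 0 < Im z \<Longrightarrow> cauchy_transform (CL s t) z = 1 / chordal_f s t z"
  using CL_chordal_measure[of t] unfolding chordal_measure_def by simp

lemma CL_eqI:
  assumes "0 \<le> t" "\<nu> \<in> prob_measures_on UNIV" "\<And>z. 0 < Im z \<Longrightarrow> cauchy_transform \<nu> z = 1 / chordal_f s t z"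
  shows "CL s t = \<nu>"
  by (rule cauchy_transform_injective[OF CL_prob[OF assms(1)] assms(2)])
    (simp add: CL_cauchy_transform[OF assms(1)] assms(3))

lemma CL_path:
  assumes "\<And>t. 0 \<le> t \<Longrightarrow> CL s t \<in> A"
  shows "CL s \<in> paths UNIV A"
  unfolding paths_iff
proof (intro conjI allI impI)
  show "CL s t \<in> A" if "0 \<le> t" for t using assms[OF that] .
  fix \<phi> :: "real \<Rightarrow> real" assume \<phi>: "continuous_on UNIV \<phi> \<and> bounded (range \<phi>)"
  then obtain C where C: "\<And>x. \<bar>\<phi> x\<bar> \<le> C" unfolding bounded_iff by auto
  show "continuous_on {0..} (\<lambda>t. LINT x|CL s t. \<phi> x)"
    unfolding continuous_on_sequentially
  proof (intro allI ballI impI)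
    fix X and t :: real assume "t \<in> {0..}" and X: "(\<forall>n. X n \<in> {0..}) \<and> X \<longlonglongrightarrow> t"
    then have t: "0 \<le> t" and X': "\<And>n. 0 \<le> X n" by auto
    have "(\<lambda>n. LINT x|CL s (X n). \<phi> x) \<longlonglongrightarrow> (LINT x|CL s t. \<phi> x)"
    proof (rule line_weak_convergence[where C = C])
      show "CL s (X n) \<in> prob_measures_on UNIV" for n by (rule CL_prob[OF X'])
      show "CL s t \<in> prob_measures_on UNIV" by (rule CL_prob[OF t])
      show "continuous_on UNIV \<phi>" using \<phi> by simp
      show "\<And>x. \<bar>\<phi> x\<bar> \<le> C" by (rule C)
      fix z :: complex assume z: "0 < Im z"
      have "(\<lambda>n. chordal_f s (X n) z) \<longlonglongrightarrow> chordal_f s t z"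
        using chordal_f_continuous[OF order_refl z, unfolded continuous_on_sequentially] t X by (auto simp: o_def)
      moreover have "chordal_f s t z \<noteq> 0" using chordal_f_Im[OF t z] z by auto
      ultimately show "(\<lambda>n. cauchy_transform (CL s (X n)) z) \<longlonglongrightarrow> cauchy_transform (CL s t) z"
        unfolding CL_cauchy_transform[OF X' z] CL_cauchy_transform[OF t z] by (intro tendsto_intros)
    qed
    then show "((\<lambda>t. LINT x|CL s t. \<phi> x) \<circ> X) \<longlonglongrightarrow> (LINT x|CL s t. \<phi> x)" by (simp add: o_def)
  qed
qed

lemma CL_0: "CL s 0 = return borel 0"
  by (rule CL_eqI[OF order_refl return_prob]) (simp add: return_cauchy_transform chordal_f_time_0[OF order_refl])

text \<open>At distance at least 1 from the supports the velocity is bounded by the mass \<open>M\<close>. A trajectory that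
  is further away than \<open>M * t\<close> from the disc of radius \<open>R + 1\<close> at time \<open>t\<close> has therefore been outside of this
  disc all the time. There \<open>Im G\<close> is at most \<open>M * Im h\<close> in modulus, so the imaginary part changes by a
  factor of at most \<open>exp (M * t)\<close>.\<close>

lemma chordal_solution_far:
  assumes M: "\<And>t. 0 \<le> t \<Longrightarrow> measure (s t) UNIV \<le> M" "0 < M"
    and supp: "\<And>\<tau>. \<tau> \<in> {0..t} \<Longrightarrow> AE x in s \<tau>. \<bar>x\<bar> \<le> R" and t: "0 \<le> t"
    and h: "t < T" "flow_solution {w. 0 < Im w} (\<lambda>t. cauchy_transform (s t)) \<zeta> T h"
    and far: "R + 1 + M * t < norm (h t)"
  shows "R + 1 < norm \<zeta>" "Im \<zeta> \<le> Im (h t) * exp (M * t)"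
proof -
  have h0: "h 0 = \<zeta>" and h_pos: "\<And>\<tau>. \<tau> \<in> {0..<T} \<Longrightarrow> 0 < Im (h \<tau>)"
    using h(2) unfolding flow_solution_def by auto
  have h_deriv: "(h has_vector_derivative cauchy_transform (s \<tau>) (h \<tau>)) (at \<tau> within {0..t})" if "\<tau> \<in> {0..t}" for \<tau>
  proof -
    have "(h has_vector_derivative cauchy_transform (s \<tau>) (h \<tau>)) (at \<tau> within {0..<T})"
      using h that unfolding flow_solution_def by auto
    then show ?thesis by (rule has_vector_derivative_within_subset) (use h(1) in auto)
  qed
  have h_cont: "continuous_on {0..t} h"
    unfolding continuous_on_eq_continuous_within using has_vector_derivative_continuous[OF h_deriv] by blast
  have fin: "s \<tau> \<in> finite_measures_on UNIV" if "0 \<le> \<tau>" for \<tau> by (rule chordal_finite[OF s M(1) that])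
  have dist1: "1 \<le> norm (w - complex_of_real x)" if "R + 1 < norm w" "\<bar>x\<bar> \<le> R" for w x
    using norm_triangle_ineq2[of w "complex_of_real x"] that by simp
  have V_le: "norm (cauchy_transform (s \<tau>) w) \<le> M" if "\<tau> \<in> {0..t}" "R + 1 < norm w" "0 < Im w" for \<tau> w
  proof -
    interpret finite_measure "s \<tau>" using fin[of \<tau>] finite_measures_onD(1) that(1) by auto
    have "norm (cauchy_transform (s \<tau>) w) \<le> (LINT x|s \<tau>. norm (1 / (w - complex_of_real x)))"
      unfolding cauchy_transform_def by (rule integral_norm_bound)
    also have "\<dots> \<le> (LINT x|s \<tau>. 1)"
    proof (rule integral_mono_AE)
      show "integrable (s \<tau>) (\<lambda>x. norm (1 / (w - complex_of_real x)))"
        using resolvent_integrable[OF fin that(3), of \<tau>] that(1) by (intro integrable_norm) auto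
      show "AE x in s \<tau>. norm (1 / (w - complex_of_real x)) \<le> 1"
        using supp[OF that(1)]
      proof eventually_elim
        case (elim x)
        then show ?case using dist1[OF that(2), of x] by (simp add: norm_divide divide_le_eq_1)
      qed
    qed simp
    also have "\<dots> \<le> M" using M(1)[of \<tau>] that(1) finite_measures_onD(3)[OF fin[of \<tau>]] by simp
    finally show ?thesis .
  qed
  have away: "R + 1 < norm (h \<tau>)" if \<tau>: "\<tau> \<in> {0..t}" for \<tau>
  proof (rule ccontr)
    assume "\<not> R + 1 < norm (h \<tau>)"
    then have ne: "{\<sigma> \<in> {0..t}. norm (h \<sigma>) \<le> R + 1} \<noteq> {}" using \<tau> by auto
    have "closedin (top_of_set {0..t}) ({0..t} \<inter> (\<lambda>\<sigma>. norm (h \<sigma>)) -` {..R + 1})"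
      by (rule continuous_closedin_preimage[OF continuous_on_norm[OF h_cont] closed_atMost])
    then have "compact ({0..t} \<inter> (\<lambda>\<sigma>. norm (h \<sigma>)) -` {..R + 1})"
      by (rule closedin_compact[OF compact_Icc])
    moreover have "{0..t} \<inter> (\<lambda>\<sigma>. norm (h \<sigma>)) -` {..R + 1} = {\<sigma> \<in> {0..t}. norm (h \<sigma>) \<le> R + 1}" by auto
    ultimately have "compact {\<sigma> \<in> {0..t}. norm (h \<sigma>) \<le> R + 1}" by simp
    \<comment> \<open>The last time \<open>\<sigma>\<close> in the disc: from \<open>\<sigma>\<close> to \<open>t\<close> the speed is at most \<open>M\<close>.\<close>
    from compact_attains_sup[OF this ne] obtain \<sigma> where \<sigma>: "\<sigma> \<in> {0..t}" "norm (h \<sigma>) \<le> R + 1"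
      and last: "\<And>r. r \<in> {0..t} \<Longrightarrow> norm (h r) \<le> R + 1 \<Longrightarrow> r \<le> \<sigma>" by blast
    have "0 \<le> M * t" using M(2) t by simp
    then have "\<sigma> < t" using \<sigma> far by (cases "\<sigma> = t") auto
    have "norm (h t - h \<sigma>) \<le> M * t - M * \<sigma>"
    proof (rule differentiable_bound_general[OF \<open>\<sigma> < t\<close>])
      show "continuous_on {\<sigma>..t} h" by (rule continuous_on_subset[OF h_cont]) (use \<sigma> in auto)
      show "continuous_on {\<sigma>..t} (\<lambda>r. M * r)" by (intro continuous_intros)
      fix r assume r: "\<sigma> < r" "r < t"
      then have r': "r \<in> {0..t}" "r \<in> interior {0..t}" using \<sigma> by auto
      show "(h has_vector_derivative cauchy_transform (s r) (h r)) (at r)"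
        using h_deriv[OF r'(1)] unfolding at_within_interior[OF r'(2)] .
      have "((\<lambda>r. M * r) has_real_derivative M) (at r)" by (auto intro!: derivative_eq_intros)
      then show "((\<lambda>r. M * r) has_vector_derivative M) (at r)"
        by (simp add: has_real_derivative_iff_has_vector_derivative)
      have "R + 1 < norm (h r)" using last[OF r'(1)] r by force
      then show "norm (cauchy_transform (s r) (h r)) \<le> M" using V_le[OF r'(1)] h_pos[of r] r' h(1) by auto
    qed
    moreover have "0 \<le> M * \<sigma>" using M(2) \<sigma> by simp
    ultimately have "norm (h t) \<le> norm (h \<sigma>) + M * t"
      using norm_triangle_ineq2[of "h t" "h \<sigma>"] by linarith
    then show False using \<sigma>(2) far by simp
  qed
  show "R + 1 < norm \<zeta>" using away[of 0] t h0 by simp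
  have "Im (h 0) * exp (M * 0) \<le> Im (h t) * exp (M * t)"
  proof (rule has_vector_derivative_monotone_on[OF t])
    fix \<tau> assume \<tau>: "\<tau> \<in> {0..t}"
    define G where "G = cauchy_transform (s \<tau>) (h \<tau>)"
    have 1: "((\<lambda>\<tau>. Im (h \<tau>)) has_vector_derivative Im G) (at \<tau> within {0..t})"
      unfolding G_def by (rule bounded_linear.has_vector_derivative[OF bounded_linear_Im h_deriv[OF \<tau>]])
    have "((\<lambda>\<tau>. M * \<tau>) has_real_derivative M) (at \<tau>)" by (auto intro!: derivative_eq_intros)
    from DERIV_fun_exp[OF this]
    have "((\<lambda>\<tau>. exp (M * \<tau>)) has_vector_derivative exp (M * \<tau>) * M) (at \<tau>)"
      by (simp only: has_real_derivative_iff_has_vector_derivative)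
    then have 2: "((\<lambda>\<tau>. exp (M * \<tau>)) has_vector_derivative exp (M * \<tau>) * M) (at \<tau> within {0..t})"
      by (rule has_vector_derivative_at_within)
    show "((\<lambda>\<tau>. Im (h \<tau>) * exp (M * \<tau>)) has_vector_derivative
        Im (h \<tau>) * (exp (M * \<tau>) * M) + Im G * exp (M * \<tau>)) (at \<tau> within {0..t})"
      by (rule has_vector_derivative_mult[OF 1 2])
    have pos: "0 < Im (h \<tau>)" using h_pos \<tau> h(1) by auto
    have "(LINT x|s \<tau>. 1 / (norm (h \<tau> - complex_of_real x))\<^sup>2) \<le> M"
    proof -
      interpret finite_measure "s \<tau>" using fin[of \<tau>] finite_measures_onD(1) \<tau> by auto
      have "(LINT x|s \<tau>. 1 / (norm (h \<tau> - complex_of_real x))\<^sup>2) \<le> (LINT x|s \<tau>. 1)"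
      proof (rule integral_mono_AE)
        have \<tau>0: "0 \<le> \<tau>" using \<tau> by simp
        have "integrable (s \<tau>) (\<lambda>x. (- 1 / Im (h \<tau>)) * Im (1 / (h \<tau> - complex_of_real x)))"
          by (intro integrable_mult_right integrable_Im resolvent_integrable[OF fin[OF \<tau>0] pos])
        moreover have "(- 1 / Im (h \<tau>)) * Im (1 / (h \<tau> - complex_of_real x)) = 1 / (norm (h \<tau> - complex_of_real x))\<^sup>2" for x
          unfolding Im_resolvent using pos by simp
        ultimately show "integrable (s \<tau>) (\<lambda>x. 1 / (norm (h \<tau> - complex_of_real x))\<^sup>2)"
          by (simp only:)
        show "AE x in s \<tau>. 1 / (norm (h \<tau> - complex_of_real x))\<^sup>2 \<le> 1"
          using supp[OF \<tau>]
        proof eventually_elim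
          case (elim x)
          then show ?case using power_mono[OF dist1[OF away[OF \<tau>], of x], of 2] by (simp add: divide_le_eq_1)
        qed
      qed simp
      also have "\<dots> \<le> M" using M(1)[of \<tau>] \<tau> finite_measures_onD(3)[OF fin[of \<tau>]] by simp
      finally show ?thesis .
    qed
    moreover have "Im G = - Im (h \<tau>) * (LINT x|s \<tau>. 1 / (norm (h \<tau> - complex_of_real x))\<^sup>2)"
      unfolding G_def by (rule Im_cauchy_transform[OF s _ _ pos]) (use M \<tau> in auto)
    ultimately have "0 \<le> Im (h \<tau>) * M + Im G"
      using mult_left_mono[of "LINT x|s \<tau>. 1 / (norm (h \<tau> - complex_of_real x))\<^sup>2" M "Im (h \<tau>)"] pos by simp
    then have "0 \<le> (Im (h \<tau>) * M + Im G) * exp (M * \<tau>)" by simp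
    then show "0 \<le> Im (h \<tau>) * (exp (M * \<tau>) * M) + Im G * exp (M * \<tau>)" by (simp add: algebra_simps)
  qed
  then show "Im \<zeta> \<le> Im (h t) * exp (M * t)" using h0 by simp
qed

text \<open>Far from the supports, \<open>- Im (1 / f\<^sub>t) = Im f\<^sub>t / \<bar>f\<^sub>t\<bar>\<^sup>2\<close> is at most \<open>exp (M * t) * y\<close> at height \<open>y\<close>. The
  Poisson kernel then gives the measure of intervals of radius \<open>y\<close> a bound of order \<open>y\<^sup>2\<close>, so there is no mass.\<close>

lemma CL_support_bounded:
  assumes supp: "locally_bounded_support s" and t: "0 \<le> t"
  shows "bounded (msupport (CL s t))"
proof -
  obtain M where M: "0 < M" "\<And>t. 0 \<le> t \<Longrightarrow> measure (s t) UNIV \<le> M" using chordal_mass by blast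
  have "bounded (\<Union>\<tau>\<in>{0..t}. msupport (s \<tau>))" using supp unfolding locally_bounded_support_def by blast
  then obtain R' where bnd: "\<forall>x\<in>(\<Union>\<tau>\<in>{0..t}. msupport (s \<tau>)). norm x \<le> R'" unfolding bounded_iff by blast
  have R': "\<bar>x\<bar> \<le> R'" if "\<tau> \<in> {0..t}" "x \<in> msupport (s \<tau>)" for x \<tau> using bnd that by auto
  define R where "R = max R' 0"
  have R: "0 \<le> R" "\<And>\<tau>. \<tau> \<in> {0..t} \<Longrightarrow> AE x in s \<tau>. \<bar>x\<bar> \<le> R"
  proof -
    show "0 \<le> R" unfolding R_def by simp
    fix \<tau> assume \<tau>: "\<tau> \<in> {0..t}"
    have "msupport (s \<tau>) \<subseteq> {-R..R}"
    proof
      fix x assume "x \<in> msupport (s \<tau>)"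
      from R'[OF \<tau> this] have "\<bar>x\<bar> \<le> R" unfolding R_def by simp
      then show "x \<in> {-R..R}" by auto
    qed
    then show "AE x in s \<tau>. \<bar>x\<bar> \<le> R" using null_outside_support[OF chordal_finite[OF s M(2)]] \<tau> by auto
  qed
  define R2 where "R2 = R + 1 + M * t"
  define \<nu> where "\<nu> = CL s t"
  have \<nu>: "\<nu> \<in> prob_measures_on UNIV" unfolding \<nu>_def by (rule CL_prob[OF t])
  have bound: "measure \<nu> {x - y<..<x + y} \<le> 2 * exp (M * t) * y\<^sup>2" if x: "R2 < \<bar>x\<bar>" and y: "0 < y" for x y
  proof (rule poisson_interval_bound[OF \<nu> y])
    define z where "z = Complex x y"
    have z: "0 < Im z" unfolding z_def using y by simp
    obtain h T where h: "t < T" "flow_solution {w. 0 < Im w} (\<lambda>t. cauchy_transform (s t)) (chordal_f s t z) T h" "h t = z"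
      using chordal_f_solution[OF t z] by blast
    have "\<bar>x\<bar> \<le> norm z" using abs_Re_le_cmod[of z] unfolding z_def by simp
    then have far: "R + 1 + M * t < norm (h t)" using x unfolding h(3) R2_def by simp
    note est = chordal_solution_far[OF M(2,1) R(2) t h(1,2) far]
    define n where "n = (norm (chordal_f s t z))\<^sup>2"
    have one: "1 \<le> n" unfolding n_def using est(1) R(1) by (intro one_le_power) linarith
    have "0 \<le> Im (chordal_f s t z)" using chordal_f_Im[OF t z] z by linarith
    then have "Im (chordal_f s t z) * 1 \<le> Im (chordal_f s t z) * n" using one by (rule mult_left_mono[rotated])
    then have "Im (chordal_f s t z) / n \<le> Im (chordal_f s t z)" using one by (simp add: divide_le_eq)
    also have "\<dots> \<le> exp (M * t) * y" using est(2) unfolding h(3) by (simp add: z_def mult.commute)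
    finally show "- Im (cauchy_transform \<nu> (Complex x y)) \<le> exp (M * t) * y"
      unfolding \<nu>_def z_def[symmetric] CL_cauchy_transform[OF t z] Im_inverse n_def by simp
  qed
  have "\<bar>x\<bar> \<le> R2" if "x \<in> msupport \<nu>" for x
  proof (rule ccontr)
    assume "\<not> \<bar>x\<bar> \<le> R2"
    then have x: "R2 < \<bar>x\<bar>" by simp
    define d where "d = (\<bar>x\<bar> - R2) / 2"
    have d: "0 < d" using x unfolding d_def by simp
    have R2: "0 \<le> R2" unfolding R2_def using R(1) M(1) t by simp
    have "measure \<nu> {x - d<..x + d} = 0"
    proof (cases "0 < x")
      case True
      show ?thesis
      proof (rule null_of_quadratic_bound[OF \<nu>, of "{R2<..}"])
        show "measure \<nu> {x - y<..<x + y} \<le> 2 * exp (M * t) * y\<^sup>2" if "x \<in> {R2<..}" "0 < y" for x y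
          using that R2 by (intro bound) auto
        show "x - d \<in> {R2<..}" "x + d \<in> {R2<..}" using True x d unfolding d_def by (auto simp: field_simps)
      qed (use d in auto)
    next
      case False
      show ?thesis
      proof (rule null_of_quadratic_bound[OF \<nu>, of "{..<-R2}"])
        show "measure \<nu> {x - y<..<x + y} \<le> 2 * exp (M * t) * y\<^sup>2" if "x \<in> {..<-R2}" "0 < y" for x y
          using that R2 by (intro bound) auto
        show "x - d \<in> {..<-R2}" "x + d \<in> {..<-R2}" using False x d unfolding d_def by (auto simp: field_simps)
      qed (use d in auto)
    qed
    moreover interpret prob_space \<nu> by (rule prob_measures_onD(2)[OF \<nu>])
    have "measure \<nu> {x - d<..<x + d} \<le> measure \<nu> {x - d<..x + d}"
      using finite_measures_onD(2)[OF prob_measures_onD(1)[OF \<nu>]] by (intro finite_measure_mono) auto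
    ultimately have "measure \<nu> {x - d<..<x + d} = 0" using measure_nonneg[of \<nu> "{x - d<..<x + d}"] by linarith
    then have "emeasure \<nu> {x - d<..<x + d} = 0" by (simp add: emeasure_eq_measure)
    moreover have "open {x - d<..<x + d}" "x \<in> {x - d<..<x + d}" using d by auto
    ultimately show False using that unfolding msupport_def by blast
  qed
  then show ?thesis unfolding \<nu>_def bounded_iff by (auto simp: real_norm_def)
qed

lemma CL_M01:
  assumes "locally_bounded_support s" "0 \<le> t"
  shows "CL s t \<in> M01_real"
proof -
  note p = prob_measures_onD[OF CL_prob[OF assms(2)]]
  have "emeasure (CL s t) UNIV = 1"
    using prob_space.emeasure_space_1[OF p(2)] unfolding finite_measures_onD(3)[OF p(1)] .
  then show ?thesis unfolding M01_real_def M0_real_def using p CL_support_bounded[OF assms] by simp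
qed

end

section \<open>The semicircle law\<close>

text \<open>The density vanishes at the two endpoints, so the interval may be closed.\<close>

lemma semicircle_law_density:
  assumes t: "0 < t"
  shows "semicircle_law t = density lborel (\<lambda>x. ennreal (indicator {- 2 * sqrt t..2 * sqrt t} x * (sqrt (4 * t - x\<^sup>2) / (2 * pi * t))))"
proof -
  have closed: "indicator {- 2 * sqrt t <..< 2 * sqrt t} x * (sqrt (4 * t - x\<^sup>2) / (2 * pi * t))
      = indicator {- 2 * sqrt t..2 * sqrt t} x * (sqrt (4 * t - x\<^sup>2) / (2 * pi * t))" for x :: real
  proof (cases "x = 2 * sqrt t \<or> x = - 2 * sqrt t")
    case True
    then have "x\<^sup>2 = 4 * t" using t by (auto simp: power_mult_distrib)
    then show ?thesis by simp
  qed (auto simp: indicator_def)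
  have "semicircle_law t = density lborel (\<lambda>x. ennreal (indicator {- 2 * sqrt t <..< 2 * sqrt t} x * (sqrt (4 * t - x\<^sup>2) / (2 * pi * t))))"
    unfolding semicircle_law_def using t by simp
  then show ?thesis unfolding closed .
qed

text \<open>The substitution \<open>x = 2 sqrt t cos \<theta>\<close> runs through the interval twice as \<open>\<theta>\<close> runs once around the circle, and
  turns the semicircle density into \<open>2 sin\<^sup>2 \<theta>\<close>. Unlike the density, this weight and the argument of \<open>f\<close> depend
  continuously on \<open>t\<close> up to \<open>t = 0\<close>.\<close>

lemma semicircle_substitution:
  fixes f :: "real \<Rightarrow> 'a::euclidean_space"
  assumes t: "0 < t" and f: "continuous_on UNIV f"
  shows "((\<lambda>x. (2 * (sin (2 * pi * x))\<^sup>2) *\<^sub>R f (2 * sqrt t * cos (2 * pi * x))) has_integral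
    (integral {- 2 * sqrt t..2 * sqrt t} (\<lambda>x. (sqrt (4 * t - x\<^sup>2) / (2 * pi * t)) *\<^sub>R f x))) {0..1}"
proof -
  define r where "r = sqrt t"
  have r: "0 < r" "r\<^sup>2 = t" unfolding r_def using t by auto
  define F where "F x = (sqrt (4 * t - x\<^sup>2) / (2 * pi * t)) *\<^sub>R f x" for x
  define g where "g x = 2 * r * cos (2 * pi * x)" for x
  define g' where "g' x = - (2 * r) * (2 * pi * sin (2 * pi * x))" for x
  have F_cont: "continuous_on {- 2 * r..2 * r} F"
    unfolding F_def using t by (intro continuous_intros continuous_on_subset[OF f]) auto
  have g_range: "g ` A \<subseteq> {- 2 * r..2 * r}" for A
  proof (rule image_subsetI)
    fix x
    have "\<bar>2 * r * cos (2 * pi * x)\<bar> \<le> 2 * r * 1" unfolding abs_mult using r by (intro mult_mono) auto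
    then show "g x \<in> {- 2 * r..2 * r}" unfolding g_def by auto
  qed
  have g_deriv: "(g has_field_derivative g' x) (at x within A)" for x A
    unfolding g_def g'_def by (auto intro!: derivative_eq_intros)
  have root: "sqrt (4 * t - (g x)\<^sup>2) = 2 * r * \<bar>sin (2 * pi * x)\<bar>" for x
  proof -
    have "4 * t - (g x)\<^sup>2 = (2 * r * sin (2 * pi * x))\<^sup>2"
      unfolding g_def r(2)[symmetric] using sin_cos_squared_add[of "2 * pi * x"]
      by (simp add: power_mult_distrib algebra_simps flip: distrib_left)
    then show ?thesis using r by (simp add: abs_mult)
  qed
  have weight: "g' x *\<^sub>R F (g x) = - ((4 * sin (2 * pi * x) * \<bar>sin (2 * pi * x)\<bar>) *\<^sub>R f (g x))" for x
  proof -
    have "- (2 * r) * (2 * pi * a) * (2 * r * b / (2 * pi * t)) = - (4 * a * b)" for a b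
      using r by (simp add: r(2)[symmetric] power2_eq_square field_simps)
    then show ?thesis unfolding F_def root g'_def scaleR_scaleR by (simp only: scaleR_minus_left)
  qed
  define I where "I = integral {- 2 * r..2 * r} F"
  have h1: "((\<lambda>x. g' x *\<^sub>R F (g x)) has_integral (integral {g 0..g (1/2)} F - integral {g (1/2)..g 0} F)) {0..1/2}"
    using continuous_on_subset[OF F_cont] g_deriv
    by (intro has_integral_substitution_general[of "{}", OF _ _ g_range F_cont])
      (auto simp: g_def intro!: continuous_intros)
  have v1: "integral {g 0..g (1/2)} F - integral {g (1/2)..g 0} F = - I"
    unfolding g_def I_def using r by simp
  have "((\<lambda>x. - (g' x *\<^sub>R F (g x))) has_integral I) {0..1/2}"
    using has_integral_neg[OF h1] unfolding v1 minus_minus .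
  then have first: "((\<lambda>x. (4 * (sin (2 * pi * x))\<^sup>2) *\<^sub>R f (g x)) has_integral I) {0..1/2}"
  proof (rule has_integral_eq[rotated])
    fix x :: real assume "x \<in> {0..1/2}"
    then have "0 \<le> sin (2 * pi * x)" by (intro sin_ge_zero) auto
    then show "- (g' x *\<^sub>R F (g x)) = (4 * (sin (2 * pi * x))\<^sup>2) *\<^sub>R f (g x)"
      unfolding weight by (simp add: power2_eq_square)
  qed
  have "((\<lambda>x. g' x *\<^sub>R F (g x)) has_integral (integral {g (1/2)..g 1} F - integral {g 1..g (1/2)} F)) {1/2..1}"
    using g_deriv
    by (intro has_integral_substitution_general[of "{}", OF _ _ g_range F_cont])
      (auto simp: g_def intro!: continuous_intros)
  moreover have "integral {g (1/2)..g 1} F - integral {g 1..g (1/2)} F = I"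
    unfolding g_def I_def using r by simp
  ultimately have "((\<lambda>x. g' x *\<^sub>R F (g x)) has_integral I) {1/2..1}" by simp
  then have second: "((\<lambda>x. (4 * (sin (2 * pi * x))\<^sup>2) *\<^sub>R f (g x)) has_integral I) {1/2..1}"
  proof (rule has_integral_eq[rotated])
    fix x :: real assume x: "x \<in> {1/2..1}"
    have "sin (2 * pi * x) = - sin (2 * pi * x - pi)" by (simp add: sin_diff)
    moreover have "0 \<le> sin (2 * pi * x - pi)" using x by (intro sin_ge_zero) auto
    ultimately have "\<bar>sin (2 * pi * x)\<bar> = - sin (2 * pi * x)" by simp
    then show "g' x *\<^sub>R F (g x) = (4 * (sin (2 * pi * x))\<^sup>2) *\<^sub>R f (g x)"
      unfolding weight by (simp add: power2_eq_square)
  qed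
  have "((\<lambda>x. (4 * (sin (2 * pi * x))\<^sup>2) *\<^sub>R f (g x)) has_integral I + I) {0..1}"
    by (rule has_integral_combine[OF _ _ first second]) auto
  from has_integral_cmul[OF this, of "1/2"]
  have "((\<lambda>x. (2 * (sin (2 * pi * x))\<^sup>2) *\<^sub>R f (g x)) has_integral (1/2) *\<^sub>R (I + I)) {0..1}" by simp
  moreover have "(1/2) *\<^sub>R (I + I) = I" by (simp flip: scaleR_2)
  ultimately show ?thesis unfolding I_def F_def g_def r_def by simp
qed

text \<open>With \<open>u = cis \<theta>\<close>, \<open>2 sin\<^sup>2 \<theta> = 1 - u\<^sup>2 / 2 - (cnj u)\<^sup>2 / 2\<close>. Subtracting \<open>((cnj u)\<^sup>2 + w cnj u) / 2\<close>, which has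
  mean 0, from the quotient leaves the boundary values of the holomorphic function
  \<open>(1 - u\<^sup>2 / 2 - w\<^sup>2 / 2) / (1 - w u)\<close>, whose mean is the value at 0.\<close>

lemma sine_square_resolvent_mean:
  assumes w: "norm w < 1"
  shows "((\<lambda>x. of_real (2 * (sin (2 * pi * x))\<^sup>2) / (1 - w * cis (2 * pi * x))) has_integral 1 - w\<^sup>2 / 2) {0..1}"
proof -
  define e where "e x = cis (2 * pi * x)" for x
  have nz: "1 - w * u \<noteq> 0" if "norm u \<le> 1" for u
  proof
    assume "1 - w * u = 0"
    then have "w * u = 1" by simp
    then have "norm (w * u) = 1" by (simp only: norm_one)
    moreover have "norm w * norm u \<le> norm w * 1" using that by (intro mult_left_mono) auto
    ultimately show False using w by (simp add: norm_mult)
  qed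
  have "((\<lambda>x. (1 - (e x)\<^sup>2 / 2 - w\<^sup>2 / 2) / (1 - w * e x)) has_integral (1 - 0\<^sup>2 / 2 - w\<^sup>2 / 2) / (1 - w * 0)) {0..1}"
    unfolding e_def
  proof (rule circle_mean)
    show "continuous_on (cball 0 1) (\<lambda>u. (1 - u\<^sup>2 / 2 - w\<^sup>2 / 2) / (1 - w * u))"
      by (intro continuous_intros) (use nz in auto)
    show "(\<lambda>u. (1 - u\<^sup>2 / 2 - w\<^sup>2 / 2) / (1 - w * u)) holomorphic_on ball 0 1"
      by (intro holomorphic_intros) (use nz in auto)
  qed
  moreover have "((cnj \<circ> (\<lambda>x. ((e x)\<^sup>2 + cnj w * e x) / 2)) has_integral cnj ((0\<^sup>2 + cnj w * 0) / 2)) {0..1}"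
    unfolding has_integral_cnj unfolding e_def
  proof (rule circle_mean)
    show "continuous_on (cball 0 1) (\<lambda>u. (u\<^sup>2 + cnj w * u) / 2)" by (intro continuous_intros) auto
    show "(\<lambda>u. (u\<^sup>2 + cnj w * u) / 2) holomorphic_on ball 0 1" by (intro holomorphic_intros) auto
  qed
  ultimately have "((\<lambda>x. (1 - (e x)\<^sup>2 / 2 - w\<^sup>2 / 2) / (1 - w * e x) - (cnj \<circ> (\<lambda>x. ((e x)\<^sup>2 + cnj w * e x) / 2)) x)
      has_integral (1 - 0\<^sup>2 / 2 - w\<^sup>2 / 2) / (1 - w * 0) - cnj ((0\<^sup>2 + cnj w * 0) / 2)) {0..1}"
    by (rule has_integral_diff)
  then have "((\<lambda>x. of_real (2 * (sin (2 * pi * x))\<^sup>2) / (1 - w * e x)) has_integral (1 - 0\<^sup>2 / 2 - w\<^sup>2 / 2) / (1 - w * 0) - cnj ((0\<^sup>2 + cnj w * 0) / 2)) {0..1}"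
  proof (rule has_integral_eq[rotated])
    fix x :: real
    define u where "u = e x"
    have c: "u * cnj u = 1" unfolding u_def e_def by (simp add: cis_cnj cis_mult)
    have ne: "1 - w * u \<noteq> 0" by (rule nz) (simp add: u_def e_def)
    have "complex_of_real (sin (2 * pi * x)) = (u - cnj u) / (2 * \<i>)"
      unfolding u_def e_def by (simp add: complex_eq_iff)
    then have "complex_of_real (2 * (sin (2 * pi * x))\<^sup>2) = 2 * ((u - cnj u) / (2 * \<i>))\<^sup>2" by simp
    also have "\<dots> = 1 - u\<^sup>2 / 2 - (cnj u)\<^sup>2 / 2"
      using c by (simp add: power2_eq_square field_simps)
    finally have s: "complex_of_real (2 * (sin (2 * pi * x))\<^sup>2) = 1 - u\<^sup>2 / 2 - (cnj u)\<^sup>2 / 2" .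
    have "w * cnj u * (w * u) = w\<^sup>2 * (u * cnj u)" "(cnj u)\<^sup>2 * (w * u) = w * cnj u * (u * cnj u)"
      by (simp_all add: power2_eq_square mult_ac)
    then have uw: "w * cnj u * (w * u) = w\<^sup>2" "(cnj u)\<^sup>2 * (w * u) = w * cnj u" unfolding c by simp_all
    have "((cnj u)\<^sup>2 + w * cnj u) / 2 * (1 - w * u)
        = ((cnj u)\<^sup>2 + w * cnj u - ((cnj u)\<^sup>2 * (w * u) + w * cnj u * (w * u))) / 2"
      by (simp add: algebra_simps)
    then have "((cnj u)\<^sup>2 + w * cnj u) / 2 * (1 - w * u) = (cnj u)\<^sup>2 / 2 - w\<^sup>2 / 2"
      unfolding uw by (simp add: diff_divide_distrib)
    then have "((cnj u)\<^sup>2 + w * cnj u) / 2 = ((cnj u)\<^sup>2 / 2 - w\<^sup>2 / 2) / (1 - w * u)"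
      using ne by (simp add: nonzero_eq_divide_eq)
    moreover have "(cnj \<circ> (\<lambda>x. ((e x)\<^sup>2 + cnj w * e x) / 2)) x = ((cnj u)\<^sup>2 + w * cnj u) / 2" by (simp add: u_def)
    moreover have "1 - u\<^sup>2 / 2 - w\<^sup>2 / 2 - ((cnj u)\<^sup>2 / 2 - w\<^sup>2 / 2) = 1 - u\<^sup>2 / 2 - (cnj u)\<^sup>2 / 2" by simp
    ultimately show "(1 - (e x)\<^sup>2 / 2 - w\<^sup>2 / 2) / (1 - w * e x) - (cnj \<circ> (\<lambda>x. ((e x)\<^sup>2 + cnj w * e x) / 2)) x
        = of_real (2 * (sin (2 * pi * x))\<^sup>2) / (1 - w * e x)"
      unfolding s u_def[symmetric] by (simp only: diff_divide_distrib[symmetric])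
  qed
  then show ?thesis unfolding e_def by simp
qed

lemma sine_square_mean: "((\<lambda>x. 2 * (sin (2 * pi * x))\<^sup>2) has_integral 1) {0..1}"
  using has_integral_Re[OF sine_square_resolvent_mean[of 0]] by simp

lemma semicircle_prob: "0 \<le> t \<Longrightarrow> semicircle_law t \<in> prob_measures_on UNIV"
proof (cases "t = 0")
  case True
  then show ?thesis using return_prob[of 0] by (simp add: semicircle_law_def)
next
  case False
  assume "0 \<le> t"
  with False have t: "0 < t" by simp
  have "((\<lambda>x. 2 * (sin (2 * pi * x))\<^sup>2) has_integral
      integral {- 2 * sqrt t..2 * sqrt t} (\<lambda>x. sqrt (4 * t - x\<^sup>2) / (2 * pi * t))) {0..1}"
    using semicircle_substitution[OF t continuous_on_const[of UNIV "1::real"]] by simp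
  then have one: "integral {- 2 * sqrt t..2 * sqrt t} (\<lambda>x. sqrt (4 * t - x\<^sup>2) / (2 * pi * t)) = 1"
    using sine_square_mean has_integral_unique by blast
  have "prob_space (semicircle_law t)"
    unfolding semicircle_law_density[OF t]
  proof (rule interval_density_prob[OF _ _ one])
    show "continuous_on {- 2 * sqrt t..2 * sqrt t} (\<lambda>x. sqrt (4 * t - x\<^sup>2) / (2 * pi * t))"
      using t by (intro continuous_intros) auto
    fix x assume "x \<in> {- 2 * sqrt t..2 * sqrt t}"
    then have "\<bar>x\<bar> \<le> 2 * sqrt t" by auto
    from power_mono[OF this, of 2] have "x\<^sup>2 \<le> 4 * t" using t by (simp add: power_mult_distrib)
    then show "0 \<le> sqrt (4 * t - x\<^sup>2) / (2 * pi * t)" using t by simp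
  qed
  moreover have "sets (semicircle_law t) = sets borel" unfolding semicircle_law_density[OF t] by simp
  ultimately show ?thesis
    unfolding prob_measures_on_def finite_measures_on_def using prob_space.finite_measure by auto
qed

lemma semicircle_integral:
  fixes f :: "real \<Rightarrow> 'a::euclidean_space"
  assumes t: "0 \<le> t" and f: "continuous_on UNIV f"
  shows "((\<lambda>x. (2 * (sin (2 * pi * x))\<^sup>2) *\<^sub>R f (2 * sqrt t * cos (2 * pi * x))) has_integral (LINT x|semicircle_law t. f x)) {0..1}"
proof (cases "t = 0")
  case True
  have "(LINT x|semicircle_law t. f x) = f 0"
    unfolding semicircle_law_def using True f by (simp add: integral_return borel_measurable_continuous_onI)
  then show ?thesis using has_integral_scaleR_left[OF sine_square_mean, of "f 0"] True by simp
next
  case False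
  with t have t': "0 < t" by simp
  have "(LINT x|semicircle_law t. f x) = integral {- 2 * sqrt t..2 * sqrt t} (\<lambda>x. (sqrt (4 * t - x\<^sup>2) / (2 * pi * t)) *\<^sub>R f x)"
    unfolding semicircle_law_density[OF t']
  proof (rule interval_density_integral)
    show "continuous_on {- 2 * sqrt t..2 * sqrt t} (\<lambda>x. sqrt (4 * t - x\<^sup>2) / (2 * pi * t))"
      using t' by (intro continuous_intros) auto
    show "f \<in> borel_measurable borel" by (rule borel_measurable_continuous_onI[OF f])
    show "continuous_on {- 2 * sqrt t..2 * sqrt t} f" by (rule continuous_on_subset[OF f]) simp
    fix x assume "x \<in> {- 2 * sqrt t..2 * sqrt t}"
    then have "\<bar>x\<bar> \<le> 2 * sqrt t" by auto
    from power_mono[OF this, of 2] have "x\<^sup>2 \<le> 4 * t" using t' by (simp add: power_mult_distrib)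
    then show "0 \<le> sqrt (4 * t - x\<^sup>2) / (2 * pi * t)" using t' by simp
  qed
  then show ?thesis using semicircle_substitution[OF t' f] by simp
qed

lemma reciprocal_sum_Im:
  assumes "\<xi> \<noteq> 0"
  shows "Im (of_real t * \<xi> + 1 / \<xi>) = - Im \<xi> * (1 / (norm \<xi>)\<^sup>2 - t)"
    and "Re (of_real t * \<xi> + 1 / \<xi>) = Re \<xi> * (1 / (norm \<xi>)\<^sup>2 + t)"
  by (simp_all add: Im_divide Re_divide cmod_power2 algebra_simps)

text \<open>Put \<open>w = sqrt t * \<xi>\<close>. Then \<open>\<xi> (z - 2 sqrt t cos \<theta>) = (1 - w u) (1 - w cnj u)\<close> for \<open>u = cis \<theta>\<close>, and by partial
  fractions the integral of the resolvent reduces to \<open>sine_square_resolvent_mean\<close> and its conjugate. The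
  condition \<open>t * (norm \<xi>)\<^sup>2 < 1\<close> says that \<open>\<bar>w\<bar> < 1\<close>.\<close>

lemma semicircle_cauchy_transform:
  assumes t: "0 \<le> t" and \<xi>: "Im \<xi> < 0" "t * (norm \<xi>)\<^sup>2 < 1"
  shows "0 < Im (of_real t * \<xi> + 1 / \<xi>)" "cauchy_transform (semicircle_law t) (of_real t * \<xi> + 1 / \<xi>) = \<xi>"
proof -
  have nz: "\<xi> \<noteq> 0" using \<xi>(1) by auto
  have "t < 1 / (norm \<xi>)\<^sup>2" using \<xi>(2) nz by (simp add: field_simps)
  then show z_pos: "0 < Im (of_real t * \<xi> + 1 / \<xi>)"
    unfolding reciprocal_sum_Im(1)[OF nz] using \<xi>(1) by (simp add: mult_neg_pos)
  define z where "z = of_real t * \<xi> + 1 / \<xi>"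
  have z: "0 < Im z" unfolding z_def by (rule z_pos)
  define r where "r = sqrt t"
  define w where "w = of_real r * \<xi>"
  have "(norm w)\<^sup>2 = t * (norm \<xi>)\<^sup>2" unfolding w_def r_def using t by (simp add: norm_mult power_mult_distrib)
  then have "(norm w)\<^sup>2 < 1\<^sup>2" using \<xi>(2) by simp
  then have w: "norm w < 1" by (rule power_less_imp_less_base) simp
  then have w2: "1 - w\<^sup>2 \<noteq> 0" using w by (metis abs_norm_cancel eq_iff_diff_eq_0 norm_one norm_power power_less_one_iff less_irrefl zero_less_numeral abs_square_less_1)
  define S where "S x = complex_of_real (2 * (sin (2 * pi * x))\<^sup>2)" for x
  define e where "e x = cis (2 * pi * x)" for x
  have A: "((\<lambda>x. S x / (1 - w * e x)) has_integral 1 - w\<^sup>2 / 2) {0..1}"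
    unfolding S_def e_def by (rule sine_square_resolvent_mean[OF w])
  have "((cnj \<circ> (\<lambda>x. S x / (1 - cnj w * e x))) has_integral cnj (1 - (cnj w)\<^sup>2 / 2)) {0..1}"
    unfolding has_integral_cnj S_def e_def by (rule sine_square_resolvent_mean) (use w in simp)
  then have B: "((\<lambda>x. S x / (1 - w * cnj (e x))) has_integral 1 - w\<^sup>2 / 2) {0..1}"
    by (simp add: o_def S_def)
  have C: "((\<lambda>x. S x) has_integral 1) {0..1}"
    using sine_square_resolvent_mean[of 0] unfolding S_def by simp
  have sum: "((\<lambda>x. \<xi> / (1 - w\<^sup>2) * (S x / (1 - w * e x) + S x / (1 - w * cnj (e x)) - S x)) has_integral
      \<xi> / (1 - w\<^sup>2) * ((1 - w\<^sup>2 / 2) + (1 - w\<^sup>2 / 2) - 1)) {0..1}"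
    by (intro has_integral_mult_right has_integral_diff has_integral_add A B C)
  have pointwise: "\<xi> / (1 - w\<^sup>2) * (S x / (1 - w * e x) + S x / (1 - w * cnj (e x)) - S x)
      = (2 * (sin (2 * pi * x))\<^sup>2) *\<^sub>R (1 / (z - of_real (2 * sqrt t * cos (2 * pi * x))))" for x
  proof -
    define u where "u = e x"
    define a where "a = 1 - w * u"
    define b where "b = 1 - w * cnj u"
    have u: "norm u = 1" "u * cnj u = 1" unfolding u_def e_def by (auto simp: cis_cnj cis_mult)
    have "norm (w * u) < 1" "norm (w * cnj u) < 1" using u w by (simp_all add: norm_mult)
    then have ab: "a \<noteq> 0" "b \<noteq> 0" unfolding a_def b_def by auto
    have cos: "complex_of_real (2 * cos (2 * pi * x)) = u + cnj u"
      unfolding u_def e_def by (simp add: complex_eq_iff)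
    have sumab: "b + a - a * b = 1 - w\<^sup>2"
      unfolding a_def b_def using u(2) by (simp add: algebra_simps power2_eq_square)
    have "\<xi> * (z - of_real (2 * sqrt t * cos (2 * pi * x))) = of_real t * \<xi>\<^sup>2 + 1 - w * (u + cnj u)"
      unfolding z_def cos[symmetric] w_def r_def using nz by (simp add: field_simps power2_eq_square)
    also have "\<dots> = a * b"
    proof -
      have "of_real t * \<xi>\<^sup>2 = w\<^sup>2" unfolding w_def r_def using t by (simp add: power_mult_distrib flip: of_real_power)
      then show ?thesis unfolding a_def b_def using u(2) by (simp add: algebra_simps power2_eq_square)
    qed
    finally have "1 / (z - of_real (2 * sqrt t * cos (2 * pi * x))) = \<xi> / (a * b)"
      using nz ab by (metis (no_types, lifting) divide_divide_eq_right mult_1 nonzero_mult_div_cancel_left mult_zero_right no_zero_divisors div_by_1 times_divide_eq_left mult.commute nonzero_divide_mult_cancel_left)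
    moreover have "S x / a + S x / b - S x = S x * ((1 - w\<^sup>2) / (a * b))"
      unfolding sumab[symmetric] using ab by (simp add: field_simps)
    ultimately show ?thesis using w2 unfolding a_def[symmetric] b_def[symmetric] u_def[symmetric] S_def
      by (simp add: scaleR_conv_of_real)
  qed
  have "((\<lambda>x. (2 * (sin (2 * pi * x))\<^sup>2) *\<^sub>R (1 / (z - of_real (2 * sqrt t * cos (2 * pi * x))))) has_integral \<xi>) {0..1}"
    using sum w2 unfolding pointwise by simp
  moreover have "((\<lambda>x. (2 * (sin (2 * pi * x))\<^sup>2) *\<^sub>R (1 / (z - of_real (2 * sqrt t * cos (2 * pi * x))))) has_integral
      cauchy_transform (semicircle_law t) z) {0..1}"
    unfolding cauchy_transform_def by (rule semicircle_integral[OF t resolvent_continuous[OF z]])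
  ultimately show "cauchy_transform (semicircle_law t) (of_real t * \<xi> + 1 / \<xi>) = \<xi>"
    unfolding z_def[symmetric] by (rule has_integral_unique[rotated])
qed

lemma semicircle_support: "0 \<le> t \<Longrightarrow> msupport (semicircle_law t) \<subseteq> {- 2 * sqrt t..2 * sqrt t}"
proof
  fix x assume t: "0 \<le> t" and x: "x \<in> msupport (semicircle_law t)"
  show "x \<in> {- 2 * sqrt t..2 * sqrt t}"
  proof (rule ccontr)
    define U where "U = - {- 2 * sqrt t..2 * sqrt t}"
    assume "x \<notin> {- 2 * sqrt t..2 * sqrt t}"
    then have "open U" "x \<in> U" unfolding U_def by (auto intro: open_Compl)
    then have ne: "emeasure (semicircle_law t) U \<noteq> 0" using x unfolding msupport_def by blast
    have U: "U \<in> sets borel" unfolding U_def by simp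
    show False
    proof (cases "t = 0")
      case True
      then show False using ne U unfolding U_def semicircle_law_def by (simp add: emeasure_return)
    next
      case False
      with t have t': "0 < t" by simp
      define g where "g x = indicator {- 2 * sqrt t..2 * sqrt t} x * (sqrt (4 * t - x\<^sup>2) / (2 * pi * t))" for x
      have "g \<in> borel_measurable borel"
      proof -
        have "continuous_on {- 2 * sqrt t..2 * sqrt t} (\<lambda>x. sqrt (4 * t - x\<^sup>2) / (2 * pi * t))"
          using t' by (intro continuous_intros) auto
        from borel_measurable_continuous_on_indicator[OF _ this] show ?thesis unfolding g_def by simp
      qed
      then have "emeasure (semicircle_law t) U = (\<integral>\<^sup>+x. ennreal (g x) * indicator U x \<partial>lborel)"
        unfolding semicircle_law_density[OF t'] g_def using U by (intro emeasure_density) auto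
      also have "\<dots> = nn_integral (lborel :: real measure) (\<lambda>_. 0)"
        by (intro nn_integral_cong) (auto simp: g_def U_def indicator_def)
      finally show False using ne by simp
    qed
  qed
qed

text \<open>By the substitution, the integrals are averages over a fixed interval with an integrand that is
  continuous in \<open>t\<close>, so dominated convergence applies.\<close>

lemma semicircle_bounded_path: "semicircle_law \<in> bounded_paths UNIV M0_real"
  unfolding bounded_paths_def mem_Collect_eq paths_iff
proof (intro conjI allI impI)
  show "semicircle_law t \<in> M0_real" if t: "0 \<le> t" for t
  proof -
    note p = prob_measures_onD[OF semicircle_prob[OF t]]
    have "emeasure (semicircle_law t) UNIV = 1"
      using prob_space.emeasure_space_1[OF p(2)] unfolding finite_measures_onD(3)[OF p(1)] .
    moreover have "bounded (msupport (semicircle_law t))"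
      using bounded_subset[OF bounded_closed_interval semicircle_support[OF t]] .
    ultimately show ?thesis unfolding M0_real_def using p by simp
  qed
  have "(\<lambda>t. measure (semicircle_law t) UNIV) ` {0..} = {1}"
    using prob_measures_onD(3)[OF semicircle_prob] by auto
  then show "bdd_above ((\<lambda>t. measure (semicircle_law t) UNIV) ` {0..})" by simp
  fix \<phi> :: "real \<Rightarrow> real" assume \<phi>: "continuous_on UNIV \<phi> \<and> bounded (range \<phi>)"
  then obtain C where C: "\<And>x. \<bar>\<phi> x\<bar> \<le> C" unfolding bounded_iff by auto
  define f where "f t x = 2 * (sin (2 * pi * x))\<^sup>2 * \<phi> (2 * sqrt t * cos (2 * pi * x))" for t x
  have f_int: "(f t has_integral (LINT x|semicircle_law t. \<phi> x)) {0..1}" if "0 \<le> t" for t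
    using semicircle_integral[OF that conjunct1[OF \<phi>]] unfolding f_def by simp
  show "continuous_on {0..} (\<lambda>t. LINT x|semicircle_law t. \<phi> x)"
    unfolding continuous_on_sequentially
  proof (intro allI ballI impI)
    fix X and t :: real assume "t \<in> {0..}" and X: "(\<forall>n. X n \<in> {0..}) \<and> X \<longlonglongrightarrow> t"
    then have t: "0 \<le> t" and X': "\<And>n. 0 \<le> X n" by auto
    have "(\<lambda>n. integral {0..1} (f (X n))) \<longlonglongrightarrow> integral {0..1} (f t)"
    proof (rule dominated_convergence(2)[where h = "\<lambda>_. 2 * C"])
      show "f (X n) integrable_on {0..1}" for n using f_int[OF X'] by (rule has_integral_integrable)
      show "norm (f (X n) x) \<le> 2 * C" for n x
      proof -
        have "norm (f (X n) x) = 2 * (sin (2 * pi * x))\<^sup>2 * \<bar>\<phi> (2 * sqrt (X n) * cos (2 * pi * x))\<bar>"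
          unfolding f_def by (simp add: abs_mult)
        also have "\<dots> \<le> 2 * C"
          using C by (intro mult_mono) (auto simp: abs_square_le_1)
        finally show ?thesis .
      qed
      show "(\<lambda>n. f (X n) x) \<longlonglongrightarrow> f t x" for x
      proof -
        have "isCont \<phi> y" for y using \<phi> by (simp add: continuous_on_eq_continuous_at)
        moreover have "(\<lambda>n. 2 * sqrt (X n) * cos (2 * pi * x)) \<longlonglongrightarrow> 2 * sqrt t * cos (2 * pi * x)"
          using X by (intro tendsto_intros) auto
        ultimately have "(\<lambda>n. \<phi> (2 * sqrt (X n) * cos (2 * pi * x))) \<longlonglongrightarrow> \<phi> (2 * sqrt t * cos (2 * pi * x))"
          by (rule isCont_tendsto_compose)
        then show ?thesis unfolding f_def by (intro tendsto_intros)
      qed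
    qed (rule integrable_const_ivl)
    then show "((\<lambda>t. LINT x|semicircle_law t. \<phi> x) \<circ> X) \<longlonglongrightarrow> (LINT x|semicircle_law t. \<phi> x)"
      unfolding integral_unique[OF f_int[OF X']] integral_unique[OF f_int[OF t]] o_def .
  qed
qed

section \<open>Fixed points of the chordal map\<close>

text \<open>The map \<open>\<zeta> \<mapsto> \<zeta> + t / \<zeta>\<close> takes the part of the half-plane outside of the disc of radius \<open>sqrt t\<close> onto the
  whole half-plane: \<open>\<zeta>\<close> is a root of \<open>\<zeta>\<^sup>2 - z \<zeta> + t\<close>.\<close>

lemma joukowski_preimage:
  assumes t: "0 \<le> t" and z: "0 < Im z"
  obtains \<zeta> where "0 < Im \<zeta>" "t < (norm \<zeta>)\<^sup>2" "z = \<zeta> + of_real t / \<zeta>"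
proof -
  define d where "d = csqrt (z\<^sup>2 - 4 * of_real t)"
  define a where "a = (z + d) / 2"
  define b where "b = (z - d) / 2"
  have d2: "d\<^sup>2 = z\<^sup>2 - 4 * of_real t" unfolding d_def by simp
  have sum: "a + b = z" and prod: "a * b = of_real t"
    unfolding a_def b_def using d2 by (simp_all add: field_simps power2_eq_square)
  show ?thesis
  proof (cases "t = 0")
    case True
    then show ?thesis using z by (intro that[of z]) auto
  next
    case False
    \<comment> \<open>The roots have product \<open>t\<close>; take the one of modulus at least \<open>sqrt t\<close>.\<close>
    have "norm a * norm b = t" using arg_cong[OF prod, of norm] t by (simp add: norm_mult)
    moreover have "norm a * norm b \<le> norm a * norm a \<or> norm a * norm b \<le> norm b * norm b"
      by (cases "norm a \<le> norm b") (auto intro: mult_right_mono mult_left_mono)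
    ultimately have "t \<le> (norm a)\<^sup>2 \<or> t \<le> (norm b)\<^sup>2" by (simp add: power2_eq_square)
    then obtain \<zeta> \<eta> where \<zeta>: "\<zeta> + \<eta> = z" "\<zeta> * \<eta> = of_real t" "t \<le> (norm \<zeta>)\<^sup>2"
    proof
      assume "t \<le> (norm a)\<^sup>2"
      then show thesis by (rule that[OF sum prod])
    next
      assume "t \<le> (norm b)\<^sup>2"
      then show thesis using sum prod by (intro that[of b a]) (auto simp: add.commute mult.commute)
    qed
    have nz: "\<zeta> \<noteq> 0" using \<zeta>(2) False by auto
    then have "\<eta> = of_real t / \<zeta>" using \<zeta>(2) by (simp add: eq_divide_eq mult.commute)
    then have z_eq: "z = \<zeta> + of_real t / \<zeta>" using \<zeta>(1) by simp
    define q where "q = (norm \<zeta>)\<^sup>2"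
    have q: "0 < q" "t \<le> q" unfolding q_def using nz \<zeta>(3) by auto
    have "Im z = Im \<zeta> * (1 - t / q)"
      unfolding z_eq q_def cmod_power2 by (simp add: Im_divide algebra_simps)
    then have "0 < Im \<zeta> * (1 - t / q)" using z by simp
    moreover have "0 \<le> 1 - t / q" using q by simp
    ultimately have "0 < Im \<zeta>" "0 < 1 - t / q" by (auto simp: zero_less_mult_iff)
    then show ?thesis using q(1) z_eq unfolding q_def by (intro that[of \<zeta>]) (auto simp: divide_less_eq_1)
  qed
qed

lemma joukowski_flow:
  assumes \<zeta>: "0 < Im \<zeta>" and \<tau>: "0 \<le> \<tau>" "\<tau> < (norm \<zeta>)\<^sup>2"
  shows "0 < Im (\<zeta> + of_real \<tau> / \<zeta>)" "cauchy_transform (semicircle_law \<tau>) (\<zeta> + of_real \<tau> / \<zeta>) = 1 / \<zeta>"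
proof -
  define \<xi> where "\<xi> = 1 / \<zeta>"
  have nz: "\<zeta> \<noteq> 0" using \<zeta> by auto
  have eq: "of_real \<tau> * \<xi> + 1 / \<xi> = \<zeta> + of_real \<tau> / \<zeta>" unfolding \<xi>_def by simp
  have "Im \<xi> < 0" unfolding \<xi>_def Im_inverse using \<zeta> nz by (simp add: divide_neg_pos)
  moreover have "\<tau> * (norm \<xi>)\<^sup>2 < 1" unfolding \<xi>_def using \<tau> nz by (simp add: norm_divide power_divide)
  ultimately show "0 < Im (\<zeta> + of_real \<tau> / \<zeta>)" "cauchy_transform (semicircle_law \<tau>) (\<zeta> + of_real \<tau> / \<zeta>) = 1 / \<zeta>"
    using semicircle_cauchy_transform[OF \<tau>(1), of \<xi>] unfolding eq by (simp_all add: \<xi>_def)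
qed

text \<open>The curve \<open>\<tau> \<mapsto> \<zeta> + \<tau> / \<zeta>\<close> solves the Loewner equation driven by the semicircle laws up to the time
  \<open>\<bar>\<zeta>\<bar>\<^sup>2\<close> at which it reaches the real line. So \<open>f\<^sub>t\<close> sends its position at time \<open>t\<close> to \<open>\<zeta>\<close>, and the
  semicircle law has Cauchy transform \<open>1 / \<zeta>\<close> there.\<close>

lemma semicircle_fixed:
  assumes s: "s \<in> bounded_paths UNIV M0_real" and eq: "\<And>t. 0 \<le> t \<Longrightarrow> s t = semicircle_law t" and t: "0 \<le> t"
  shows "CL s t = semicircle_law t"
proof (rule CL_eqI[OF s t semicircle_prob[OF t]])
  fix z :: complex assume z: "0 < Im z"
  obtain \<zeta> where \<zeta>: "0 < Im \<zeta>" "t < (norm \<zeta>)\<^sup>2" "z = \<zeta> + of_real t / \<zeta>"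
    using joukowski_preimage[OF t z] by blast
  define h where "h \<tau> = \<zeta> + of_real \<tau> / \<zeta>" for \<tau>
  have "flow_solution {w. 0 < Im w} (\<lambda>t. cauchy_transform (s t)) \<zeta> ((norm \<zeta>)\<^sup>2) h"
    unfolding flow_solution_def
  proof (intro conjI ballI)
    show "0 < (norm \<zeta>)\<^sup>2" using t \<zeta>(2) by linarith
    show "h 0 = \<zeta>" unfolding h_def by simp
    fix \<tau> assume \<tau>: "\<tau> \<in> {0..<(norm \<zeta>)\<^sup>2}"
    show "h \<tau> \<in> {w. 0 < Im w}" using joukowski_flow(1)[OF \<zeta>(1)] \<tau> unfolding h_def by simp
    have "cauchy_transform (s \<tau>) (h \<tau>) = 1 / \<zeta>"
      using joukowski_flow(2)[OF \<zeta>(1)] \<tau> eq unfolding h_def by simp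
    moreover have "(h has_vector_derivative 1 / \<zeta>) (at \<tau> within {0..<(norm \<zeta>)\<^sup>2})"
    proof -
      have h_eq: "h = (\<lambda>\<tau>. \<zeta> + \<tau> *\<^sub>R (1 / \<zeta>))" unfolding h_def by (simp add: scaleR_conv_of_real)
      show ?thesis unfolding h_eq by (auto intro!: derivative_eq_intros)
    qed
    ultimately show "(h has_vector_derivative cauchy_transform (s \<tau>) (h \<tau>)) (at \<tau> within {0..<(norm \<zeta>)\<^sup>2})" by simp
  qed
  from chordal_f_eq[OF s t \<zeta>(2) this] have "chordal_f s t z = \<zeta>" unfolding h_def \<zeta>(3)[symmetric] .
  then show "cauchy_transform (semicircle_law t) z = 1 / chordal_f s t z"
    using joukowski_flow(2)[OF \<zeta>(1) t \<zeta>(2)] unfolding \<zeta>(3)[symmetric] by simp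
qed

text \<open>For a fixed point the velocity along the trajectory from \<open>\<zeta>\<close> is \<open>1 / f\<^sub>\<tau> (h \<tau>) = 1 / \<zeta>\<close>, so the trajectory
  is \<open>\<zeta> + \<tau> / \<zeta>\<close>. As its endpoint is in the upper half-plane, \<open>t < \<bar>\<zeta>\<bar>\<^sup>2\<close>, and there the semicircle law has
  Cauchy transform \<open>1 / \<zeta> = 1 / f\<^sub>t z\<close>.\<close>

lemma fixed_semicircle:
  assumes s: "s \<in> bounded_paths UNIV M0_real" and fixed: "\<And>t. 0 \<le> t \<Longrightarrow> CL s t = s t" and t: "0 \<le> t"
  shows "s t = semicircle_law t"
proof -
  have "CL s t = semicircle_law t"
  proof (rule cauchy_transform_injective[OF CL_prob[OF s t] semicircle_prob[OF t]])
    fix z :: complex assume z: "0 < Im z"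
    obtain h T where h: "t < T" "flow_solution {w. 0 < Im w} (\<lambda>t. cauchy_transform (s t)) (chordal_f s t z) T h" "h t = z"
      using chordal_f_solution[OF s t z] by blast
    define \<zeta> where "\<zeta> = chordal_f s t z"
    have \<zeta>: "0 < Im \<zeta>" unfolding \<zeta>_def using chordal_f_Im[OF s t z] z by simp
    have h0: "h 0 = \<zeta>" and h_pos: "\<And>\<tau>. \<tau> \<in> {0..<T} \<Longrightarrow> 0 < Im (h \<tau>)"
      and h_deriv: "\<And>\<tau>. \<tau> \<in> {0..<T} \<Longrightarrow> (h has_vector_derivative cauchy_transform (s \<tau>) (h \<tau>)) (at \<tau> within {0..<T})"
      using h(2) unfolding flow_solution_def \<zeta>_def by auto
    have "((\<lambda>_. 1 / \<zeta>) has_integral (h t - h 0)) {0..t}"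
    proof (rule fundamental_theorem_of_calculus[OF t])
      fix \<tau> assume \<tau>: "\<tau> \<in> {0..t}"
      then have \<tau>': "0 \<le> \<tau>" "\<tau> < T" "\<tau> \<in> {0..<T}" using h(1) by auto
      have "cauchy_transform (s \<tau>) (h \<tau>) = 1 / chordal_f s \<tau> (h \<tau>)"
        using CL_cauchy_transform[OF s \<tau>'(1) h_pos[OF \<tau>'(3)]] fixed[OF \<tau>'(1)] by simp
      also have "chordal_f s \<tau> (h \<tau>) = \<zeta>" using chordal_f_eq[OF s \<tau>'(1,2) h(2)] unfolding \<zeta>_def .
      finally have V: "cauchy_transform (s \<tau>) (h \<tau>) = 1 / \<zeta>" .
      have "{0..t} \<subseteq> {0..<T}" using h(1) by auto
      from has_vector_derivative_within_subset[OF h_deriv[OF \<tau>'(3)] this]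
      show "(h has_vector_derivative 1 / \<zeta>) (at \<tau> within {0..t})" unfolding V .
    qed
    moreover have "((\<lambda>_. 1 / \<zeta>) has_integral (t *\<^sub>R (1 / \<zeta>))) {0..t}"
      using has_integral_const_real[of "1 / \<zeta>" 0 t] t by simp
    ultimately have "h t - h 0 = t *\<^sub>R (1 / \<zeta>)" by (rule has_integral_unique)
    then have z_eq: "z = \<zeta> + of_real t / \<zeta>" unfolding h(3) h0 by (simp add: scaleR_conv_of_real algebra_simps)
    define \<xi> where "\<xi> = 1 / \<zeta>"
    have nz: "\<zeta> \<noteq> 0" "\<xi> \<noteq> 0" using \<zeta> unfolding \<xi>_def by auto
    have \<xi>_neg: "Im \<xi> < 0" unfolding \<xi>_def Im_inverse using \<zeta> nz by (simp add: divide_neg_pos)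
    have "z = of_real t * \<xi> + 1 / \<xi>" unfolding \<xi>_def using z_eq by simp
    then have "0 < - Im \<xi> * (1 / (norm \<xi>)\<^sup>2 - t)" using z reciprocal_sum_Im(1)[OF nz(2), of t] by simp
    then have "t < 1 / (norm \<xi>)\<^sup>2" using \<xi>_neg by (auto simp only: zero_less_mult_iff)
    then have "t < (norm \<zeta>)\<^sup>2" unfolding \<xi>_def by (simp add: norm_divide power_divide)
    then have "cauchy_transform (semicircle_law t) z = 1 / \<zeta>" unfolding z_eq by (rule joukowski_flow(2)[OF \<zeta> t])
    then show "cauchy_transform (CL s t) z = cauchy_transform (semicircle_law t) z"
      using CL_cauchy_transform[OF s t z] unfolding \<zeta>_def by simp
  qed
  then show ?thesis using fixed[OF t] by simp
qed

text \<open>Dominated convergence for the divided differences \<open>d\<close> of the kernel. Being given explicitly, these need no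
  mean value estimate.\<close>

lemma integral_holomorphic:
  fixes k :: "complex \<Rightarrow> 'a::topological_space \<Rightarrow> complex"
  assumes \<mu>: "\<mu> \<in> finite_measures_on X" and U: "open U"
    and int: "\<And>z. z \<in> U \<Longrightarrow> integrable \<mu> (k z)"
    and diff: "\<And>z w x. z \<in> U \<Longrightarrow> w \<in> U \<Longrightarrow> x \<in> X \<Longrightarrow> k z x - k w x = d z w x * (z - w)"
    and meas: "\<And>z w. z \<in> U \<Longrightarrow> w \<in> U \<Longrightarrow> d z w \<in> borel_measurable \<mu>"
    and cont: "\<And>w x. w \<in> U \<Longrightarrow> x \<in> X \<Longrightarrow> isCont (\<lambda>z. d z w x) w"
    and bound: "\<And>w. w \<in> U \<Longrightarrow> \<exists>e C. 0 < e \<and> ball w e \<subseteq> U \<and> (\<forall>z\<in>ball w e. \<forall>x\<in>X. norm (d z w x) \<le> C)"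
  shows "(\<lambda>z. LINT x|\<mu>. k z x) holomorphic_on U"
  unfolding holomorphic_on_open[OF U]
proof
  fix w assume w: "w \<in> U"
  obtain e C where e: "0 < e" "ball w e \<subseteq> U" and C: "\<And>z x. z \<in> ball w e \<Longrightarrow> x \<in> X \<Longrightarrow> norm (d z w x) \<le> C"
    using bound[OF w] by blast
  interpret finite_measure \<mu> by (rule finite_measures_onD(1)[OF \<mu>])
  have space: "space \<mu> = X" by (rule finite_measures_onD(3)[OF \<mu>])
  define F where "F z = (LINT x|\<mu>. k z x)" for z
  have quotient: "(F z - F w) / (z - w) = (LINT x|\<mu>. d z w x)" if z: "z \<in> U" "z \<noteq> w" for z
  proof -
    have "F z - F w = (LINT x|\<mu>. k z x - k w x)"
      unfolding F_def using int[OF z(1)] int[OF w] by simp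
    also have "\<dots> = (LINT x|\<mu>. d z w x * (z - w))"
      by (rule Bochner_Integration.integral_cong[OF refl]) (use diff[OF z(1) w] space in simp)
    also have "\<dots> = (LINT x|\<mu>. d z w x) * (z - w)" by (simp only: integral_mult_left_zero)
    finally show ?thesis using z(2) by simp
  qed
  have "((\<lambda>z. (F z - F w) / (z - w)) \<longlongrightarrow> (LINT x|\<mu>. d w w x)) (at w within ball w e)"
    unfolding tendsto_at_iff_sequentially
  proof (intro allI impI)
    fix Z assume "\<forall>i. Z i \<in> ball w e - {w}" and lim: "Z \<longlonglongrightarrow> w"
    then have Z: "Z i \<in> ball w e" "Z i \<noteq> w" "Z i \<in> U" for i using e(2) by auto
    have "(\<lambda>i. LINT x|\<mu>. d (Z i) w x) \<longlonglongrightarrow> (LINT x|\<mu>. d w w x)"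
    proof (rule integral_dominated_convergence[where w = "\<lambda>_. C"])
      show "AE x in \<mu>. (\<lambda>i. d (Z i) w x) \<longlonglongrightarrow> d w w x"
        using isCont_tendsto_compose[OF cont[OF w] lim] space by (intro AE_I2) simp
      show "AE x in \<mu>. norm (d (Z i) w x) \<le> C" for i using C[OF Z(1)] space by (intro AE_I2) simp
    qed (use meas w Z(3) in auto)
    then show "((\<lambda>z. (F z - F w) / (z - w)) \<circ> Z) \<longlonglongrightarrow> (LINT x|\<mu>. d w w x)"
      using quotient[OF Z(3,2)] by (simp add: o_def)
  qed
  then have "(F has_field_derivative (LINT x|\<mu>. d w w x)) (at w)"
    using at_within_open[of w "ball w e"] e(1) by (simp add: has_field_derivative_iff)
  then show "\<exists>f'. ((\<lambda>z. LINT x|\<mu>. k z x) has_field_derivative f') (at w)" unfolding F_def by blast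
qed

lemma cauchy_transform_holomorphic:
  assumes \<mu>: "\<mu> \<in> finite_measures_on UNIV"
  shows "cauchy_transform \<mu> holomorphic_on {z. 0 < Im z}"
  unfolding cauchy_transform_def
proof (rule integral_holomorphic[OF \<mu> open_halfspace_Im_gt, where d = "\<lambda>z w x. - (1 / (z - complex_of_real x) * (1 / (w - complex_of_real x)))"])
  have nz: "z - complex_of_real x \<noteq> 0" if "z \<in> {z. 0 < Im z}" for z x using that by (auto simp: complex_eq_iff)
  fix z w x assume zw: "z \<in> {z. 0 < Im z}" "w \<in> {z. 0 < Im z}"
  show "integrable \<mu> (\<lambda>x. 1 / (z - complex_of_real x))" using resolvent_integrable[OF \<mu>] zw(1) by simp
  show "(\<lambda>x. - (1 / (z - complex_of_real x) * (1 / (w - complex_of_real x)))) \<in> borel_measurable \<mu>"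
    using zw by (intro continuous_measurable_on[OF \<mu>] continuous_intros resolvent_continuous) auto
  show "1 / (z - complex_of_real x) - 1 / (w - complex_of_real x) = - (1 / (z - complex_of_real x) * (1 / (w - complex_of_real x))) * (z - w)"
    using nz[OF zw(1), of x] nz[OF zw(2), of x] by (simp add: divide_simps)
  show "isCont (\<lambda>z. - (1 / (z - complex_of_real x) * (1 / (w - complex_of_real x)))) w"
    using nz[OF zw(2), of x] by (intro continuous_intros) auto
  define c where "c = Im w / 2"
  have c: "0 < c" "c \<le> Im w" unfolding c_def using zw by auto
  have Im_ge: "c \<le> Im z" if "z \<in> ball w c" for z
    using abs_Im_le_cmod[of "w - z"] that unfolding c_def by (simp add: dist_norm)
  show "\<exists>e C. 0 < e \<and> ball w e \<subseteq> {z. 0 < Im z} \<and> (\<forall>z\<in>ball w e. \<forall>x\<in>UNIV. norm (- (1 / (z - complex_of_real x) * (1 / (w - complex_of_real x)))) \<le> C)"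
  proof (intro exI conjI ballI)
    show "ball w c \<subseteq> {z. 0 < Im z}" using Im_ge c(1) by force
    show "norm (- (1 / (z - complex_of_real x) * (1 / (w - complex_of_real x)))) \<le> 1 / c * (1 / c)" if "z \<in> ball w c" for z x
      unfolding norm_minus_cancel norm_mult using Im_ge[OF that] c
      by (intro mult_mono resolvent_bound) auto
  qed (rule c(1))
qed

text \<open>The right inverse is \<open>K z = t z + 1 / z\<close>. For \<open>\<bar>z\<bar> < \<beta>\<close> the second term dominates: \<open>t \<bar>z\<bar>\<^sup>2 \<le> 1/2\<close>, so \<open>K\<close> opens
  the cone by a factor of at most 3 and \<open>\<bar>K z\<bar> > 1 / (2 \<beta>)\<close>.\<close>

lemma semicircle_R_transform:
  assumes t: "0 \<le> t"
  shows "has_R_transform (semicircle_law t) (\<lambda>z. of_real t * z)"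
  unfolding has_R_transform_def
proof (intro conjI allI impI)
  show "semicircle_law t \<in> prob_measures_on UNIV" by (rule semicircle_prob[OF t])
  fix \<alpha> :: real assume \<alpha>: "0 < \<alpha>"
  define \<beta> where "\<beta> = 1 / (2 * (t + 1))"
  have \<beta>: "0 < \<beta>" unfolding \<beta>_def using t by simp
  have t\<beta>: "t * \<beta>\<^sup>2 \<le> 1 / 2"
  proof -
    have "t * \<beta> \<le> 1 / 2" "\<beta> \<le> 1" unfolding \<beta>_def using t by (auto simp: field_simps)
    then have "t * \<beta> * \<beta> \<le> 1 / 2 * 1" using \<beta> t by (intro mult_mono) auto
    then show ?thesis by (simp add: power2_eq_square mult.assoc)
  qed
  define K where "K z = of_real t * z + 1 / z" for z :: complex
  have "cauchy_right_inverse (semicircle_law t) \<alpha> \<beta> K"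
    unfolding cauchy_right_inverse_def
  proof (rule exI[of _ "3 * \<alpha>"], intro conjI exI[of _ "1 / (2 * \<beta>)"] ballI)
    show "0 < 3 * \<alpha>" "0 < 1 / (2 * \<beta>)" using \<alpha> \<beta> by auto
    fix z assume "z \<in> lower_cone \<alpha> \<beta>"
    then have z: "Im z < 0" "\<alpha> * Im z < Re z" "Re z < - \<alpha> * Im z" "norm z < \<beta>" unfolding lower_cone_def by auto
    have nz: "z \<noteq> 0" using z(1) by auto
    define q where "q = (norm z)\<^sup>2"
    have q: "0 < q" unfolding q_def using nz by simp
    have "q \<le> \<beta>\<^sup>2" unfolding q_def using z(4) by (intro power_mono) auto
    then have tq: "t * q \<le> 1 / 2" using t\<beta> t mult_left_mono[of q "\<beta>\<^sup>2" t] by linarith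
    have "t * (norm z)\<^sup>2 < 1" using tq unfolding q_def by simp
    note G = semicircle_cauchy_transform[OF t z(1) this]
    show "cauchy_transform (semicircle_law t) (K z) = z" unfolding K_def by (rule G(2))
    have ImK: "Im (K z) = - Im z * (1 / q - t)" and ReK: "Re (K z) = Re z * (1 / q + t)"
      unfolding K_def q_def by (rule reciprocal_sum_Im[OF nz])+
    have "2 * t \<le> 1 / q" using tq q by (simp add: field_simps)
    then have comp: "1 / q + t \<le> 3 * (1 / q - t)" "0 < 1 / q + t" using t q by (auto simp: add_pos_nonneg)
    have "\<bar>Re z\<bar> < \<alpha> * - Im z" using z(2,3) by auto
    then have "\<bar>Re z\<bar> * (1 / q + t) < (\<alpha> * - Im z) * (1 / q + t)" using comp(2) by (rule mult_strict_right_mono)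
    also have "\<dots> \<le> (\<alpha> * - Im z) * (3 * (1 / q - t))" using comp(1) mult_pos_neg[OF \<alpha> z(1)] by (intro mult_left_mono) auto
    also have "\<dots> = 3 * \<alpha> * Im (K z)" unfolding ImK by simp
    finally have "\<bar>Re (K z)\<bar> < 3 * \<alpha> * Im (K z)" unfolding ReK using comp(2) by (simp add: abs_mult)
    moreover have "1 / (2 * \<beta>) < norm (K z)"
    proof -
      have "t * norm z \<le> (1 / norm z) / 2"
        using tq nz unfolding q_def by (simp add: field_simps power2_eq_square)
      moreover have "1 / norm z - t * norm z \<le> norm (K z)"
        using norm_triangle_ineq2[of "1 / z" "- (of_real t * z)"] t
        unfolding K_def by (simp add: norm_divide norm_mult add.commute)
      ultimately have "(1 / norm z) / 2 \<le> norm (K z)" by linarith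
      moreover have "1 / \<beta> < 1 / norm z" using z(4) nz \<beta> by (intro divide_strict_left_mono) auto
      ultimately show ?thesis by simp
    qed
    ultimately show "K z \<in> upper_cone (3 * \<alpha>) (1 / (2 * \<beta>))"
      unfolding upper_cone_def using G(1) unfolding K_def[symmetric] by auto
  qed
  then show "\<exists>\<beta>>0. \<exists>K. cauchy_right_inverse (semicircle_law t) \<alpha> \<beta> K \<and> (\<forall>z\<in>lower_cone \<alpha> \<beta>. of_real t * z = K z - 1 / z)"
    using \<beta> by (intro exI[of _ \<beta>] exI[of _ K] conjI) (auto simp: K_def)
qed

text \<open>On the ray \<open>z = - \<i> y\<close> the right inverse must be \<open>K z = t z + 1 / z\<close>, the point \<open>Y y\<close> of the imaginary axis.
  So the Cauchy transforms of \<open>\<mu>\<close> and of the semicircle law agree on a segment, and hence on the half-plane.\<close>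

lemma R_transform_semicircle:
  assumes t: "0 \<le> t" and R: "has_R_transform \<mu> (\<lambda>z. of_real t * z)"
  shows "\<mu> = semicircle_law t"
proof -
  have \<mu>: "\<mu> \<in> prob_measures_on UNIV" using R unfolding has_R_transform_def by blast
  obtain \<beta> K where \<beta>: "0 < \<beta>" and K: "cauchy_right_inverse \<mu> 1 \<beta> K" "\<And>z. z \<in> lower_cone 1 \<beta> \<Longrightarrow> of_real t * z = K z - 1 / z"
    using R unfolding has_R_transform_def by (metis zero_less_one)
  define b where "b = min \<beta> (1 / (t + 1))"
  have b: "0 < b" "b \<le> \<beta>" "t * b\<^sup>2 < 1"
  proof -
    show b0: "0 < b" "b \<le> \<beta>" unfolding b_def using \<beta> t by auto
    have le: "b \<le> 1 / (t + 1)" "b \<le> 1" unfolding b_def using t by (auto simp: min_le_iff_disj divide_le_eq_1)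
    have "t * b \<le> t * (1 / (t + 1))" using le(1) t by (intro mult_left_mono) auto
    also have "\<dots> < 1" using t by (simp add: divide_less_eq_1)
    finally have "t * b < 1" .
    moreover have "t * b * b \<le> t * b" using le(2) b0 t mult_left_mono[of b 1 "t * b"] by simp
    ultimately have "t * b * b < 1" by simp
    then show "t * b\<^sup>2 < 1" by (simp add: power2_eq_square mult.assoc)
  qed
  define Y where "Y y = \<i> * of_real (1 / y - t * y)" for y
  have Y_eq: "of_real t * (- \<i> * of_real y) + 1 / (- \<i> * of_real y) = Y y" if "0 < y" for y
    unfolding Y_def using that by (simp add: complex_eq_iff Im_divide Re_divide power2_eq_square)
  have agree: "0 < Im (Y y)" "cauchy_transform \<mu> (Y y) = cauchy_transform (semicircle_law t) (Y y)" if y: "0 < y" "y < b" for y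
  proof -
    define z where "z = - \<i> * complex_of_real y"
    have cone: "z \<in> lower_cone 1 \<beta>" unfolding lower_cone_def z_def using y b by (simp add: norm_mult)
    have "y\<^sup>2 \<le> b\<^sup>2" using y by (intro power_mono) auto
    then have "t * y\<^sup>2 < 1" using b(3) t mult_left_mono[of "y\<^sup>2" "b\<^sup>2" t] by linarith
    then have "t * (norm z)\<^sup>2 < 1" "Im z < 0" unfolding z_def using y by (simp_all add: norm_mult)
    note G = semicircle_cauchy_transform[OF t this(2,1)]
    have Kz: "K z = Y y" using K(2)[OF cone] Y_eq[OF y(1)] unfolding z_def[symmetric] by (simp add: algebra_simps)
    have "cauchy_transform \<mu> (Y y) = z" using K(1) cone unfolding cauchy_right_inverse_def Kz[symmetric] by blast
    moreover have "cauchy_transform (semicircle_law t) (Y y) = z" using G(2) Y_eq[OF y(1)] unfolding z_def by simp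
    ultimately show "cauchy_transform \<mu> (Y y) = cauchy_transform (semicircle_law t) (Y y)" by simp
    show "0 < Im (Y y)" using G(1) unfolding z_def Y_eq[OF y(1)] .
  qed
  define U where "U = Y ` {0<..<b}"
  have "cauchy_transform \<mu> z = cauchy_transform (semicircle_law t) z" if z: "0 < Im z" for z
  proof -
    define D where "D z = cauchy_transform \<mu> z - cauchy_transform (semicircle_law t) z" for z
    have "D z = 0"
    proof (rule analytic_continuation[of D "{z. 0 < Im z}" U "Y (b / 2)"])
      show "D holomorphic_on {z. 0 < Im z}" unfolding D_def
        by (intro holomorphic_intros cauchy_transform_holomorphic prob_measures_onD(1) \<mu> semicircle_prob[OF t])
      show "open {z. 0 < Im z}" by (rule open_halfspace_Im_gt)
      show "connected {z. 0 < Im z}" by (rule convex_connected[OF convex_halfspace_Im_gt])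
      show "U \<subseteq> {z. 0 < Im z}" unfolding U_def using agree(1) by auto
      show "Y (b / 2) \<in> {z. 0 < Im z}" using agree(1)[of "b / 2"] b(1) by simp
      show "D w = 0" if "w \<in> U" for w using that agree(2) unfolding U_def D_def by auto
      show "z \<in> {z. 0 < Im z}" using z by simp
      show "Y (b / 2) islimpt U"
        unfolding islimpt_sequential
      proof (intro exI conjI allI)
        define y where "y n = b / 2 * (1 - 1 / (real n + 2))" for n
        have y: "0 < y n" "y n < b / 2" for n unfolding y_def using b(1) by (auto simp: field_simps add_pos_nonneg)
        show "Y (y n) \<in> U - {Y (b / 2)}" for n
        proof -
          have "1 / (b / 2) < 1 / y n" using y[of n] by (intro divide_strict_left_mono mult_pos_pos) auto
          moreover have "t * y n \<le> t * (b / 2)" using y[of n] t by (intro mult_left_mono) auto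
          ultimately have "1 / (b / 2) - t * (b / 2) \<noteq> 1 / y n - t * y n" by linarith
          then have "Y (y n) \<noteq> Y (b / 2)" unfolding Y_def by (metis complex_i_not_zero mult_cancel_left of_real_eq_iff)
          moreover have "y n \<in> {0<..<b}" using y[of n] b(1) by simp
          ultimately show ?thesis unfolding U_def by blast
        qed
        have "(\<lambda>n. 1 / (real n + 2)) \<longlonglongrightarrow> 0" by real_asymp
        then have "(\<lambda>n. b / 2 * (1 - 1 / (real n + 2))) \<longlonglongrightarrow> b / 2 * (1 - 0)" by (intro tendsto_intros)
        then have "y \<longlonglongrightarrow> b / 2" unfolding y_def by simp
        then show "(\<lambda>n. Y (y n)) \<longlonglongrightarrow> Y (b / 2)" unfolding Y_def using b(1) by (intro tendsto_intros) auto
      qed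
    qed
    then show ?thesis unfolding D_def by simp
  qed
  then show ?thesis by (rule cauchy_transform_injective[OF \<mu> semicircle_prob[OF t]])
qed

section \<open>The radial map\<close>

lemma unit_disc_level: "{w::complex. 0 < 1 - norm w} = ball 0 1"
  by auto

lemma one_minus_nonzero: "norm w < 1 \<Longrightarrow> 1 - w \<noteq> 0" for w :: complex
  by auto

lemma return_M1_circle: "return (restrict_space borel (sphere 0 1)) (1::complex) \<in> M1_circle"
  unfolding prob_measures_on_def finite_measures_on_def
  using prob_space_return[of 1 "restrict_space borel (sphere (0::complex) 1)"] prob_space.finite_measure
  by (auto simp: space_restrict_space)

lemma psi_return:
  assumes z: "norm z < 1"
  shows "psi (return (restrict_space borel (sphere 0 1)) 1) z = z / (1 - z)"
proof -
  have "(\<lambda>\<zeta>. z / (\<zeta> - z)) \<in> borel_measurable (restrict_space borel (sphere 0 1))"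
    using z by (intro borel_measurable_continuous_on_restrict continuous_intros) auto
  then show ?thesis
    unfolding psi_eq[OF prob_measures_onD(1)[OF return_M1_circle] z]
    by (subst integral_return) (auto simp: space_restrict_space)
qed

lemma psi_holomorphic:
  assumes \<mu>: "\<mu> \<in> finite_measures_on (sphere 0 1)"
  shows "psi \<mu> holomorphic_on ball 0 1"
proof -
  have "(\<lambda>z. LINT \<zeta>|\<mu>. z / (\<zeta> - z)) holomorphic_on ball 0 1"
  proof (rule integral_holomorphic[OF \<mu> open_ball, where d = "\<lambda>z w \<zeta>. \<zeta> / ((\<zeta> - z) * (\<zeta> - w))"])
    fix z w \<zeta> :: complex assume zw: "z \<in> ball 0 1" "w \<in> ball 0 1"
    show "integrable \<mu> (\<lambda>\<zeta>. z / (\<zeta> - z))"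
      using zw by (intro circle_integrable[OF \<mu>] continuous_intros) auto
    show "(\<lambda>\<zeta>. \<zeta> / ((\<zeta> - z) * (\<zeta> - w))) \<in> borel_measurable \<mu>"
      using zw by (intro continuous_measurable_on[OF \<mu>] continuous_intros) auto
    define c where "c = (1 - norm w) / 2"
    have c: "0 < c" "c \<le> 1 - norm w" unfolding c_def using zw by auto
    have norm_le: "c \<le> 1 - norm z" if "z \<in> ball w c" for z
      using norm_triangle_ineq2[of z w] that unfolding c_def by (simp add: dist_norm norm_minus_commute)
    show "\<exists>e C. 0 < e \<and> ball w e \<subseteq> ball 0 1 \<and> (\<forall>z\<in>ball w e. \<forall>\<zeta>\<in>sphere 0 1. norm (\<zeta> / ((\<zeta> - z) * (\<zeta> - w))) \<le> C)"
    proof (intro exI conjI ballI)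
      show "ball w c \<subseteq> ball 0 1" using norm_le c(1) by force
      fix z \<zeta> assume z: "z \<in> ball w c" and \<zeta>: "\<zeta> \<in> sphere (0::complex) 1"
      have "c * c \<le> norm (\<zeta> - z) * norm (\<zeta> - w)"
        using herglotz_denominator(1)[OF \<zeta> c(1) norm_le[OF z]] herglotz_denominator(1)[OF \<zeta> c] c(1)
        by (intro mult_mono) auto
      then show "norm (\<zeta> / ((\<zeta> - z) * (\<zeta> - w))) \<le> 1 / (c * c)"
        unfolding norm_divide norm_mult using c(1) \<zeta> by (intro frac_le) auto
    qed (rule c(1))
    assume \<zeta>: "\<zeta> \<in> sphere 0 1"
    then have nz: "\<zeta> - z \<noteq> 0" "\<zeta> - w \<noteq> 0" using zw by auto
    then show "z / (\<zeta> - z) - w / (\<zeta> - w) = \<zeta> / ((\<zeta> - z) * (\<zeta> - w)) * (z - w)"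
      by (simp add: divide_simps) (simp add: algebra_simps)
    show "isCont (\<lambda>z. \<zeta> / ((\<zeta> - z) * (\<zeta> - w))) w" using nz by (intro continuous_intros) auto
  qed
  then show ?thesis by (rule holomorphic_transform) (simp add: psi_eq[OF \<mu>])
qed

lemma radial_field_psi:
  assumes "\<mu> \<in> M1_circle" "norm w < 1"
  shows "radial_field \<mu> w = w * (1 + 2 * psi \<mu> w)"
  unfolding radial_field_def psi_herglotz[OF assms] ..

lemma cayley_half:
  fixes w :: complex
  assumes "norm w < 1"
  shows "(1 + w) / (1 - w) = 1 + 2 * (w / (1 - w))"
  using one_minus_nonzero[OF assms] by (simp add: field_simps)

context
  fixes s :: "real \<Rightarrow> complex measure"
  assumes s: "s \<in> bounded_paths (sphere 0 1) M_circle"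
begin

lemma radial_mass:
  obtains M where "loewner_field (\<lambda>w. 1 - norm w) (\<lambda>t. radial_field (s t))
     (\<lambda>t a b. LINT \<zeta>|s t. (\<zeta>\<^sup>2 + (a + b) * \<zeta> - a * b) / ((\<zeta> - a) * (\<zeta> - b)))
     (\<lambda>c. 2 / c * M) (\<lambda>c. 4 / (c * c) * M)"
proof -
  obtain M where "\<And>t. 0 \<le> t \<Longrightarrow> measure (s t) (sphere 0 1) \<le> M" using bounded_path_mass[OF s] by blast
  from radial_loewner_field[OF s this] show ?thesis by (rule that)
qed

lemma radial_f_properties:
  assumes t: "0 \<le> t"
  shows radial_f_holomorphic: "radial_f s t holomorphic_on ball 0 1"
    and radial_f_norm: "\<And>z. norm z < 1 \<Longrightarrow> norm (radial_f s t z) \<le> norm z"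
    and radial_f_eq: "\<And>T \<zeta> h. t < T \<Longrightarrow> flow_solution (ball 0 1) (\<lambda>t. radial_field (s t)) \<zeta> T h \<Longrightarrow> radial_f s t (h t) = \<zeta>"
    and radial_f_solution: "\<And>z. norm z < 1 \<Longrightarrow>
      \<exists>h T. t < T \<and> flow_solution (ball 0 1) (\<lambda>t. radial_field (s t)) (radial_f s t z) T h \<and> h t = z"
    and radial_f_continuous: "\<And>z. norm z < 1 \<Longrightarrow> continuous_on {0..} (\<lambda>t. radial_f s t z)"
    and radial_f_time_0: "\<And>z. norm z < 1 \<Longrightarrow> radial_f s 0 z = z"
proof -
  obtain M where L: "loewner_field (\<lambda>w. 1 - norm w) (\<lambda>t. radial_field (s t))
     (\<lambda>t a b. LINT \<zeta>|s t. (\<zeta>\<^sup>2 + (a + b) * \<zeta> - a * b) / ((\<zeta> - a) * (\<zeta> - b)))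
     (\<lambda>c. 2 / c * M) (\<lambda>c. 4 / (c * c) * M)" using radial_mass by blast
  note facts = loewner_field.inverse_flow_holomorphic[OF L t] loewner_field.inverse_flow_level[OF L t]
    loewner_field.inverse_flow_eq[OF L t] loewner_field.inverse_flow_solution[OF L t]
    loewner_field.inverse_flow_continuous_in_time[OF L] loewner_field.inverse_flow_0[OF L]
  note facts' = facts[unfolded unit_disc_level, folded radial_f_def]
  show "radial_f s t holomorphic_on ball 0 1" by (rule facts'(1))
  show "norm (radial_f s t z) \<le> norm z" if "norm z < 1" for z using facts'(2)[of z] that by simp
  show "radial_f s t (h t) = \<zeta>"
    if "t < T" "flow_solution (ball 0 1) (\<lambda>t. radial_field (s t)) \<zeta> T h" for T \<zeta> h
    using facts'(3)[OF that] .
  show "\<exists>h T. t < T \<and> flow_solution (ball 0 1) (\<lambda>t. radial_field (s t)) (radial_f s t z) T h \<and> h t = z"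
    if "norm z < 1" for z
  proof (rule facts'(4)[of z])
    show "z \<in> ball 0 1" using that by simp
  qed blast
  show "continuous_on {0..} (\<lambda>t. radial_f s t z)" if "norm z < 1" for z using facts'(5)[of z] that by simp
  show "radial_f s 0 z = z" if "norm z < 1" for z using facts'(6)[of z] that by simp
qed

text \<open>The constant curve 0 is a trajectory.\<close>

lemma radial_f_0:
  assumes t: "0 \<le> t"
  shows "radial_f s t 0 = 0"
proof -
  have "flow_solution (ball 0 1) (\<lambda>t. radial_field (s t)) 0 (t + 1) (\<lambda>_. 0)"
    unfolding flow_solution_def radial_field_def using t by simp
  from radial_f_eq[OF t _ this] show ?thesis by simp
qed

lemma radial_f_less_1: "0 \<le> t \<Longrightarrow> norm z < 1 \<Longrightarrow> norm (radial_f s t z) < 1"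
  using radial_f_norm by force

text \<open>\<open>(1 + f) / (1 - f) = 1 + 2 f / (1 - f)\<close> has nonnegative real part because \<open>\<bar>f\<bar> < 1\<close>, and the Herglotz
  integral of \<open>\<nu>\<close> is \<open>1 + 2 psi \<nu>\<close>.\<close>

lemma radial_measure_unique_existence:
  assumes t: "0 \<le> t"
  shows "\<exists>!\<nu>. radial_measure s t \<nu>"
proof (rule ex_ex1I)
  define f where "f = radial_f s t"
  have f: "norm (f z) < 1" if "norm z < 1" for z unfolding f_def by (rule radial_f_less_1[OF t that])
  note nz = one_minus_nonzero[OF f]
  obtain \<nu> where \<nu>: "\<nu> \<in> M1_circle" "\<And>z. norm z < 1 \<Longrightarrow> (1 + f z) / (1 - f z) = (LINT \<zeta>|\<nu>. (\<zeta> + z) / (\<zeta> - z))"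
  proof (rule herglotz_representation[of "\<lambda>z. (1 + f z) / (1 - f z)"])
    show "(\<lambda>z. (1 + f z) / (1 - f z)) holomorphic_on ball 0 1"
      unfolding f_def using nz[unfolded f_def] by (intro holomorphic_intros radial_f_holomorphic[OF t]) auto
    show "0 \<le> Re ((1 + f z) / (1 - f z))" if "norm z < 1" for z
      using Re_herglotz[of 1 "f z"] f[OF that] by (simp add: abs_square_le_1)
    show "(1 + f 0) / (1 - f 0) = 1" unfolding f_def radial_f_0[OF t] by simp
  qed blast
  have "f z / (1 - f z) = psi \<nu> z" if z: "norm z < 1" for z
    using \<nu>(2)[OF z] unfolding psi_herglotz[OF \<nu>(1) z] cayley_half[OF f[OF z]]
      add_left_cancel mult_cancel_left by simp
  then show "\<exists>\<nu>. radial_measure s t \<nu>" using \<nu>(1) unfolding radial_measure_def f_def by auto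
  fix \<mu> \<nu> assume "radial_measure s t \<mu>" "radial_measure s t \<nu>"
  then show "\<mu> = \<nu>" unfolding radial_measure_def by (intro psi_injective) auto
qed

lemma RL_radial_measure: "0 \<le> t \<Longrightarrow> radial_measure s t (RL s t)"
  unfolding RL_def by (rule theI'[OF radial_measure_unique_existence])

lemma RL_M1_circle: "0 \<le> t \<Longrightarrow> RL s t \<in> M1_circle"
  using RL_radial_measure unfolding radial_measure_def by blast

lemma RL_psi: "0 \<le> t \<Longrightarrow> norm z < 1 \<Longrightarrow> psi (RL s t) z = radial_f s t z / (1 - radial_f s t z)"
  using RL_radial_measure[of t] unfolding radial_measure_def by simp

lemma RL_eqI:
  assumes "0 \<le> t" "\<nu> \<in> M1_circle" "\<And>z. norm z < 1 \<Longrightarrow> psi \<nu> z = radial_f s t z / (1 - radial_f s t z)"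
  shows "RL s t = \<nu>"
  by (rule psi_injective[OF RL_M1_circle[OF assms(1)] assms(2)]) (simp add: RL_psi[OF assms(1)] assms(3))

lemma RL_path: "RL s \<in> paths (sphere 0 1) M1_circle"
  unfolding paths_iff
proof (intro conjI allI impI)
  show "RL s t \<in> M1_circle" if "0 \<le> t" for t using RL_M1_circle[OF that] .
  fix \<phi> :: "complex \<Rightarrow> real" assume \<phi>: "continuous_on (sphere 0 1) \<phi> \<and> bounded (\<phi> ` sphere 0 1)"
  show "continuous_on {0..} (\<lambda>t. LINT x|RL s t. \<phi> x)"
    unfolding continuous_on_sequentially
  proof (intro allI ballI impI)
    fix X and t :: real assume "t \<in> {0..}" and X: "(\<forall>n. X n \<in> {0..}) \<and> X \<longlonglongrightarrow> t"
    then have t: "0 \<le> t" and X': "\<And>n. 0 \<le> X n" by auto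
    have "(\<lambda>n. LINT x|RL s (X n). \<phi> x) \<longlonglongrightarrow> (LINT x|RL s t. \<phi> x)"
    proof (rule circle_weak_convergence)
      show "RL s (X n) \<in> M1_circle" for n by (rule RL_M1_circle[OF X'])
      show "RL s t \<in> M1_circle" by (rule RL_M1_circle[OF t])
      show "continuous_on (sphere 0 1) \<phi>" using \<phi> by simp
      fix z :: complex assume z: "norm z < 1"
      have "(\<lambda>n. radial_f s (X n) z) \<longlonglongrightarrow> radial_f s t z"
        using radial_f_continuous[OF order_refl z, unfolded continuous_on_sequentially] t X by (auto simp: o_def)
      moreover have "1 - radial_f s t z \<noteq> 0" by (rule one_minus_nonzero[OF radial_f_less_1[OF t z]])
      ultimately show "(\<lambda>n. psi (RL s (X n)) z) \<longlonglongrightarrow> psi (RL s t) z"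
        unfolding RL_psi[OF X' z] RL_psi[OF t z] by (intro tendsto_intros)
    qed
    then show "((\<lambda>t. LINT x|RL s t. \<phi> x) \<circ> X) \<longlonglongrightarrow> (LINT x|RL s t. \<phi> x)" by (simp add: o_def)
  qed
qed

lemma RL_0: "RL s 0 = return (restrict_space borel (sphere 0 1)) 1"
  by (rule RL_eqI[OF order_refl return_M1_circle]) (simp add: psi_return radial_f_time_0[OF order_refl])

end

section \<open>Fixed points of the radial map\<close>

text \<open>The trajectory of the point \<open>\<zeta>\<close> under a fixed point of the radial map.\<close>

definition radial_orbit :: "real \<Rightarrow> complex \<Rightarrow> complex" where
  "radial_orbit t \<zeta> = \<zeta> * exp (of_real t * ((1 + \<zeta>) / (1 - \<zeta>)))"

lemma radial_orbit_deriv: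
  "((\<lambda>t. radial_orbit t \<zeta>) has_vector_derivative radial_orbit t \<zeta> * ((1 + \<zeta>) / (1 - \<zeta>))) (at t within S)"
proof -
  define c where "c = (1 + \<zeta>) / (1 - \<zeta>)"
  have "((\<lambda>w. \<zeta> * exp (w * c)) has_field_derivative \<zeta> * (exp (of_real t * c) * c)) (at (of_real t))"
    by (auto intro!: derivative_eq_intros)
  from has_vector_derivative_real_field[OF this, of S] show ?thesis
    unfolding radial_orbit_def c_def[symmetric] by (simp add: mult.assoc)
qed

lemma radial_orbit_holomorphic: "radial_orbit t holomorphic_on ball 0 1"
  unfolding radial_orbit_def by (intro holomorphic_intros) auto

text \<open>For \<open>\<bar>\<zeta>\<bar> \<le> 1/2\<close> the exponent is bounded by 3 per unit of time, hence the radius \<open>exp (- 3 * T) / 2\<close>.\<close>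

lemma radial_orbit_in_disc:
  assumes t: "0 \<le> t" "t \<le> T" and \<zeta>: "norm \<zeta> < exp (- 3 * T) / 2"
  shows "norm (radial_orbit t \<zeta>) < 1"
proof -
  have T: "0 \<le> T" using t by simp
  then have "exp (- 3 * T) \<le> 1" by simp
  then have half: "norm \<zeta> \<le> 1 / 2" using \<zeta> by linarith
  have "norm (1 + \<zeta>) \<le> 3 / 2" "1 / 2 \<le> norm (1 - \<zeta>)"
    using norm_triangle_ineq[of 1 \<zeta>] norm_triangle_ineq2[of 1 \<zeta>] half by auto
  then have "norm ((1 + \<zeta>) / (1 - \<zeta>)) \<le> (3 / 2) / (1 / 2)"
    unfolding norm_divide by (intro frac_le) auto
  then have "norm (of_real t * ((1 + \<zeta>) / (1 - \<zeta>))) \<le> T * 3"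
    unfolding norm_mult using t T by (intro mult_mono) auto
  then have "norm (exp (of_real t * ((1 + \<zeta>) / (1 - \<zeta>)))) \<le> exp (T * 3)"
    using norm_exp order_trans exp_le_cancel_iff by blast
  then have "norm (radial_orbit t \<zeta>) \<le> norm \<zeta> * exp (T * 3)"
    unfolding radial_orbit_def norm_mult by (intro mult_left_mono) auto
  also have "\<dots> \<le> exp (- 3 * T) / 2 * exp (T * 3)" using \<zeta> by (intro mult_right_mono) auto
  also have "\<dots> = 1 / 2"
  proof -
    have "exp (- 3 * T) * exp (T * 3) = 1" unfolding exp_add[symmetric] by simp
    then show ?thesis by simp
  qed
  finally show ?thesis by simp
qed

text \<open>For a fixed point, \<open>1 + 2 psi\<close> at time \<open>\<tau>\<close> along the trajectory from \<open>\<zeta>\<close> is the constant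
  \<open>c = (1 + \<zeta>) / (1 - \<zeta>)\<close>. So \<open>h\<close> solves the linear equation \<open>h' = c h\<close>.\<close>

lemma radial_fixed_orbit:
  assumes s: "s \<in> bounded_paths (sphere 0 1) M_circle" and fixed: "\<And>t. 0 \<le> t \<Longrightarrow> RL s t = s t"
    and t: "0 \<le> t" and z: "norm z < 1"
  shows "radial_orbit t (radial_f s t z) = z"
proof -
  define \<zeta> where "\<zeta> = radial_f s t z"
  define c where "c = (1 + \<zeta>) / (1 - \<zeta>)"
  have \<zeta>1: "norm \<zeta> < 1" unfolding \<zeta>_def by (rule radial_f_less_1[OF s t z])
  obtain h T where h: "t < T" "flow_solution (ball 0 1) (\<lambda>t. radial_field (s t)) \<zeta> T h" "h t = z"
    using radial_f_solution[OF s t z] unfolding \<zeta>_def by blast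
  have h0: "h 0 = \<zeta>" and h_disc: "\<And>\<tau>. \<tau> \<in> {0..<T} \<Longrightarrow> norm (h \<tau>) < 1"
    using h(2) unfolding flow_solution_def by auto
  have "((\<lambda>_. 0) has_integral (h t * exp (- of_real t * c) - h 0 * exp (- of_real 0 * c))) {0..t}"
  proof (rule fundamental_theorem_of_calculus[OF t])
    fix \<tau> assume \<tau>: "\<tau> \<in> {0..t}"
    then have \<tau>': "0 \<le> \<tau>" "\<tau> < T" "\<tau> \<in> {0..<T}" using h(1) by auto
    note disc = h_disc[OF \<tau>'(3)]
    have M1: "s \<tau> \<in> M1_circle" using RL_M1_circle[OF s \<tau>'(1)] fixed[OF \<tau>'(1)] by simp
    have "psi (s \<tau>) (h \<tau>) = \<zeta> / (1 - \<zeta>)"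
      using RL_psi[OF s \<tau>'(1) disc] unfolding fixed[OF \<tau>'(1)] radial_f_eq[OF s \<tau>'(1,2) h(2)] .
    then have V: "radial_field (s \<tau>) (h \<tau>) = h \<tau> * c"
      unfolding radial_field_psi[OF M1 disc] c_def cayley_half[OF \<zeta>1] by simp
    have "(h has_vector_derivative h \<tau> * c) (at \<tau> within {0..<T})"
      using h(2) \<tau>'(3) unfolding flow_solution_def V[symmetric] by blast
    then have 1: "(h has_vector_derivative h \<tau> * c) (at \<tau> within {0..t})"
      by (rule has_vector_derivative_within_subset) (use h(1) in auto)
    have "((\<lambda>w. exp (- w * c)) has_field_derivative exp (- of_real \<tau> * c) * (- c)) (at (of_real \<tau>))"
      by (auto intro!: derivative_eq_intros)
    from has_vector_derivative_mult[OF 1 has_vector_derivative_real_field[OF this, of "{0..t}"]]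
    show "((\<lambda>\<tau>. h \<tau> * exp (- of_real \<tau> * c)) has_vector_derivative 0) (at \<tau> within {0..t})"
      by simp
  qed
  then have "h t * exp (- of_real t * c) = \<zeta>"
    using has_integral_unique[OF has_integral_0] h0 by simp
  then have "h t = \<zeta> * exp (of_real t * c)" by (simp add: exp_minus field_simps)
  then show ?thesis unfolding radial_orbit_def \<zeta>_def[symmetric] c_def[symmetric] h(3) by simp
qed

text \<open>The form in which fixed points and S-transforms are compared. Only the germ at 0 enters, as in the
  S-transform.\<close>

definition orbit_law :: "complex measure \<Rightarrow> real \<Rightarrow> bool" where
  "orbit_law \<mu> t \<longleftrightarrow> (\<forall>\<^sub>F \<zeta> in nhds 0. psi \<mu> (radial_orbit t \<zeta>) = \<zeta> / (1 - \<zeta>))"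

text \<open>\<open>radial_orbit t\<close> inverts \<open>f\<^sub>t\<close> on the range of \<open>f\<^sub>t\<close>, and this range is a neighbourhood of 0.\<close>

lemma fixed_orbit_law:
  assumes s: "s \<in> bounded_paths (sphere 0 1) M_circle" and fixed: "\<And>t. 0 \<le> t \<Longrightarrow> RL s t = s t"
    and t: "0 \<le> t"
  shows "orbit_law (s t) t"
proof -
  define f where "f = radial_f s t"
  have inj: "inj_on f (ball 0 1)"
    using radial_fixed_orbit[OF s fixed t] unfolding f_def by (intro inj_on_inverseI[of _ "radial_orbit t"]) simp
  have op: "open (f ` ball 0 1)"
    using open_mapping_thm3[OF radial_f_holomorphic[OF s t] open_ball inj[unfolded f_def]] unfolding f_def .
  have "0 \<in> f ` ball 0 1" using radial_f_0[OF s t] unfolding f_def by (intro image_eqI[of _ _ 0]) auto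
  from eventually_nhds_in_open[OF op this] show ?thesis
    unfolding orbit_law_def
  proof (rule eventually_mono)
    fix \<zeta> assume "\<zeta> \<in> f ` ball 0 1"
    then obtain z where z: "norm z < 1" "\<zeta> = f z" by auto
    have "psi (s t) z = f z / (1 - f z)" using RL_psi[OF s t z(1)] unfolding fixed[OF t] f_def .
    then show "psi (s t) (radial_orbit t \<zeta>) = \<zeta> / (1 - \<zeta>)"
      unfolding z(2) using radial_fixed_orbit[OF s fixed t z(1)] unfolding f_def by simp
  qed
qed

text \<open>The law holds for germs only, but for times up to \<open>t + 1\<close> the orbits of all points of a common disc of radius \<open>r\<close> stay
  in the unit disc, and analytic continuation extends the law to this disc. Then these orbits solve the
  Loewner equation past time \<open>t\<close>, so that \<open>f\<^sub>t\<close> inverts \<open>radial_orbit t\<close>, and the identity \<open>psi = f\<^sub>t / (1 - f\<^sub>t)\<close> extends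
  from the open image of the disc of radius \<open>r\<close> to the unit disc.\<close>

lemma orbit_law_fixed:
  assumes s: "s \<in> bounded_paths (sphere 0 1) M_circle" and M1: "\<And>t. 0 \<le> t \<Longrightarrow> s t \<in> M1_circle"
    and law: "\<And>t. 0 \<le> t \<Longrightarrow> orbit_law (s t) t" and t: "0 \<le> t"
  shows "RL s t = s t"
proof (rule RL_eqI[OF s t M1[OF t]])
  define r where "r = exp (- 3 * (t + 1)) / 2"
  have "exp (- 3 * (t + 1)) \<le> 1" using t by simp
  then have r: "0 < r" "r < 1" unfolding r_def using exp_gt_zero[of "- 3 * (t + 1)"] by linarith+
  have disc: "norm (radial_orbit \<tau> \<zeta>) < 1" if "0 \<le> \<tau>" "\<tau> \<le> t + 1" "norm \<zeta> < r" for \<tau> \<zeta>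
    using radial_orbit_in_disc[of \<tau> "t + 1" \<zeta>] that unfolding r_def by simp
  have psi_orbit: "psi (s \<tau>) (radial_orbit \<tau> \<zeta>) = \<zeta> / (1 - \<zeta>)" if \<tau>: "0 \<le> \<tau>" "\<tau> \<le> t + 1" and \<zeta>: "norm \<zeta> < r" for \<tau> \<zeta>
  proof -
    have "\<exists>S. open S \<and> 0 \<in> S \<and> (\<forall>\<zeta>\<in>S. psi (s \<tau>) (radial_orbit \<tau> \<zeta>) = \<zeta> / (1 - \<zeta>))"
      using law[OF \<tau>(1)] unfolding orbit_law_def eventually_nhds .
    then obtain S where S: "open S" "0 \<in> S" and S_law: "\<forall>\<zeta>\<in>S. psi (s \<tau>) (radial_orbit \<tau> \<zeta>) = \<zeta> / (1 - \<zeta>)"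
      by (elim exE conjE)
    have sub: "ball 0 r \<subseteq> (ball 0 1 :: complex set)" using r by auto
    show ?thesis
    proof (rule analytic_continuation_open[of "S \<inter> ball 0 r" "ball 0 r" "\<lambda>\<zeta>. psi (s \<tau>) (radial_orbit \<tau> \<zeta>)" "\<lambda>\<zeta>. \<zeta> / (1 - \<zeta>)" \<zeta>])
      show "S \<inter> ball 0 r \<noteq> {}" using S(2) r by auto
      have "radial_orbit \<tau> ` ball 0 r \<subseteq> ball 0 1" using disc[OF \<tau>] by auto
      from holomorphic_on_compose_gen[OF holomorphic_on_subset[OF radial_orbit_holomorphic sub]
          psi_holomorphic[OF prob_measures_onD(1)[OF M1[OF \<tau>(1)]]] this]
      show "(\<lambda>\<zeta>. psi (s \<tau>) (radial_orbit \<tau> \<zeta>)) holomorphic_on ball 0 r" by (simp add: o_def)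
      show "(\<lambda>\<zeta>. \<zeta> / (1 - \<zeta>)) holomorphic_on ball 0 r"
        using r by (intro holomorphic_intros) auto
      show "open (S \<inter> ball 0 r)" "connected (ball (0::complex) r)" "\<zeta> \<in> ball 0 r" "S \<inter> ball 0 r \<subseteq> ball 0 r"
        using S(1) \<zeta> by auto
      show "psi (s \<tau>) (radial_orbit \<tau> w) = w / (1 - w)" if "w \<in> S \<inter> ball 0 r" for w
        by (rule S_law[rule_format]) (use that in simp)
    qed simp
  qed
  have inverse: "radial_f s t (radial_orbit t \<zeta>) = \<zeta>" if \<zeta>: "norm \<zeta> < r" for \<zeta>
  proof (rule radial_f_eq[OF s t, of "t + 1"])
    show "flow_solution (ball 0 1) (\<lambda>t. radial_field (s t)) \<zeta> (t + 1) (\<lambda>\<tau>. radial_orbit \<tau> \<zeta>)"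
      unfolding flow_solution_def
    proof (intro conjI ballI)
      show "radial_orbit 0 \<zeta> = \<zeta>" unfolding radial_orbit_def by simp
      fix \<tau> assume "\<tau> \<in> {0..<t + 1}"
      then have \<tau>: "0 \<le> \<tau>" "\<tau> \<le> t + 1" by auto
      show "radial_orbit \<tau> \<zeta> \<in> ball 0 1" using disc[OF \<tau> \<zeta>] by simp
      have "norm \<zeta> < 1" using \<zeta> r by simp
      then have "radial_field (s \<tau>) (radial_orbit \<tau> \<zeta>) = radial_orbit \<tau> \<zeta> * ((1 + \<zeta>) / (1 - \<zeta>))"
        unfolding radial_field_psi[OF M1[OF \<tau>(1)] disc[OF \<tau> \<zeta>]] psi_orbit[OF \<tau> \<zeta>] by (simp only: cayley_half)
      then show "((\<lambda>\<tau>. radial_orbit \<tau> \<zeta>) has_vector_derivative radial_field (s \<tau>) (radial_orbit \<tau> \<zeta>)) (at \<tau> within {0..<t + 1})"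
        using radial_orbit_deriv by simp
    qed (use t in simp)
  qed simp
  define f where "f = radial_f s t"
  have sub: "ball 0 r \<subseteq> (ball 0 1 :: complex set)" using r by auto
  have inj: "inj_on (radial_orbit t) (ball 0 r)" by (rule inj_on_inverseI[of _ "radial_f s t"]) (simp add: inverse)
  fix z :: complex assume z: "norm z < 1"
  have "psi (s t) z = f z / (1 - f z)"
  proof (rule analytic_continuation_open[of "radial_orbit t ` ball 0 r" "ball 0 1" "psi (s t)" "\<lambda>z. f z / (1 - f z)" z])
    show "open (radial_orbit t ` ball 0 r)"
      by (rule open_mapping_thm3[OF holomorphic_on_subset[OF radial_orbit_holomorphic sub] open_ball inj])
    show "radial_orbit t ` ball 0 r \<noteq> {}" using r by simp
    show "radial_orbit t ` ball 0 r \<subseteq> ball 0 1" using disc[OF t] by auto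
    show "psi (s t) holomorphic_on ball 0 1" by (rule psi_holomorphic[OF prob_measures_onD(1)[OF M1[OF t]]])
    show "(\<lambda>z. f z / (1 - f z)) holomorphic_on ball 0 1"
      unfolding f_def using one_minus_nonzero[OF radial_f_less_1[OF s t]]
      by (intro holomorphic_intros radial_f_holomorphic[OF s t]) auto
    show "psi (s t) w = f w / (1 - f w)" if "w \<in> radial_orbit t ` ball 0 r" for w
      using that psi_orbit[OF t] inverse unfolding f_def by auto
  qed (use z in auto)
  then show "psi (s t) z = radial_f s t z / (1 - radial_f s t z)" unfolding f_def .
qed

section \<open>The S-transform of the fixed point\<close>

lemma psi_0: "psi \<mu> 0 = 0"
  unfolding psi_def by simp

text \<open>The first moment is the conjugate of the mean.\<close>

lemma psi_deriv_0:
  assumes \<mu>: "\<mu> \<in> M1_circle"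
  shows "(psi \<mu> has_field_derivative cnj (LINT \<zeta>|\<mu>. \<zeta>)) (at 0)"
proof -
  have m: "moment \<mu> 1 = cnj (LINT \<zeta>|\<mu>. \<zeta>)" unfolding moment_def by simp
  have "((\<lambda>z. (psi \<mu> z - psi \<mu> 0) / (z - 0) - moment \<mu> 1) \<longlongrightarrow> 0) (at 0)"
  proof (rule Lim_null_comparison)
    have "\<forall>\<^sub>F z in at 0. z \<in> ball (0::complex) (1 / 2)" by (intro eventually_at_in_open') auto
    then show "\<forall>\<^sub>F z in at 0. norm ((psi \<mu> z - psi \<mu> 0) / (z - 0) - moment \<mu> 1) \<le> 2 * norm z"
      using eventually_neq_at_within[of 0]
    proof eventually_elim
      case (elim z)
      have "norm (psi \<mu> z - moment \<mu> 1 * z) \<le> 2 * norm z ^ 2"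
        using psi_moment_expansion[OF \<mu>, of z 1] elim by (simp add: power2_eq_square)
      then have "norm ((psi \<mu> z - moment \<mu> 1 * z) / z) \<le> 2 * norm z"
        using elim by (simp add: norm_divide divide_le_eq power2_eq_square)
      then show ?case using elim by (simp add: psi_0 diff_divide_distrib)
    qed
    have "((\<lambda>z::complex. 2 * norm z) \<longlongrightarrow> 2 * norm (0::complex)) (at 0)" by (intro tendsto_intros)
    then show "((\<lambda>z::complex. 2 * norm z) \<longlongrightarrow> 0) (at 0)" by simp
  qed
  then show ?thesis unfolding has_field_derivative_iff m[symmetric] by (simp only: LIM_zero_iff)
qed

lemma fps_inv_unique:
  fixes a b :: "'a::field fps"
  assumes "a $ 0 = 0" "a $ 1 \<noteq> 0" "b $ 0 = 0" "a oo b = fps_X"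
  shows "fps_inv a = b"
proof -
  have inv0: "fps_inv a $ 0 = 0" by (simp add: fps_inv_def)
  have "b = (fps_inv a oo a) oo b" unfolding fps_inv[OF assms(1,2)] using assms(3) by simp
  also have "\<dots> = fps_inv a oo fps_X" unfolding assms(4)[symmetric] by (rule fps_compose_assoc[OF assms(3,1), symmetric])
  finally show ?thesis by simp
qed

text \<open>In terms of power series at 0, with \<open>P\<close> for \<open>psi\<close> and \<open>C\<close> for \<open>\<kappa> u = u / (1 + u) * exp (t * (1 + 2 * u))\<close>, the
  orbit law says \<open>P oo C = fps_X\<close>. This is equivalent to \<open>fps_inv P = C\<close> together with nonzero mean, the
  latter because comparing linear coefficients gives \<open>P $ 1 * C $ 1 = 1\<close>. Finally
  \<open>(1 + u) \<kappa> u = u exp (2 t (u + 1/2))\<close> turns \<open>C\<close> into the prescribed S-transform.\<close>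

lemma S_transform_orbit_law:
  assumes \<mu>: "\<mu> \<in> M1_circle"
  shows "has_S_transform \<mu> (\<lambda>z. exp (2 * of_real t * (z + 1 / 2))) \<longleftrightarrow> orbit_law \<mu> t"
proof -
  \<comment> \<open>In the coordinate \<open>u = \<zeta> / (1 - \<zeta>)\<close> the orbit law says that \<open>\<kappa>\<close> is a right inverse of \<open>psi\<close>.\<close>
  define \<kappa> where "\<kappa> u = u / (1 + u) * exp (of_real t * (1 + 2 * u))" for u :: complex
  define P where "P = fps_expansion (psi \<mu>) 0"
  define C where "C = fps_expansion \<kappa> 0"
  define S where "S = fps_expansion (\<lambda>z. exp (2 * of_real t * (z + 1 / 2))) 0"
  have P: "psi \<mu> has_fps_expansion P" unfolding P_def
    by (rule has_fps_expansion_fps_expansion[OF open_ball _ psi_holomorphic[OF prob_measures_onD(1)[OF \<mu>]]]) simp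
  have nz: "1 + u \<noteq> 0" if "norm u < 1" for u :: complex using one_minus_nonzero[of "- u"] that by simp
  have C: "\<kappa> has_fps_expansion C" unfolding C_def
  proof (rule has_fps_expansion_fps_expansion[of "ball 0 1"])
    show "\<kappa> holomorphic_on ball 0 1" unfolding \<kappa>_def using nz by (intro holomorphic_intros) auto
  qed auto
  have S: "(\<lambda>z. exp (2 * of_real t * (z + 1 / 2))) has_fps_expansion S" unfolding S_def
    by (rule has_fps_expansion_fps_expansion[of UNIV]) (auto intro!: holomorphic_intros)
  have P0: "P $ 0 = 0" using has_fps_expansion_imp_0_eq_fps_nth_0[OF P] psi_0 by simp
  have C0: "C $ 0 = 0" using has_fps_expansion_imp_0_eq_fps_nth_0[OF C] by (simp add: \<kappa>_def)
  have P1: "P $ 1 = cnj (LINT \<zeta>|\<mu>. \<zeta>)"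
    using DERIV_imp_deriv[OF psi_deriv_0[OF \<mu>]] unfolding P_def fps_expansion_def by simp
  have small: "\<forall>\<^sub>F u in nhds 0. norm (u::complex) < 1"
    using eventually_nhds_in_open[of "ball 0 1" "0::complex"] by simp
  have SC: "(1 + fps_X) * C = fps_X * S"
  proof (rule fps_expansion_unique_complex)
    show "(\<lambda>u. (1 + u) * \<kappa> u) has_fps_expansion (1 + fps_X) * C"
      by (intro fps_expansion_intros C)
    have "(\<lambda>u. u * exp (2 * of_real t * (u + 1 / 2))) has_fps_expansion fps_X * S"
      by (intro fps_expansion_intros S)
    moreover have eq: "\<forall>\<^sub>F u in nhds 0. (1 + u) * \<kappa> u = u * exp (2 * of_real t * (u + 1 / 2))"
      using small
    proof eventually_elim
      case (elim u)
      have "2 * of_real t * (u + 1 / 2) = of_real t * (1 + 2 * u)" by (simp add: algebra_simps)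
      then show ?case unfolding \<kappa>_def using nz[OF elim] by (simp only:) simp
    qed
    ultimately show "(\<lambda>u. (1 + u) * \<kappa> u) has_fps_expansion fps_X * S"
      unfolding has_fps_expansion_cong[OF eq refl] by blast
  qed
  have inv0: "fps_inv P $ 0 = 0" by (simp add: fps_inv_def)
  have "orbit_law \<mu> t \<longleftrightarrow> (\<forall>\<^sub>F u in nhds 0. psi \<mu> (\<kappa> u) = u)"
  proof -
    define \<omega> where "\<omega> \<zeta> = \<zeta> / (1 - \<zeta>)" for \<zeta> :: complex
    define \<omega>' where "\<omega>' u = u / (1 + u)" for u :: complex
    have \<omega>: "\<kappa> (\<omega> \<zeta>) = radial_orbit t \<zeta>" if "norm \<zeta> < 1" for \<zeta>
    proof -
      have "1 + \<omega> \<zeta> = 1 / (1 - \<zeta>)" unfolding \<omega>_def using one_minus_nonzero[OF that] by (simp add: field_simps)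
      then have "\<omega> \<zeta> / (1 + \<omega> \<zeta>) = \<zeta>" unfolding \<omega>_def using one_minus_nonzero[OF that] by simp
      then show ?thesis unfolding \<kappa>_def radial_orbit_def cayley_half[OF that] \<omega>_def by simp
    qed
    have \<omega>': "\<omega> (\<omega>' u) = u" if "norm u < 1" for u
    proof -
      have "1 - \<omega>' u = 1 / (1 + u)" unfolding \<omega>'_def using nz[OF that] by (simp add: field_simps)
      then show ?thesis unfolding \<omega>_def \<omega>'_def using nz[OF that] by simp
    qed
    have "isCont \<omega> 0" "isCont \<omega>' 0" unfolding \<omega>_def \<omega>'_def by (intro continuous_intros; simp)+
    then have lim: "filterlim \<omega> (nhds 0) (nhds 0)" "filterlim \<omega>' (nhds 0) (nhds 0)"
      unfolding isCont_def tendsto_at_iff_tendsto_nhds by (simp_all add: \<omega>_def \<omega>'_def)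
    show ?thesis
    proof
      assume "orbit_law \<mu> t"
      then have "\<forall>\<^sub>F u in nhds 0. psi \<mu> (radial_orbit t (\<omega>' u)) = \<omega> (\<omega>' u)"
        unfolding orbit_law_def \<omega>_def[symmetric] by (rule eventually_compose_filterlim[OF _ lim(2)])
      moreover have "\<forall>\<^sub>F u in nhds 0. norm (\<omega>' u) < 1" by (rule eventually_compose_filterlim[OF small lim(2)])
      ultimately show "\<forall>\<^sub>F u in nhds 0. psi \<mu> (\<kappa> u) = u"
        using small
      proof eventually_elim
        case (elim u)
        then show ?case using \<omega>[of "\<omega>' u"] \<omega>'[of u] by simp
      qed
    next
      assume "\<forall>\<^sub>F u in nhds 0. psi \<mu> (\<kappa> u) = u"
      then have "\<forall>\<^sub>F \<zeta> in nhds 0. psi \<mu> (\<kappa> (\<omega> \<zeta>)) = \<omega> \<zeta>"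
        by (rule eventually_compose_filterlim[OF _ lim(1)])
      then show "orbit_law \<mu> t"
        unfolding orbit_law_def using small
      proof eventually_elim
        case (elim \<zeta>)
        then show ?case using \<omega>[of \<zeta>] unfolding \<omega>_def by simp
      qed
    qed
  qed
  also have "\<dots> \<longleftrightarrow> P oo C = fps_X"
  proof -
    have comp: "(\<lambda>u. psi \<mu> (\<kappa> u)) has_fps_expansion (P oo C)"
      using has_fps_expansion_compose[OF P C C0] by (simp add: o_def)
    show ?thesis
    proof
      assume "\<forall>\<^sub>F u in nhds 0. psi \<mu> (\<kappa> u) = u"
      from has_fps_expansion_cong[OF this refl]
      have "(\<lambda>u. psi \<mu> (\<kappa> u)) has_fps_expansion fps_X" by (simp add: has_fps_expansion_fps_X)
      from fps_expansion_unique_complex[OF comp this] show "P oo C = fps_X" .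
    next
      assume "P oo C = fps_X"
      with comp have "\<forall>\<^sub>F u in nhds 0. eval_fps fps_X u = psi \<mu> (\<kappa> u)"
        unfolding has_fps_expansion_def by simp
      then show "\<forall>\<^sub>F u in nhds 0. psi \<mu> (\<kappa> u) = u" by (rule eventually_mono) simp
    qed
  qed
  also have "\<dots> \<longleftrightarrow> P $ 1 \<noteq> 0 \<and> fps_inv P = C"
  proof
    assume eq: "P oo C = fps_X"
    have "P $ 1 * C $ 1 = 1"
    proof -
      have "(P oo C) $ 1 = P $ 1 * C $ 1"
        unfolding fps_compose_nth using C0 by (simp add: sum.atLeast_Suc_atMost)
      then show ?thesis unfolding eq by simp
    qed
    then have "P $ 1 \<noteq> 0" by auto
    then show "P $ 1 \<noteq> 0 \<and> fps_inv P = C" using fps_inv_unique[OF P0 _ C0 eq] by simp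
  next
    assume "P $ 1 \<noteq> 0 \<and> fps_inv P = C"
    then show "P oo C = fps_X" using fps_inv_right[OF P0] by auto
  qed
  also have "\<dots> \<longleftrightarrow> P $ 1 \<noteq> 0 \<and> ((1 + fps_X) * fps_inv P) / fps_X = S"
  proof -
    have "((1 + fps_X) * fps_inv P) / fps_X = S \<longleftrightarrow> (1 + fps_X) * fps_inv P = fps_X * S"
    proof
      define A where "A = (1 + fps_X) * fps_inv P"
      have "A = fps_X * fps_shift 1 A"
      proof (rule fps_ext)
        fix n show "A $ n = (fps_X * fps_shift 1 A) $ n"
          using inv0 by (cases n) (simp_all add: A_def)
      qed
      then have "fps_X dvd A" by (rule dvdI)
      from dvd_mult_div_cancel[OF this]
      show "(1 + fps_X) * fps_inv P = fps_X * S" if "((1 + fps_X) * fps_inv P) / fps_X = S"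
        unfolding A_def that by (rule sym)
      show "((1 + fps_X) * fps_inv P) / fps_X = S" if "(1 + fps_X) * fps_inv P = fps_X * S"
        unfolding that by (rule nonzero_mult_div_cancel_left) simp
    qed
    moreover have "(1 + fps_X :: complex fps) \<noteq> 0"
    proof
      assume "(1 + fps_X :: complex fps) = 0"
      then have "(1 + fps_X :: complex fps) $ 0 = 0" by simp
      then show False by simp
    qed
    ultimately show ?thesis unfolding SC[symmetric] mult_cancel_left by blast
  qed
  also have "\<dots> \<longleftrightarrow> has_S_transform \<mu> (\<lambda>z. exp (2 * of_real t * (z + 1 / 2)))"
    unfolding has_S_transform_def S_transform_def P_def[symmetric] S_def[symmetric] P1 using \<mu> by simp
  finally show ?thesis by simp
qed

lemma radial_fixed_iff:
  assumes s: "s \<in> bounded_paths (sphere 0 1) M_circle"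
  shows "(\<forall>t\<ge>0. RL s t = s t) \<longleftrightarrow> (\<forall>t\<ge>0. has_S_transform (s t) (\<lambda>z. exp (2 * complex_of_real t * (z + 1 / 2))))"
proof
  assume fixed: "\<forall>t\<ge>0. RL s t = s t"
  show "\<forall>t\<ge>0. has_S_transform (s t) (\<lambda>z. exp (2 * complex_of_real t * (z + 1 / 2)))"
  proof (intro allI impI)
    fix t :: real assume t: "0 \<le> t"
    have M1: "s t \<in> M1_circle" using RL_M1_circle[OF s t] fixed t by simp
    have "orbit_law (s t) t" by (rule fixed_orbit_law[OF s _ t]) (use fixed in blast)
    then show "has_S_transform (s t) (\<lambda>z. exp (2 * complex_of_real t * (z + 1 / 2)))"
      unfolding S_transform_orbit_law[OF M1] .
  qed
next
  assume S: "\<forall>t\<ge>0. has_S_transform (s t) (\<lambda>z. exp (2 * complex_of_real t * (z + 1 / 2)))"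
  have M1: "s t \<in> M1_circle" if "0 \<le> t" for t using S that unfolding has_S_transform_def by blast
  have "orbit_law (s t) t" if "0 \<le> t" for t
    unfolding S_transform_orbit_law[OF M1[OF that], of t, symmetric] using S that by blast
  then show "\<forall>t\<ge>0. RL s t = s t" using orbit_law_fixed[OF s M1] by blast
qed

section \<open>The Loewner maps and their fixed points\<close>

theorem theorem3:
  shows
    "(\<forall>s \<in> bounded_paths UNIV M0_real.
        (\<forall>t\<ge>0. \<exists>!\<nu>. chordal_measure s t \<nu>) \<and>
        CL s \<in> paths UNIV (prob_measures_on UNIV) \<and>
        (locally_bounded_support s \<longrightarrow> CL s \<in> paths UNIV M01_real) \<and>
        CL s 0 = return borel 0) \<and>
     semicircle_law \<in> bounded_paths UNIV M0_real \<and>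
     (\<forall>s \<in> bounded_paths UNIV M0_real.
        ((\<forall>t\<ge>0. CL s t = s t) \<longleftrightarrow> (\<forall>t\<ge>0. s t = semicircle_law t)) \<and>
        ((\<forall>t\<ge>0. CL s t = s t) \<longleftrightarrow>
           (\<forall>t\<ge>0. has_R_transform (s t) (\<lambda>z. complex_of_real t * z)))) \<and>
     (\<forall>s \<in> bounded_paths (sphere 0 1) M_circle.
        (\<forall>t\<ge>0. \<exists>!\<nu>. radial_measure s t \<nu>) \<and>
        RL s \<in> paths (sphere 0 1) M1_circle \<and>
        RL s 0 = return (restrict_space borel (sphere 0 1)) 1 \<and>
        ((\<forall>t\<ge>0. RL s t = s t) \<longleftrightarrow>
           (\<forall>t\<ge>0. has_S_transform (s t)
              (\<lambda>z. exp (2 * complex_of_real t * (z + 1 / 2))))))"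
proof (intro conjI ballI allI impI)
  fix s :: "real \<Rightarrow> real measure" assume s: "s \<in> bounded_paths UNIV M0_real"
  show "\<exists>!\<nu>. chordal_measure s t \<nu>" if "0 \<le> t" for t by (rule chordal_measure_unique_existence[OF s that])
  show "CL s \<in> paths UNIV (prob_measures_on UNIV)" by (rule CL_path[OF s CL_prob[OF s]])
  show "CL s \<in> paths UNIV M01_real" if "locally_bounded_support s"
    by (rule CL_path[OF s CL_M01[OF s that]])
  show "CL s 0 = return borel 0" by (rule CL_0[OF s])
  show semicircle: "(\<forall>t\<ge>0. CL s t = s t) \<longleftrightarrow> (\<forall>t\<ge>0. s t = semicircle_law t)"
  proof
    assume "\<forall>t\<ge>0. CL s t = s t"
    then show "\<forall>t\<ge>0. s t = semicircle_law t" using fixed_semicircle[OF s] by blast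
  next
    assume "\<forall>t\<ge>0. s t = semicircle_law t"
    then show "\<forall>t\<ge>0. CL s t = s t" using semicircle_fixed[OF s] by simp
  qed
  have "(\<forall>t\<ge>0. s t = semicircle_law t) \<longleftrightarrow> (\<forall>t\<ge>0. has_R_transform (s t) (\<lambda>z. complex_of_real t * z))"
  proof
    assume "\<forall>t\<ge>0. s t = semicircle_law t"
    then show "\<forall>t\<ge>0. has_R_transform (s t) (\<lambda>z. complex_of_real t * z)" using semicircle_R_transform by simp
  next
    assume "\<forall>t\<ge>0. has_R_transform (s t) (\<lambda>z. complex_of_real t * z)"
    then show "\<forall>t\<ge>0. s t = semicircle_law t" using R_transform_semicircle by blast
  qed
  with semicircle show "(\<forall>t\<ge>0. CL s t = s t) \<longleftrightarrow> (\<forall>t\<ge>0. has_R_transform (s t) (\<lambda>z. complex_of_real t * z))"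
    by (rule trans)
next
  show "semicircle_law \<in> bounded_paths UNIV M0_real" by (rule semicircle_bounded_path)
next
  fix s :: "real \<Rightarrow> complex measure" assume s: "s \<in> bounded_paths (sphere 0 1) M_circle"
  show "\<exists>!\<nu>. radial_measure s t \<nu>" if "0 \<le> t" for t by (rule radial_measure_unique_existence[OF s that])
  show "RL s \<in> paths (sphere 0 1) M1_circle" by (rule RL_path[OF s])
  show "RL s 0 = return (restrict_space borel (sphere 0 1)) 1" by (rule RL_0[OF s])
  show "(\<forall>t\<ge>0. RL s t = s t) \<longleftrightarrow>
      (\<forall>t\<ge>0. has_S_transform (s t) (\<lambda>z. exp (2 * complex_of_real t * (z + 1 / 2))))"
    by (rule radial_fixed_iff[OF s])
qed

end
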